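(* The \textsc{Gottesman-Knill} problem is in $\oplus\mathsf{L}$. Consequently (since it is also $\oplus\mathsf{L}$-hard, as CNOT circuits are special stabilizer circuits), \textsc{Gottesman-Knill} is $\oplus\mathsf{L}$-complete under logarithmic-space reductions.
   Context: The \textsc{Gottesman-Knill} problem: the input is a number $n$ and a stabilizer circuit $\mathcal{C}$ given as a sequence of gates of the forms $\mathrm{CNOT}\ a\to b$, $\mathrm{Hadamard}\ a$, $\mathrm{Phase}\ a$ (the gate $\mathrm{diag}(1,i)$), or $\mathrm{Measure}\ a$ (measurement in the standard basis), with $a,b\in\{1,\ldots,n\}$. The question is to decide whether qubit $1$ will be $|1\rangle$ with certainty after $\mathcal{C}$ is applied to $|0\rangle^{\otimes n}$. $\oplus\mathsf{L}$ is the class of decision problems solvable by a nondeterministic logarithmic-space Turing machine that accepts iff the number of accepting computation paths is odd; equivalently, the class of problems logspace-reducible to simulating a polynomial-size circuit of NOT and CNOT gates on $|0\cdots0\rangle$ (i.e. deciding the value of a designated output bit). *)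

theory Defs
  imports Complex_Main
begin

datatype sym = S0 | S1 | SHash

datatype cell = LEnd | REnd | Sym sym

datatype dir = Lft | Rgt | Stay

fun mv :: "dir \<Rightarrow> nat \<Rightarrow> nat" where
  "mv Lft p = p - 1"
| "mv Rgt p = Suc p"
| "mv Stay p = p"

definition read_in :: "sym list \<Rightarrow> nat \<Rightarrow> cell" where
  "read_in x i = (if i = 0 then LEnd else if i \<le> length x then Sym (x ! (i - 1)) else REnd)"

definition move_in :: "sym list \<Rightarrow> dir \<Rightarrow> nat \<Rightarrow> nat" where
  "move_in x d i = min (mv d i) (Suc (length x))"

definition logspace_bound :: "nat \<Rightarrow> sym list \<Rightarrow> nat \<Rightarrow> bool" where
  "logspace_bound c x w \<longleftrightarrow> w \<le> c * nat \<lceil>log 2 (real (length x + 2))\<rceil>"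

text \<open>States are 0..<nq (start state 0), work symbols 0..<nk (blank 0).
  A transition reads (state, input cell, work symbol) and yields
  (new state, input head move, written work symbol, work head move, optional output symbol);
  None means halt.  The output tape is write-only and not counted in the space.\<close>
record dtm =
  d_nq :: nat
  d_nk :: nat
  d_delta :: "nat \<Rightarrow> cell \<Rightarrow> nat \<Rightarrow> (nat \<times> dir \<times> nat \<times> dir \<times> sym option) option"

type_synonym dconfig = "nat \<times> nat \<times> (nat \<Rightarrow> nat) \<times> nat \<times> sym list"

definition dtm_wf :: "dtm \<Rightarrow> bool" where
  "dtm_wf M \<longleftrightarrow> 0 < d_nq M \<and> 0 < d_nk M \<and>
     (\<forall>q < d_nq M. \<forall>c. \<forall>a < d_nk M.
        (case d_delta M q c a of None \<Rightarrow> True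
         | Some (q', di, s, dw, ou) \<Rightarrow> q' < d_nq M \<and> s < d_nk M))"

definition dinit :: dconfig where
  "dinit = (0, 0, (\<lambda>_. 0), 0, [])"

fun dstep :: "dtm \<Rightarrow> sym list \<Rightarrow> dconfig \<Rightarrow> dconfig" where
  "dstep M x (q, i, t, w, out) =
     (case d_delta M q (read_in x i) (t w) of
        None \<Rightarrow> (q, i, t, w, out)
      | Some (q', di, s, dw, ou) \<Rightarrow>
          (q', move_in x di i, t(w := s), mv dw w,
           out @ (case ou of None \<Rightarrow> [] | Some c \<Rightarrow> [c])))"

fun dhalted :: "dtm \<Rightarrow> sym list \<Rightarrow> dconfig \<Rightarrow> bool" where
  "dhalted M x (q, i, t, w, out) \<longleftrightarrow> d_delta M q (read_in x i) (t w) = None"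

fun dwork_head :: "dconfig \<Rightarrow> nat" where
  "dwork_head (q, i, t, w, out) = w"

fun doutput :: "dconfig \<Rightarrow> sym list" where
  "doutput (q, i, t, w, out) = out"

definition logspace_computable :: "(sym list \<Rightarrow> sym list) \<Rightarrow> bool" where
  "logspace_computable f \<longleftrightarrow>
     (\<exists>M c. dtm_wf M \<and>
        (\<forall>x. (\<forall>n. logspace_bound c x (dwork_head ((dstep M x ^^ n) dinit))) \<and>
             (\<exists>n. dhalted M x ((dstep M x ^^ n) dinit) \<and>
                  doutput ((dstep M x ^^ n) dinit) = f x)))"

definition logspace_reducible :: "sym list set \<Rightarrow> sym list set \<Rightarrow> bool" where
  "logspace_reducible A B \<longleftrightarrow> (\<exists>f. logspace_computable f \<and> (\<forall>x. x \<in> A \<longleftrightarrow> f x \<in> B))"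

text \<open>Transitions: (new state, input head move, written work symbol, work head move).
  A configuration with no available transition is halting; it is accepting iff its state is 1.
  A computation path is the sequence of transitions chosen.\<close>
record ntm =
  n_nq :: nat
  n_nk :: nat
  n_delta :: "nat \<Rightarrow> cell \<Rightarrow> nat \<Rightarrow> (nat \<times> dir \<times> nat \<times> dir) set"

type_synonym nconfig = "nat \<times> nat \<times> (nat \<Rightarrow> nat) \<times> nat"

definition ntm_wf :: "ntm \<Rightarrow> bool" where
  "ntm_wf M \<longleftrightarrow> 0 < n_nq M \<and> 0 < n_nk M \<and>
     (\<forall>q < n_nq M. \<forall>c. \<forall>a < n_nk M. finite (n_delta M q c a) \<and>
        (\<forall>(q', di, s, dw) \<in> n_delta M q c a. q' < n_nq M \<and> s < n_nk M))"

definition ninit :: nconfig where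
  "ninit = (0, 0, (\<lambda>_. 0), 0)"

fun nchoices :: "ntm \<Rightarrow> sym list \<Rightarrow> nconfig \<Rightarrow> (nat \<times> dir \<times> nat \<times> dir) set" where
  "nchoices M x (q, i, t, w) = n_delta M q (read_in x i) (t w)"

fun napply :: "sym list \<Rightarrow> (nat \<times> dir \<times> nat \<times> dir) \<Rightarrow> nconfig \<Rightarrow> nconfig" where
  "napply x (q', di, s, dw) (q, i, t, w) = (q', move_in x di i, t(w := s), mv dw w)"

definition nsucc :: "ntm \<Rightarrow> sym list \<Rightarrow> nconfig \<Rightarrow> nconfig \<Rightarrow> bool" where
  "nsucc M x c c' \<longleftrightarrow> (\<exists>tr \<in> nchoices M x c. c' = napply x tr c)"

fun valid_path :: "ntm \<Rightarrow> sym list \<Rightarrow> nconfig \<Rightarrow> (nat \<times> dir \<times> nat \<times> dir) list \<Rightarrow> bool" where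
  "valid_path M x c [] = True"
| "valid_path M x c (tr # trs) = (tr \<in> nchoices M x c \<and> valid_path M x (napply x tr c) trs)"

fun run_path :: "sym list \<Rightarrow> nconfig \<Rightarrow> (nat \<times> dir \<times> nat \<times> dir) list \<Rightarrow> nconfig" where
  "run_path x c [] = c"
| "run_path x c (tr # trs) = run_path x (napply x tr c) trs"

definition acc_paths :: "ntm \<Rightarrow> sym list \<Rightarrow> (nat \<times> dir \<times> nat \<times> dir) list set" where
  "acc_paths M x = {trs. valid_path M x ninit trs \<and>
      nchoices M x (run_path x ninit trs) = {} \<and> fst (run_path x ninit trs) = 1}"

definition ntm_terminates :: "ntm \<Rightarrow> sym list \<Rightarrow> bool" where
  "ntm_terminates M x \<longleftrightarrow> \<not> (\<exists>f. f 0 = ninit \<and> (\<forall>k. nsucc M x (f k) (f (Suc k))))"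

fun nwork_head :: "nconfig \<Rightarrow> nat" where
  "nwork_head (q, i, t, w) = w"

definition parityL :: "sym list set set" where
  "parityL = {A. \<exists>M c. ntm_wf M \<and>
      (\<forall>x. ntm_terminates M x \<and>
           (\<forall>cf. (nsucc M x)\<^sup>*\<^sup>* ninit cf \<longrightarrow> logspace_bound c x (nwork_head cf))) \<and>
      (\<forall>x. x \<in> A \<longleftrightarrow> odd (card (acc_paths M x)))}"

datatype gate = CNOT nat nat | Hadamard nat | Phase nat | Measure nat

text \<open>Quantum states as amplitude functions on computational basis states
  (basis state = assignment of a bit to every qubit index).\<close>
type_synonym qstate = "(nat \<Rightarrow> bool) \<Rightarrow> complex"

definition init_state :: qstate where
  "init_state x = (if \<forall>i. \<not> x i then 1 else 0)"

fun apply_unitary :: "gate \<Rightarrow> qstate \<Rightarrow> qstate" where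
  "apply_unitary (CNOT a b) \<psi> = (\<lambda>x. \<psi> (x(b := (x b \<noteq> x a))))"
| "apply_unitary (Hadamard a) \<psi> =
     (\<lambda>x. (\<psi> (x(a := False)) + (if x a then -1 else 1) * \<psi> (x(a := True))) / complex_of_real (sqrt 2))"
| "apply_unitary (Phase a) \<psi> = (\<lambda>x. (if x a then \<i> else 1) * \<psi> x)"
| "apply_unitary (Measure a) \<psi> = \<psi>"

definition proj :: "nat \<Rightarrow> bool \<Rightarrow> qstate \<Rightarrow> qstate" where
  "proj a b \<psi> = (\<lambda>x. if x a = b then \<psi> x else 0)"

text \<open>All (unnormalised) post-measurement branches; the squared norm of a branch
  is the probability of the corresponding sequence of measurement outcomes.\<close>
fun branches :: "gate list \<Rightarrow> qstate \<Rightarrow> qstate set" where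
  "branches [] \<psi> = {\<psi>}"
| "branches (Measure a # gs) \<psi> = branches gs (proj a False \<psi>) \<union> branches gs (proj a True \<psi>)"
| "branches (g # gs) \<psi> = branches gs (apply_unitary g \<psi>)"

definition valid_qubit :: "nat \<Rightarrow> nat \<Rightarrow> bool" where
  "valid_qubit n a \<longleftrightarrow> 1 \<le> a \<and> a \<le> n"

fun gate_wf :: "nat \<Rightarrow> gate \<Rightarrow> bool" where
  "gate_wf n (CNOT a b) \<longleftrightarrow> valid_qubit n a \<and> valid_qubit n b \<and> a \<noteq> b"
| "gate_wf n (Hadamard a) \<longleftrightarrow> valid_qubit n a"
| "gate_wf n (Phase a) \<longleftrightarrow> valid_qubit n a"
| "gate_wf n (Measure a) \<longleftrightarrow> valid_qubit n a"

definition circuit_wf :: "nat \<Rightarrow> gate list \<Rightarrow> bool" where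
  "circuit_wf n gs \<longleftrightarrow> 1 \<le> n \<and> (\<forall>g \<in> set gs. gate_wf n g)"

definition qubit1_certainly_one :: "gate list \<Rightarrow> bool" where
  "qubit1_certainly_one gs \<longleftrightarrow> (\<forall>\<phi> \<in> branches gs init_state. \<forall>x. \<not> x 1 \<longrightarrow> \<phi> x = 0)"

fun bin :: "nat \<Rightarrow> sym list" where
  "bin n = (if n < 2 then [if n = 0 then S0 else S1]
            else bin (n div 2) @ [if even n then S0 else S1])"

fun enc_gate :: "gate \<Rightarrow> sym list" where
  "enc_gate (CNOT a b) = [S0, S0, SHash] @ bin a @ [SHash] @ bin b @ [SHash]"
| "enc_gate (Hadamard a) = [S0, S1, SHash] @ bin a @ [SHash]"
| "enc_gate (Phase a) = [S1, S0, SHash] @ bin a @ [SHash]"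
| "enc_gate (Measure a) = [S1, S1, SHash] @ bin a @ [SHash]"

definition enc_instance :: "nat \<Rightarrow> gate list \<Rightarrow> sym list" where
  "enc_instance n gs = bin n @ [SHash] @ concat (map enc_gate gs)"

definition GK :: "sym list set" where
  "GK = {enc_instance n gs | n gs. circuit_wf n gs \<and> qubit1_certainly_one gs}"

end

theory Submission
  imports Defs
begin

text \<open>
  Membership. In the Heisenberg picture the observable \<open>Z\<close> on qubit 1 is conjugated backwards through
  the circuit; it stays a single Pauli operator \<open>i\<^sup>k X\<^sup>x Z\<^sup>z\<close>, and a measurement of qubit \<open>a\<close> either
  leaves it alone or, if it anticommutes with \<open>Z\<close> on \<open>a\<close>, annihilates it. Qubit 1 is certainly one iff the
  operator is never annihilated, ends with \<open>x = 0\<close>, and \<open>i\<^sup>k = -1\<close>. The bits of \<open>x\<close> and \<open>z\<close> evolve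
  linearly over GF(2), so each of them is the parity of a number of walks through the circuit. Running
  walks one after the other multiplies such counts and branching adds them, and since
  \<open>k = m + 2 h\<close>, with \<open>m\<close> Phase gates and \<open>h\<close> Hadamard gates contributing, the condition on \<open>k\<close> becomes
  \<open>m\<close> even and \<open>m choose 2 + h\<close> odd. Hence one nondeterministic machine has an odd number of accepting
  paths exactly on the yes-instances.

  Hardness. A CNOT circuit with one qubit per time layer and machine configuration adds, layer by layer,
  the number of paths into each configuration modulo 2. A configuration is named by writing its state,
  head position and the two halves of the work tape (as numbers, hence of polynomial size) in unary.

  Both machines are obtained from a small while-language over number registers. The registers are stored in
  binary on parallel tracks of the work tape, and every register operation is a single left-to-right scan of
  these tracks by a finite transducer.
\<close>

section \<open>Machines over arbitrary states and symbols\<close>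

text \<open>Working backwards is what makes logarithmic space enough: a stabilizer tableau has
  quadratically many bits, while a walk remembers only one gate, one qubit and one kind (X or Z).
  Counting modulo 2 also permits negation, since one extra branch exchanges even and odd; a
  conjunction of parity conditions thus becomes a product of counts. For the phase,
  \<open>m = (m mod 2) + 2 * (m choose 2)\<close> holds modulo 4, so the bit of weight two in
  \<open>k\<close> is the parity of \<open>(m choose 2) + h\<close>, again a count of choices. A
  qubit number may have about as many digits as the whole input, too many for a register. The
  recognizer therefore never stores one: it keeps a pointer to a numeral and compares numerals
  symbol by symbol. Hardness exploits the same fact, since a name may be a numeral of polynomial
  length and the output is not charged. Space, halting, parity and output are treated together: the
  inductive predicate \<open>good\<close> collects them, and every later program is verified against
  it through compositional rules, without estimating running times.\<close>

type_synonym ('s, 'k) trans = "'s \<times> dir \<times> 'k \<times> dir \<times> sym option"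
type_synonym ('s, 'k) tm = "'s \<Rightarrow> cell \<Rightarrow> 'k \<Rightarrow> ('s, 'k) trans list"
type_synonym ('s, 'k) conf = "'s \<times> nat \<times> (nat \<Rightarrow> 'k) \<times> nat"

fun tapply :: "sym list \<Rightarrow> ('s, 'k) trans \<Rightarrow> ('s, 'k) conf \<Rightarrow> ('s, 'k) conf" where
  "tapply x (s', di, k, dw, ou) (s, i, t, w) = (s', move_in x di i, t(w := k), mv dw w)"

fun tout :: "('s, 'k) trans \<Rightarrow> sym list" where
  "tout (s', di, k, dw, ou) = (case ou of None \<Rightarrow> [] | Some c \<Rightarrow> [c])"

text \<open>\<open>good D acc x H nd cf p os\<close>: from \<open>cf\<close> all runs halt, never move the work head beyond \<open>H\<close>, the number of
  accepting runs has parity \<open>p\<close>, and accepting runs output \<open>os\<close>. Branching is allowed only if \<open>nd\<close> is set.\<close>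

inductive good :: "('s, 'k) tm \<Rightarrow> 's \<Rightarrow> sym list \<Rightarrow> nat \<Rightarrow> bool \<Rightarrow> ('s, 'k) conf \<Rightarrow> bool \<Rightarrow> sym list \<Rightarrow> bool"
  for D acc x H nd where
  halt_acc: "\<lbrakk>D acc (read_in x i) (t w) = []; w \<le> H\<rbrakk> \<Longrightarrow> good D acc x H nd (acc, i, t, w) True []"
| halt_rej: "\<lbrakk>D s (read_in x i) (t w) = []; s \<noteq> acc; w \<le> H\<rbrakk> \<Longrightarrow> good D acc x H nd (s, i, t, w) False os"
| det: "\<lbrakk>D s (read_in x i) (t w) = [tr]; w \<le> H; good D acc x H nd (tapply x tr (s, i, t, w)) p os\<rbrakk>
    \<Longrightarrow> good D acc x H nd (s, i, t, w) p (tout tr @ os)"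
| branch: "\<lbrakk>nd; D s (read_in x i) (t w) = [tr1, tr2]; fst tr1 \<noteq> fst tr2; w \<le> H;
      good D acc x H nd (tapply x tr1 (s, i, t, w)) p1 os;
      good D acc x H nd (tapply x tr2 (s, i, t, w)) p2 os\<rbrakk>
    \<Longrightarrow> good D acc x H nd (s, i, t, w) (p1 \<noteq> p2) os"

section \<open>Accepting paths of concrete machines and their parity\<close>

definition apaths :: "ntm \<Rightarrow> sym list \<Rightarrow> nconfig \<Rightarrow> (nat \<times> dir \<times> nat \<times> dir) list set" where
  "apaths M x c = {trs. valid_path M x c trs \<and>
      nchoices M x (run_path x c trs) = {} \<and> fst (run_path x c trs) = 1}"

lemma acc_paths_apaths: "acc_paths M x = apaths M x ninit"
  by (simp add: acc_paths_def apaths_def)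

lemma apaths_halt: "nchoices M x c = {} \<Longrightarrow> apaths M x c = (if fst c = 1 then {[]} else {})"
  unfolding apaths_def by (auto elim: valid_path.elims)

lemma apaths_step:
  assumes "nchoices M x c \<noteq> {}"
  shows "apaths M x c = (\<Union>tr \<in> nchoices M x c. (#) tr ` apaths M x (napply x tr c))"
proof (rule set_eqI)
  fix trs show "trs \<in> apaths M x c \<longleftrightarrow> trs \<in> (\<Union>tr \<in> nchoices M x c. (#) tr ` apaths M x (napply x tr c))"
    using assms by (cases trs) (auto simp: apaths_def)
qed

lemma card_apaths_step:
  assumes "nchoices M x c \<noteq> {}" "finite (nchoices M x c)"
    and "\<And>tr. tr \<in> nchoices M x c \<Longrightarrow> finite (apaths M x (napply x tr c))"
  shows "card (apaths M x c) = (\<Sum>tr \<in> nchoices M x c. card (apaths M x (napply x tr c)))"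
    "finite (apaths M x c)"
proof -
  have "card (apaths M x c) = (\<Sum>tr \<in> nchoices M x c. card ((#) tr ` apaths M x (napply x tr c)))"
    unfolding apaths_step[OF assms(1)] using assms(2,3) by (subst card_UN_disjoint) auto
  then show "card (apaths M x c) = (\<Sum>tr \<in> nchoices M x c. card (apaths M x (napply x tr c)))"
    by (simp add: card_image)
  show "finite (apaths M x c)" unfolding apaths_step[OF assms(1)] using assms(2,3) by auto
qed

definition no_inf :: "ntm \<Rightarrow> sym list \<Rightarrow> nconfig \<Rightarrow> bool" where
  "no_inf M x c \<longleftrightarrow> \<not> (\<exists>f. f 0 = c \<and> (\<forall>k. nsucc M x (f k) (f (Suc k))))"

lemma no_inf_step:
  assumes "\<And>c'. nsucc M x c c' \<Longrightarrow> no_inf M x c'"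
  shows "no_inf M x c"
  unfolding no_inf_def
proof (rule notI, elim exE conjE)
  fix f assume f: "f 0 = c" "\<forall>k. nsucc M x (f k) (f (Suc k))"
  have "no_inf M x (f 1)" using f assms by (metis One_nat_def)
  moreover have "\<exists>g. g 0 = f 1 \<and> (\<forall>k. nsucc M x (g k) (g (Suc k)))"
    using f(2) by (intro exI[of _ "\<lambda>k. f (Suc k)"]) auto
  ultimately show False unfolding no_inf_def by metis
qed

text \<open>The content of \<open>good\<close> for a concrete machine. Finiteness is carried along
  because \<open>card\<close> of an infinite set is 0, which would spoil the sum over first
  transitions.\<close>

definition nok :: "ntm \<Rightarrow> sym list \<Rightarrow> nat \<Rightarrow> nconfig \<Rightarrow> bool \<Rightarrow> bool" where
  "nok M x H c p \<longleftrightarrow> finite (apaths M x c) \<and> (odd (card (apaths M x c)) \<longleftrightarrow> p) \<and>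
     no_inf M x c \<and> (\<forall>cf. (nsucc M x)\<^sup>*\<^sup>* c cf \<longrightarrow> nwork_head cf \<le> H)"

lemma reach_bound_step:
  assumes "nwork_head c \<le> H"
    and "\<And>c'. nsucc M x c c' \<Longrightarrow> \<forall>cf. (nsucc M x)\<^sup>*\<^sup>* c' cf \<longrightarrow> nwork_head cf \<le> H"
  shows "\<forall>cf. (nsucc M x)\<^sup>*\<^sup>* c cf \<longrightarrow> nwork_head cf \<le> H"
  using assms by (metis converse_rtranclpE)

lemma nok_halt:
  assumes "nchoices M x c = {}" "nwork_head c \<le> H"
  shows "nok M x H c (fst c = 1)"
proof -
  have ns: "\<not> nsucc M x c c'" for c' using assms by (simp add: nsucc_def)
  have "no_inf M x c" by (rule no_inf_step) (use ns in blast)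
  moreover have "\<forall>cf. (nsucc M x)\<^sup>*\<^sup>* c cf \<longrightarrow> nwork_head cf \<le> H"
    by (rule reach_bound_step[OF assms(2)]) (use ns in blast)
  ultimately show ?thesis unfolding nok_def apaths_halt[OF assms(1)] by simp
qed

lemma nok_det:
  assumes "nchoices M x c = {tr}" "nwork_head c \<le> H" "nok M x H (napply x tr c) p"
  shows "nok M x H c p"
proof -
  have ns: "nsucc M x c c' \<longleftrightarrow> c' = napply x tr c" for c' using assms by (simp add: nsucc_def)
  have ne: "nchoices M x c \<noteq> {}" "finite (nchoices M x c)"
    and fin: "\<And>tr. tr \<in> nchoices M x c \<Longrightarrow> finite (apaths M x (napply x tr c))"
    using assms by (auto simp: nok_def)
  have "no_inf M x c" by (rule no_inf_step) (use ns assms(3) in \<open>auto simp only: nok_def\<close>)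
  moreover have "\<forall>cf. (nsucc M x)\<^sup>*\<^sup>* c cf \<longrightarrow> nwork_head cf \<le> H"
    by (rule reach_bound_step[OF assms(2)]) (use ns assms(3) in \<open>auto simp only: nok_def\<close>)
  ultimately show ?thesis using assms(3) card_apaths_step[OF ne fin] unfolding nok_def by (simp add: assms(1))
qed

text \<open>Choices form a set, so two equal transitions would be a single branch. For different
  ones the path sets are disjoint, as paths differ in their first entry, and the cardinalities
  add.\<close>

lemma nok_branch:
  assumes "nchoices M x c = {tr1, tr2}" "tr1 \<noteq> tr2" "nwork_head c \<le> H"
    "nok M x H (napply x tr1 c) p1" "nok M x H (napply x tr2 c) p2"
  shows "nok M x H c (p1 \<noteq> p2)"
proof -
  have ns: "nsucc M x c c' \<longleftrightarrow> c' = napply x tr1 c \<or> c' = napply x tr2 c" for c'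
    using assms by (auto simp: nsucc_def)
  have ne: "nchoices M x c \<noteq> {}" "finite (nchoices M x c)"
    and fin: "\<And>tr. tr \<in> nchoices M x c \<Longrightarrow> finite (apaths M x (napply x tr c))"
    using assms by (auto simp: nok_def)
  have "no_inf M x c" by (rule no_inf_step) (use ns assms(4,5) in \<open>auto simp only: nok_def\<close>)
  moreover have "\<forall>cf. (nsucc M x)\<^sup>*\<^sup>* c cf \<longrightarrow> nwork_head cf \<le> H"
    by (rule reach_bound_step[OF assms(3)]) (use ns assms(4,5) in \<open>auto simp only: nok_def\<close>)
  ultimately show ?thesis using assms(2,4,5) card_apaths_step[OF ne fin]
    unfolding nok_def by (simp add: assms(1)) blast
qed

section \<open>Numbering states and symbols\<close>

lemma enum_obtain:
  assumes "finite Q" "a \<in> Q" "b \<in> Q" "a \<noteq> b"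
  obtains e :: "'a \<Rightarrow> nat" and d n where
    "\<And>s. s \<in> Q \<Longrightarrow> e s < n \<and> d (e s) = s" "\<And>i. i < n \<Longrightarrow> d i \<in> Q" "e a = 0" "e b = 1"
proof -
  obtain xs where xs: "set xs = Q - {a, b}" "distinct xs"
    using assms(1) finite_distinct_list[of "Q - {a, b}"] by auto
  \<comment> \<open>With \<open>a\<close> and \<open>b\<close> in front, their numbers are 0 and 1.
    The machine model reserves 0 for the start state and the blank, and 1 for the accepting
    state.\<close>
  define ys where "ys = a # b # xs"
  have ys: "set ys = Q" "distinct ys" using xs assms by (auto simp: ys_def)
  define e where "e s = (LEAST i. ys ! i = s)" for s
  have e: "e s < length ys \<and> ys ! (e s) = s" if s: "s \<in> Q" for s
  proof -
    obtain i where i: "i < length ys" "ys ! i = s" using s ys(1) by (metis in_set_conv_nth)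
    have "e s \<le> i" unfolding e_def by (rule Least_le) (use i in simp)
    moreover have "ys ! (e s) = s" unfolding e_def by (rule LeastI[of _ i]) (use i in simp)
    ultimately show ?thesis using i by simp
  qed
  have e0: "e a = 0" unfolding e_def by (rule Least_equality) (auto simp: ys_def)
  have e1: "e b = 1" unfolding e_def using assms(4)
    by (intro Least_equality) (auto simp: ys_def not_less_eq_eq Suc_le_eq intro!: Nat.gr0I)
  show thesis by (rule that[of e "length ys" "\<lambda>i. ys ! i"])
      (use e e0 e1 ys in \<open>auto intro: nth_mem\<close>)
qed

text \<open>The types of states and symbols may be infinite, as they are for compiled programs; only
  a finite part closed under transitions gets numbered. \<open>mark\<close> supplies the second
  distinguished symbol of that numbering.\<close>

locale tm_closed =
  fixes D :: "('s, 'k) tm" and start acc :: 's and blank mark :: 'k and Q :: "'s set" and K :: "'k set"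
  assumes finQ: "finite Q" and finK: "finite K"
    and inQ: "start \<in> Q" "acc \<in> Q" "start \<noteq> acc" and inK: "blank \<in> K" "mark \<in> K" "blank \<noteq> mark"
    and closed: "\<And>s c k s' di k' dw ou. \<lbrakk>s \<in> Q; k \<in> K; (s', di, k', dw, ou) \<in> set (D s c k)\<rbrakk> \<Longrightarrow> s' \<in> Q \<and> k' \<in> K"
begin

fun conf_in :: "('s, 'k) conf \<Rightarrow> bool" where
  "conf_in (s, i, t, w) \<longleftrightarrow> s \<in> Q \<and> range t \<subseteq> K"

lemma conf_in_step:
  assumes "conf_in (s, i, t, w)" "tr \<in> set (D s c (t w))"
  shows "conf_in (tapply x tr (s, i, t, w))"
proof -
  obtain s' di k dw ou where tr: "tr = (s', di, k, dw, ou)" by (metis prod_cases5)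
  have "s' \<in> Q \<and> k \<in> K" using assms closed[of s "t w" s' di k dw ou c] by (auto simp: tr)
  then show ?thesis using assms by (auto simp: tr)
qed

theorem parityL_of_good:
  assumes g: "\<And>x. \<exists>H os. logspace_bound c x H \<and> good D acc x H True (start, 0, \<lambda>_. blank, 0) (x \<in> A) os"
  shows "A \<in> parityL"
proof -
  obtain eS :: "'s \<Rightarrow> nat" and dS nS where S:
    "\<And>s. s \<in> Q \<Longrightarrow> eS s < nS \<and> dS (eS s) = s" "\<And>i. i < nS \<Longrightarrow> dS i \<in> Q" "eS start = 0" "eS acc = 1"
    using enum_obtain[OF finQ inQ] by metis
  obtain eK :: "'k \<Rightarrow> nat" and dK nK where E:
    "\<And>s. s \<in> K \<Longrightarrow> eK s < nK \<and> dK (eK s) = s" "\<And>i. i < nK \<Longrightarrow> dK i \<in> K" "eK blank = 0"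
    using enum_obtain[OF finK inK] by metis
  define etr where "etr = (\<lambda>(s', di, k', dw, ou :: sym option). (eS s', di :: dir, eK k', dw :: dir))"
  define M where "M = \<lparr>n_nq = nS, n_nk = nK, n_delta = (\<lambda>q c a. etr ` set (D (dS q) c (dK a)))\<rparr>"
  define ec where "ec = (\<lambda>(s, i :: nat, t :: nat \<Rightarrow> 'k, w :: nat). (eS s, i, (\<lambda>j. eK (t j)), w))"
  have wf: "ntm_wf M"
    unfolding ntm_wf_def
  proof (intro conjI allI impI)
    show "0 < n_nq M" "0 < n_nk M" using S(1)[OF inQ(1)] E(1)[OF inK(1)] by (auto simp: M_def)
  next
    fix q c a assume qa: "q < n_nq M" "a < n_nk M"
    then have *: "dS q \<in> Q" "dK a \<in> K" using S E by (auto simp: M_def)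
    show "finite (n_delta M q c a)" by (simp add: M_def)
    show "\<forall>(q', di, s, dw) \<in> n_delta M q c a. q' < n_nq M \<and> s < n_nk M"
      using closed[OF *] S(1) E(1) by (fastforce simp: M_def etr_def)
  qed
  have ch: "nchoices M x (ec (s, i, t, w)) = etr ` set (D s (read_in x i) (t w))"
    if "conf_in (s, i, t, w)" for x s i t w
    using that S(1) E(1) by (auto simp: M_def ec_def range_subsetD)
  have ap: "napply x (etr tr) (ec (s, i, t, w)) = ec (tapply x tr (s, i, t, w))" for x tr s i t w
    by (cases tr) (auto simp: etr_def ec_def)
  have nok: "nok M x H (ec cf) p" if "good D acc x H nd cf p os" "conf_in cf" for x H nd cf p os
    using that
  proof (induction rule: good.induct)
    case (halt_acc i t w)
    then show ?case using nok_halt[of M x "ec (acc, i, t, w)" H] ch[OF halt_acc(3)] S(4) by (simp add: ec_def)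
  next
    case (halt_rej s i t w os)
    have "s \<in> Q" using halt_rej by simp
    \<comment> \<open>The number 1 belongs to \<open>acc\<close> and the numbering is injective on
      \<open>Q\<close>, so halting elsewhere is not accepting.\<close>
    then have "eS s \<noteq> 1" using halt_rej(2) S(1) S(4) inQ(2) by metis
    then show ?case using nok_halt[of M x "ec (s, i, t, w)" H] ch[OF halt_rej(4)] halt_rej by (simp add: ec_def)
  next
    case (det s i t w tr p os)
    have in1: "conf_in (tapply x tr (s, i, t, w))" using conf_in_step[OF det.prems, of tr "read_in x i"] det.hyps(1) by simp
    show ?case
      by (rule nok_det[of _ _ _ "etr tr"])
        (use det.hyps det.IH[OF in1] ch[OF det.prems] in \<open>simp_all add: ap del: tapply.simps nchoices.simps conf_in.simps, simp add: ec_def\<close>)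
  next
    case (branch s i t w tr1 tr2 p1 os p2)
    have in1: "conf_in (tapply x tr1 (s, i, t, w))" "conf_in (tapply x tr2 (s, i, t, w))"
      using conf_in_step[OF branch.prems, of tr1 "read_in x i"] conf_in_step[OF branch.prems, of tr2 "read_in x i"]
        branch.hyps(2) by simp_all
    have "fst tr1 \<in> Q" "fst tr2 \<in> Q" using in1 by (cases tr1; cases tr2; simp)+
    \<comment> \<open>Here the demand of \<open>branch\<close> for different target states is used:
      \<open>etr\<close> forgets the output, and transitions differing only there would be merged
      into one.\<close>
    then have "eS (fst tr1) \<noteq> eS (fst tr2)" using S(1) branch.hyps(3) by metis
    then have ne: "etr tr1 \<noteq> etr tr2" by (cases tr1; cases tr2) (auto simp: etr_def)
    show ?case
      by (rule nok_branch[of _ _ _ "etr tr1" "etr tr2"])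
        (use branch.hyps ne branch.IH(1)[OF in1(1)] branch.IH(2)[OF in1(2)] ch[OF branch.prems] in
          \<open>simp_all add: ap del: tapply.simps nchoices.simps conf_in.simps, simp add: ec_def\<close>)
  qed
  have init: "ec (start, 0, \<lambda>_. blank, 0) = ninit" "conf_in (start, 0, \<lambda>_. blank, 0)"
    using S(3) E(3) inQ inK by (auto simp: ec_def ninit_def)
  have main: "\<exists>H. logspace_bound c x H \<and> nok M x H ninit (x \<in> A)" for x
    using g[of x] nok init by metis
  show ?thesis unfolding parityL_def
  proof (intro CollectI exI[of _ M] exI[of _ c] conjI allI impI)
    fix x
    obtain H where H: "logspace_bound c x H" "nok M x H ninit (x \<in> A)" using main by blast
    show "ntm_terminates M x" using H by (auto simp: nok_def no_inf_def ntm_terminates_def)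
    show "x \<in> A \<longleftrightarrow> odd (card (acc_paths M x))" using H by (auto simp: nok_def acc_paths_apaths)
    fix cf assume "(nsucc M x)\<^sup>*\<^sup>* ninit cf"
    then show "logspace_bound c x (nwork_head cf)" using H
      by (meson nok_def logspace_bound_def le_trans)
  qed (rule wf)
qed

theorem logspace_computable_of_good:
  assumes g: "\<And>x. \<exists>H. logspace_bound c x H \<and> good D acc x H False (start, 0, \<lambda>_. blank, 0) True (f x)"
  shows "logspace_computable f"
proof -
  obtain eS :: "'s \<Rightarrow> nat" and dS nS where S:
    "\<And>s. s \<in> Q \<Longrightarrow> eS s < nS \<and> dS (eS s) = s" "\<And>i. i < nS \<Longrightarrow> dS i \<in> Q" "eS start = 0" "eS acc = 1"
    using enum_obtain[OF finQ inQ] by metis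
  obtain eK :: "'k \<Rightarrow> nat" and dK nK where E:
    "\<And>s. s \<in> K \<Longrightarrow> eK s < nK \<and> dK (eK s) = s" "\<And>i. i < nK \<Longrightarrow> dK i \<in> K" "eK blank = 0"
    using enum_obtain[OF finK inK] by metis
  define etr where "etr = (\<lambda>(s', di :: dir, k', dw :: dir, ou :: sym option). (eS s', di, eK k', dw, ou))"
  define M where "M = \<lparr>d_nq = nS, d_nk = nK,
    d_delta = (\<lambda>q c a. case D (dS q) c (dK a) of [] \<Rightarrow> None | tr # _ \<Rightarrow> Some (etr tr))\<rparr>"
  define ec where "ec = (\<lambda>(s, i :: nat, t :: nat \<Rightarrow> 'k, w :: nat) (out :: sym list). (eS s, i, (\<lambda>j. eK (t j)), w, out))"
  have wf: "dtm_wf M"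
    unfolding dtm_wf_def
  proof (intro conjI allI impI)
    show "0 < d_nq M" "0 < d_nk M" using S(1)[OF inQ(1)] E(1)[OF inK(1)] by (auto simp: M_def)
  next
    fix q c a assume qa: "q < d_nq M" "a < d_nk M"
    then have *: "dS q \<in> Q" "dK a \<in> K" using S E by (auto simp: M_def)
    show "case d_delta M q c a of None \<Rightarrow> True | Some (q', di, s, dw, ou) \<Rightarrow> q' < d_nq M \<and> s < d_nk M"
    proof (cases "D (dS q) c (dK a)")
      case (Cons tr trs)
      obtain s' di k dw ou where tr: "tr = (s', di, k, dw, ou)" by (metis prod_cases5)
      have "s' \<in> Q \<and> k \<in> K" using closed[OF *, of s' di k dw ou c] Cons by (simp add: tr)
      then show ?thesis using S(1) E(1) Cons by (simp add: M_def etr_def tr)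
    qed (simp add: M_def)
  qed
  have de: "d_delta M (eS s) c (eK k) = (case D s c k of [] \<Rightarrow> None | tr # _ \<Rightarrow> Some (etr tr))"
    if "s \<in> Q" "k \<in> K" for s c k using that S(1) E(1) by (simp add: M_def)
  \<comment> \<open>The accumulated output \<open>out\<close> is arbitrary so that the induction can
    pass a step that prints. A rejecting run only has to obey the space bound.\<close>
  have ok: "(\<forall>n. dwork_head ((dstep M x ^^ n) (ec cf out)) \<le> H) \<and>
      (p \<longrightarrow> (\<exists>n. dhalted M x ((dstep M x ^^ n) (ec cf out)) \<and> doutput ((dstep M x ^^ n) (ec cf out)) = out @ os))"
    if "good D acc x H nd cf p os" "\<not> nd" "conf_in cf" for x H nd cf p os out
    using that
  proof (induction arbitrary: out rule: good.induct)
    case (halt_acc i t w out)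
    have h: "d_delta M (eS acc) (read_in x i) (eK (t w)) = None"
      using halt_acc de by (auto simp: range_subsetD)
    have "dstep M x (ec (acc, i, t, w) out) = ec (acc, i, t, w) out" using h by (simp add: ec_def)
    then have *: "(dstep M x ^^ n) (ec (acc, i, t, w) out) = ec (acc, i, t, w) out" for n
      by (induction n) auto
    show ?case unfolding * using h halt_acc by (simp add: ec_def)
  next
    case (halt_rej s i t w os out)
    have h: "d_delta M (eS s) (read_in x i) (eK (t w)) = None"
      using halt_rej de by (auto simp: range_subsetD)
    have "dstep M x (ec (s, i, t, w) out) = ec (s, i, t, w) out" using h by (simp add: ec_def)
    then have *: "(dstep M x ^^ n) (ec (s, i, t, w) out) = ec (s, i, t, w) out" for n
      by (induction n) auto
    show ?case unfolding * using halt_rej by (simp add: ec_def)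
  next
    case (det s i t w tr p os out)
    obtain s' di k dw ou where tr: "tr = (s', di, k, dw, ou)" by (metis prod_cases5)
    have h: "d_delta M (eS s) (read_in x i) (eK (t w)) = Some (etr tr)"
      using det de by (auto simp: range_subsetD)
    have st: "dstep M x (ec (s, i, t, w) out) = ec (tapply x tr (s, i, t, w)) (out @ tout tr)"
      using h by (auto simp: ec_def etr_def tr)
    have "conf_in (tapply x tr (s, i, t, w))" using conf_in_step[OF det.prems(2), of tr "read_in x i"] det.hyps(1) by simp
    note IH = det.IH[OF det.prems(1) this, of "out @ tout tr"]
    have b: "dwork_head ((dstep M x ^^ n) (ec (s, i, t, w) out)) \<le> H" for n
      using IH det.hyps(2) by (cases n) (simp add: ec_def, simp add: funpow_Suc_right st del: funpow.simps)
    show ?case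
    proof (intro conjI impI allI b)
      assume p
      then obtain n where "dhalted M x ((dstep M x ^^ n) (ec (tapply x tr (s, i, t, w)) (out @ tout tr)))"
        "doutput ((dstep M x ^^ n) (ec (tapply x tr (s, i, t, w)) (out @ tout tr))) = out @ tout tr @ os"
        using IH by auto
      then show "\<exists>n. dhalted M x ((dstep M x ^^ n) (ec (s, i, t, w) out)) \<and>
          doutput ((dstep M x ^^ n) (ec (s, i, t, w) out)) = out @ tout tr @ os"
        by (intro exI[of _ "Suc n"]) (simp add: funpow_Suc_right st del: funpow.simps)
    qed
  qed simp
  have init: "ec (start, 0, \<lambda>_. blank, 0) [] = dinit" "conf_in (start, 0, \<lambda>_. blank, 0)"
    using S(3) E(3) inQ inK by (auto simp: ec_def dinit_def)
  show ?thesis unfolding logspace_computable_def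
  proof (rule exI[of _ M], rule exI[of _ c], intro conjI allI)
    fix x
    obtain H where H: "logspace_bound c x H" "good D acc x H False (start, 0, \<lambda>_. blank, 0) True (f x)"
      using g by blast
    note ok = ok[OF H(2) _ init(2), of "[]", unfolded init(1)]
    show "logspace_bound c x (dwork_head ((dstep M x ^^ n) dinit))" for n
      using ok H(1) by (meson logspace_bound_def le_trans)
    show "\<exists>n. dhalted M x ((dstep M x ^^ n) dinit) \<and> doutput ((dstep M x ^^ n) dinit) = f x"
      using ok by simp
  qed (rule wf)
qed

end

section \<open>A while-language compiled to log-space machines\<close>

text \<open>\<open>Scan f\<close> runs the transducer \<open>f\<close> over the binary digits of all registers, least significant first, starting in
  control state \<open>False\<close>; digit column \<open>j\<close> is presented as the set of registers whose \<open>j\<close>-th bit is 1.\<close>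

datatype tst = Scan "bool \<Rightarrow> nat set \<Rightarrow> bool \<times> nat set" | At "cell \<Rightarrow> bool"

datatype com = Skip | Fail | MvR | MvL | Out sym | Seq com com (infixr ";;" 60)
  | If tst com com | While com tst com | Choice com com

text \<open>\<open>Mark\<close> sits in cell 0 and guides the head home. \<open>Blank\<close> is a
  column no scan has written yet; it reads as all digits zero.\<close>

datatype wsym = Blank | Mark | Bits "nat set"

text \<open>A control state carries the stack of commands still to be run, so the machine is an
  interpreter; its state set is finite because a fixed program produces only finitely many
  stacks.\<close>

datatype st = Start com | Ctl "com list"
  | Sc "bool \<Rightarrow> nat set \<Rightarrow> bool \<times> nat set" bool "com list" "com list" | Ret "com list"

fun bits_of :: "wsym \<Rightarrow> nat set" where
  "bits_of (Bits A) = A"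
| "bits_of _ = {}"

text \<open>The empty stack is the accepting halt, whereas \<open>Fail\<close> halts on a nonempty
  stack and so rejects. A \<open>Scan\<close> begins by stepping right, off the mark.\<close>

fun cdelta :: "com list \<Rightarrow> cell \<Rightarrow> wsym \<Rightarrow> (st, wsym) trans list" where
  "cdelta [] c k = []"
| "cdelta (Skip # ks) c k = [(Ctl ks, Stay, k, Stay, None)]"
| "cdelta (Fail # ks) c k = []"
| "cdelta (MvR # ks) c k = [(Ctl ks, Rgt, k, Stay, None)]"
| "cdelta (MvL # ks) c k = [(Ctl ks, Lft, k, Stay, None)]"
| "cdelta (Out s # ks) c k = [(Ctl ks, Stay, k, Stay, Some s)]"
| "cdelta (Seq a b # ks) c k = [(Ctl (a # b # ks), Stay, k, Stay, None)]"
| "cdelta (If (At P) a b # ks) c k = [(Ctl ((if P c then a else b) # ks), Stay, k, Stay, None)]"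
| "cdelta (If (Scan f) a b # ks) c k = [(Sc f False (a # ks) (b # ks), Stay, k, Rgt, None)]"
| "cdelta (While p t a # ks) c k = [(Ctl ((p ;; If t (a ;; While p t a) Skip) # ks), Stay, k, Stay, None)]"
| "cdelta (Choice a b # ks) c k = [(Ctl (a # ks), Stay, k, Stay, None), (Ctl (b # ks), Stay, k, Stay, None)]"

text \<open>A scan stops at a blank cell only if the transducer writes no digit there; otherwise, as
  with a carry out of the top digit, the cell becomes a new column. \<open>Ret\<close> then walks
  back to \<open>Mark\<close>.\<close>

fun delta :: "st \<Rightarrow> cell \<Rightarrow> wsym \<Rightarrow> (st, wsym) trans list" where
  "delta (Start p) c k = [(Ctl [p], Stay, Mark, Stay, None)]"
| "delta (Ctl ks) c k = cdelta ks c k"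
| "delta (Sc f b ks1 ks0) c k =
    (if snd (f b (bits_of k)) = {} \<and> (k = Blank)
     then [(Ret (if b then ks1 else ks0), Stay, k, Lft, None)]
     else [(Sc f (fst (f b (bits_of k))) ks1 ks0, Stay, Bits (snd (f b (bits_of k))), Rgt, None)])"
| "delta (Ret ks) c k = [if k = Mark then (Ctl ks, Stay, k, Stay, None) else (Ret ks, Stay, k, Lft, None)]"

definition scs :: "tst \<Rightarrow> com list \<Rightarrow> com list \<Rightarrow> st set" where
  "scs t k1 k0 = (case t of At P \<Rightarrow> {} | Scan f \<Rightarrow> {Sc f True k1 k0, Sc f False k1 k0, Ret k1, Ret k0})"

text \<open>All control states reachable while \<open>c\<close> runs in front of the stack \<open>ks\<close>, including the one that resumes \<open>ks\<close>.\<close>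

fun conts :: "com \<Rightarrow> com list \<Rightarrow> st set" where
  "conts (Seq a b) ks = {Ctl (Seq a b # ks)} \<union> conts a (b # ks) \<union> conts b ks"
| "conts (If t a b) ks = {Ctl (If t a b # ks)} \<union> scs t (a # ks) (b # ks) \<union> conts a ks \<union> conts b ks"
| "conts (While p t a) ks = (let W = While p t a; I = If t (a ;; W) Skip in
     {Ctl (W # ks), Ctl ((p ;; I) # ks), Ctl (I # ks), Ctl ((a ;; W) # ks), Ctl (Skip # ks), Ctl ks}
     \<union> scs t ((a ;; W) # ks) (Skip # ks) \<union> conts p (I # ks) \<union> conts a (W # ks))"
| "conts (Choice a b) ks = {Ctl (Choice a b # ks)} \<union> conts a ks \<union> conts b ks"
| "conts c ks = {Ctl (c # ks), Ctl ks}"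

fun tok :: "nat \<Rightarrow> tst \<Rightarrow> bool" where
  "tok n (Scan f) = (\<forall>b A. A \<subseteq> {..<n} \<longrightarrow> snd (f b A) \<subseteq> {..<n})"
| "tok n (At P) = True"

fun cok :: "nat \<Rightarrow> com \<Rightarrow> bool" where
  "cok n (Seq a b) = (cok n a \<and> cok n b)"
| "cok n (If t a b) = (tok n t \<and> cok n a \<and> cok n b)"
| "cok n (While p t a) = (tok n t \<and> cok n p \<and> cok n a)"
| "cok n (Choice a b) = (cok n a \<and> cok n b)"
| "cok n c = True"

section \<open>Finiteness and closure of the compiled state set\<close>

lemma finite_scs: "finite (scs t k1 k0)"
  by (auto simp: scs_def split: tst.splits)

lemma finite_conts: "finite (conts c ks)"
  by (induction c arbitrary: ks) (auto simp: finite_scs Let_def)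

lemma Ctl_in_conts: "Ctl (c # ks) \<in> conts c ks"
  by (induction c arbitrary: ks) (auto simp: Let_def)

lemma Ctl_tail_in_conts: "Ctl ks \<in> conts c ks"
  by (induction c arbitrary: ks) (auto simp: Let_def)

definition clos :: "nat \<Rightarrow> st set \<Rightarrow> st \<Rightarrow> bool" where
  "clos n Q s \<longleftrightarrow> (\<forall>c k s' di k' dw ou. bits_of k \<subseteq> {..<n} \<longrightarrow> (s', di, k', dw, ou) \<in> set (delta s c k) \<longrightarrow>
      s' \<in> Q \<and> bits_of k' \<subseteq> {..<n})"

lemma clos_scs:
  assumes "tok n t" "s \<in> scs t k1 k0" "scs t k1 k0 \<subseteq> Q" "Ctl k1 \<in> Q" "Ctl k0 \<in> Q"
  shows "clos n Q s"
proof (cases t)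
  case (Scan f)
  then have s: "s \<in> {Sc f True k1 k0, Sc f False k1 k0, Ret k1, Ret k0}"
    and Q: "Sc f b k1 k0 \<in> Q" "Ret k1 \<in> Q" "Ret k0 \<in> Q" for b
    using assms by (cases b; auto simp: scs_def)+
  have f: "snd (f b (bits_of k)) \<subseteq> {..<n}" if "bits_of k \<subseteq> {..<n}" for b k
    using assms(1) that by (simp add: Scan)
  from s Q assms(4,5) show ?thesis unfolding clos_def by (auto split: if_splits dest: subsetD[OF f])
qed (use assms in \<open>simp add: scs_def\<close>)

lemma clos_mono: "clos n Q s \<Longrightarrow> Q \<subseteq> Q' \<Longrightarrow> clos n Q' s"
  unfolding clos_def by blast

lemma clos_Ctl:
  "clos n Q (Ctl ks) \<longleftrightarrow> (\<forall>c k s' di k' dw ou. bits_of k \<subseteq> {..<n} \<longrightarrow>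
     (s', di, k', dw, ou) \<in> set (cdelta ks c k) \<longrightarrow> s' \<in> Q \<and> bits_of k' \<subseteq> {..<n})"
  by (simp add: clos_def)

lemma clos_If:
  assumes "Ctl (a # ks) \<in> Q" "Ctl (b # ks) \<in> Q" "scs t (a # ks) (b # ks) \<subseteq> Q"
  shows "clos n Q (Ctl (If t a b # ks))"
  using assms by (cases t) (auto simp: clos_Ctl scs_def)

text \<open>\<open>Ctl ks\<close> is excepted because it is the exit of \<open>c\<close>: its
  successors belong to the surrounding program. In a compound command the exit of one part is the
  entry of another, where closure is established for that other part.\<close>

lemma clos_conts:
  assumes "cok n c" "s \<in> conts c ks"
  shows "s = Ctl ks \<or> clos n (conts c ks) s"
  using assms
proof (induction c arbitrary: ks s)
  case (Seq a b)
  let ?Q = "conts (Seq a b) ks"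
  have sub: "conts a (b # ks) \<subseteq> ?Q" "conts b ks \<subseteq> ?Q" by auto
  consider "s = Ctl (Seq a b # ks)" | "s \<in> conts a (b # ks)" | "s \<in> conts b ks" using Seq.prems by auto
  then show ?case
  proof cases
    case 1
    then show ?thesis using Ctl_in_conts[of a "b # ks"] by (auto simp: clos_Ctl)
  next
    case 2
    then have "s = Ctl (b # ks) \<or> clos n ?Q s" using Seq.IH(1) Seq.prems(1) clos_mono[OF _ sub(1)] by auto
    then show ?thesis using Seq.IH(2)[of "Ctl (b # ks)" ks] Seq.prems(1) Ctl_in_conts clos_mono[OF _ sub(2)] by auto
  next
    case 3
    then show ?thesis using Seq.IH(2) Seq.prems(1) clos_mono[OF _ sub(2)] by auto
  qed
next
  case (If t a b)
  let ?Q = "conts (If t a b) ks"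
  have sub: "conts a ks \<subseteq> ?Q" "conts b ks \<subseteq> ?Q" "scs t (a # ks) (b # ks) \<subseteq> ?Q" by auto
  have hd: "Ctl (a # ks) \<in> ?Q" "Ctl (b # ks) \<in> ?Q" using sub Ctl_in_conts by auto
  consider "s = Ctl (If t a b # ks)" | "s \<in> scs t (a # ks) (b # ks)" | "s \<in> conts a ks" | "s \<in> conts b ks"
    using If.prems by auto
  then show ?case
  proof cases
    case 1
    then show ?thesis using clos_If[OF hd sub(3)] by simp
  next
    case 2
    then show ?thesis using clos_scs[of n t s, OF _ _ sub(3) hd] If.prems by simp
  next
    case 3
    then show ?thesis using If.IH(1) If.prems(1) clos_mono[OF _ sub(1)] by auto
  next
    case 4
    then show ?thesis using If.IH(2) If.prems(1) clos_mono[OF _ sub(2)] by auto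
  qed
next
  case (While p t a)
  define W where "W = While p t a"
  define I where "I = If t (a ;; W) Skip"
  let ?Q = "conts (While p t a) ks"
  have Q: "?Q = {Ctl (W # ks), Ctl ((p ;; I) # ks), Ctl (I # ks), Ctl ((a ;; W) # ks), Ctl (Skip # ks), Ctl ks}
     \<union> scs t ((a ;; W) # ks) (Skip # ks) \<union> conts p (I # ks) \<union> conts a (W # ks)"
    by (simp add: W_def I_def Let_def)
  have sub: "conts p (I # ks) \<subseteq> ?Q" "conts a (W # ks) \<subseteq> ?Q" "scs t ((a ;; W) # ks) (Skip # ks) \<subseteq> ?Q"
    and hd: "Ctl ((a ;; W) # ks) \<in> ?Q" "Ctl (Skip # ks) \<in> ?Q" unfolding Q by auto
  have c1: "clos n ?Q (Ctl (W # ks))" unfolding Q by (simp add: clos_Ctl W_def[symmetric] I_def[symmetric], simp add: W_def I_def)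
  have c2: "clos n ?Q (Ctl ((p ;; I) # ks))" "clos n ?Q (Ctl ((a ;; W) # ks))" "clos n ?Q (Ctl (Skip # ks))"
    unfolding Q using Ctl_in_conts by (auto simp: clos_Ctl)
  have c3: "clos n ?Q (Ctl (I # ks))" unfolding I_def by (rule clos_If[OF hd sub(3)])
  consider "s = Ctl ks" | "s \<in> {Ctl (W # ks), Ctl ((p ;; I) # ks), Ctl (I # ks), Ctl ((a ;; W) # ks), Ctl (Skip # ks)}"
    | "s \<in> scs t ((a ;; W) # ks) (Skip # ks)" | "s \<in> conts p (I # ks)" | "s \<in> conts a (W # ks)"
    using While.prems(2) unfolding Q by blast
  then show ?case
  proof cases
    case 3
    then show ?thesis using clos_scs[of n t s, OF _ _ sub(3) hd] While.prems by simp
  next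
    case 4
    then show ?thesis using While.IH(1)[of s "I # ks"] While.prems(1) clos_mono[OF _ sub(1)] c3 by auto
  next
    case 5
    then show ?thesis using While.IH(2)[of s "W # ks"] While.prems(1) clos_mono[OF _ sub(2)] c1 by auto
  qed (use c1 c2 c3 in auto)
next
  case (Choice a b)
  let ?Q = "conts (Choice a b) ks"
  have sub: "conts a ks \<subseteq> ?Q" "conts b ks \<subseteq> ?Q" by auto
  have hd: "Ctl (a # ks) \<in> ?Q" "Ctl (b # ks) \<in> ?Q" using sub Ctl_in_conts by auto
  consider "s = Ctl (Choice a b # ks)" | "s \<in> conts a ks" | "s \<in> conts b ks"
    using Choice.prems by auto
  then show ?case
  proof cases
    case 1
    then show ?thesis using hd by (auto simp: clos_Ctl)
  next
    case 2
    then show ?thesis using Choice.IH(1) Choice.prems(1) clos_mono[OF _ sub(1)] by auto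
  next
    case 3
    then show ?thesis using Choice.IH(2) Choice.prems(1) clos_mono[OF _ sub(2)] by auto
  qed
qed (auto simp: clos_Ctl)

lemma tm_closed_compile:
  assumes "cok n c"
  shows "tm_closed delta (Start c) (Ctl []) Blank Mark (insert (Start c) (conts c [])) ({Blank, Mark} \<union> Bits ` Pow {..<n})"
proof
  let ?Q = "insert (Start c) (conts c [])"
  have cl: "clos n ?Q s" if "s \<in> ?Q" for s
  proof (cases "s = Start c")
    case True
    then show ?thesis using Ctl_in_conts[of c "[]"] by (auto simp: clos_def)
  next
    case False
    then have "s = Ctl [] \<or> clos n (conts c []) s" using clos_conts[OF assms] that by auto
    then show ?thesis using clos_mono[of n "conts c []" s ?Q] by (auto simp: clos_Ctl)
  qed
  fix s c' k s' di k' dw ou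
  assume s: "s \<in> ?Q" and k: "k \<in> {Blank, Mark} \<union> Bits ` Pow {..<n}" and st: "(s', di, k', dw, ou) \<in> set (delta s c' k)"
  have "bits_of k \<subseteq> {..<n}" using k by auto
  then have "s' \<in> ?Q \<and> bits_of k' \<subseteq> {..<n}" using cl[OF s] st unfolding clos_def by blast
  then show "s' \<in> ?Q \<and> k' \<in> {Blank, Mark} \<union> Bits ` Pow {..<n}" by (cases k') auto
qed (auto simp: finite_conts Ctl_tail_in_conts)

section \<open>Registers on the tape and the correctness of scans\<close>

definition col :: "(nat \<Rightarrow> nat) \<Rightarrow> nat \<Rightarrow> nat set" where
  "col \<sigma> j = {r. odd (\<sigma> r div 2 ^ j)}"

text \<open>The first condition makes the final control state independent of where the scan meets blank tape.\<close>

definition scans :: "(bool \<Rightarrow> nat set \<Rightarrow> bool \<times> nat set) \<Rightarrow> (nat \<Rightarrow> nat) \<Rightarrow> (nat \<Rightarrow> nat) \<Rightarrow> bool \<Rightarrow> bool" where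
  "scans f \<sigma> \<sigma>' b \<longleftrightarrow> (\<forall>b. snd (f b {}) = {} \<longrightarrow> fst (f b {}) = b) \<and>
     (\<exists>c. \<not> c 0 \<and> (\<forall>j. f (c j) (col \<sigma> j) = (c (Suc j), col \<sigma>' j)) \<and> (\<exists>j0. \<forall>j\<ge>j0. c j = b))"

locale prog = fixes x :: "sym list" and B :: nat and nd :: bool
begin

abbreviation gd :: "st \<times> nat \<times> (nat \<Rightarrow> wsym) \<times> nat \<Rightarrow> bool \<Rightarrow> sym list \<Rightarrow> bool" where
  "gd \<equiv> good delta (Ctl []) x (Suc B) nd"

definition bd :: "(nat \<Rightarrow> nat) \<Rightarrow> bool" where "bd \<sigma> \<longleftrightarrow> (\<forall>r. \<sigma> r < 2 ^ B)"

text \<open>\<open>V\<close> is the number of columns written so far; all digits from there on are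
  zero but their cells are still blank. One register state thus has several tapes, and
  \<open>Gh\<close> quantifies over all of them.\<close>

definition rep :: "nat \<Rightarrow> (nat \<Rightarrow> nat) \<Rightarrow> (nat \<Rightarrow> wsym) \<Rightarrow> bool" where
  "rep V \<sigma> t \<longleftrightarrow> V \<le> B \<and> bd \<sigma> \<and> (\<forall>j\<ge>V. col \<sigma> j = {}) \<and> t 0 = Mark \<and>
     (\<forall>j. t (Suc j) = (if j < V then Bits (col \<sigma> j) else Blank))"

definition Gh :: "com list \<Rightarrow> (nat \<Rightarrow> nat) \<Rightarrow> nat \<Rightarrow> bool \<Rightarrow> sym list \<Rightarrow> bool" where
  "Gh ks \<sigma> i p os \<longleftrightarrow> (\<forall>t V. i \<le> Suc (length x) \<longrightarrow> rep V \<sigma> t \<longrightarrow> gd (Ctl ks, i, t, 0) p os)"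

text \<open>Register programs may leave the input head anywhere, since each of their reads first
  repositions it by \<open>GOTO\<close>.\<close>

definition G :: "com list \<Rightarrow> (nat \<Rightarrow> nat) \<Rightarrow> bool \<Rightarrow> sym list \<Rightarrow> bool" where
  "G ks \<sigma> p os \<longleftrightarrow> (\<forall>i. Gh ks \<sigma> i p os)"

lemma Gh_step:
  assumes "\<And>k. cdelta ks (read_in x i) k = [(Ctl ks', di, k, Stay, ou)]" "Gh ks' \<sigma> (move_in x di i) p os"
  shows "Gh ks \<sigma> i p ((case ou of None \<Rightarrow> [] | Some c \<Rightarrow> [c]) @ os)"
  unfolding Gh_def
proof (intro allI impI)
  fix t V assume r: "rep V \<sigma> t"
  have "gd (Ctl ks, i, t, 0) p (tout (Ctl ks', di, t 0, Stay, ou) @ os)"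
    by (rule good.det) (use assms r in \<open>auto simp: Gh_def move_in_def\<close>)
  then show "gd (Ctl ks, i, t, 0) p ((case ou of None \<Rightarrow> [] | Some c \<Rightarrow> [c]) @ os)" by simp
qed

lemma Gh_stay:
  assumes "\<And>k. cdelta ks (read_in x i) k = [(Ctl ks', Stay, k, Stay, None)]" "Gh ks' \<sigma> i p os"
  shows "Gh ks \<sigma> i p os"
  using Gh_step[OF assms(1), of \<sigma> p os] assms(2)
  by (cases "i \<le> Suc (length x)") (simp_all add: move_in_def min_absorb1, simp add: Gh_def)

lemma Gh_Nil: "Gh [] \<sigma> i True []"
  unfolding Gh_def by (auto intro: good.halt_acc)

lemma Gh_Fail: "Gh (Fail # ks) \<sigma> i False os"
  unfolding Gh_def by (auto intro: good.halt_rej)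

lemma Gh_Skip: "Gh ks \<sigma> i p os \<Longrightarrow> Gh (Skip # ks) \<sigma> i p os"
  by (rule Gh_stay) auto

lemma Gh_Seq: "Gh (a # b # ks) \<sigma> i p os \<Longrightarrow> Gh (Seq a b # ks) \<sigma> i p os"
  by (rule Gh_stay) auto

lemma Gh_While: "Gh ((q ;; If t (a ;; While q t a) Skip) # ks) \<sigma> i p os \<Longrightarrow> Gh (While q t a # ks) \<sigma> i p os"
  by (rule Gh_stay) auto

lemma Gh_At: "Gh ((if P (read_in x i) then a else b) # ks) \<sigma> i p os \<Longrightarrow> Gh (If (At P) a b # ks) \<sigma> i p os"
  by (rule Gh_stay) auto

lemma Gh_MvR: "Gh ks \<sigma> (min (Suc i) (Suc (length x))) p os \<Longrightarrow> Gh (MvR # ks) \<sigma> i p os"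
  using Gh_step[of "MvR # ks" i ks Rgt None \<sigma> p os] by (simp add: move_in_def)

lemma Gh_MvL: "Gh ks \<sigma> (min (i - 1) (Suc (length x))) p os \<Longrightarrow> Gh (MvL # ks) \<sigma> i p os"
  using Gh_step[of "MvL # ks" i ks Lft None \<sigma> p os] by (simp add: move_in_def)

lemma Gh_Out:
  assumes "Gh ks \<sigma> i p os"
  shows "Gh (Out s # ks) \<sigma> i p (s # os)"
proof (cases "i \<le> Suc (length x)")
  case True
  then show ?thesis using Gh_step[of "Out s # ks" i ks Stay "Some s" \<sigma> p os] assms
    by (simp add: move_in_def min_absorb1)
qed (simp add: Gh_def)

lemma Gh_Choice:
  assumes "nd" "a \<noteq> b" "Gh (a # ks) \<sigma> i p1 os" "Gh (b # ks) \<sigma> i p2 os"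
  shows "Gh (Choice a b # ks) \<sigma> i (p1 \<noteq> p2) os"
  unfolding Gh_def
proof (intro allI impI)
  fix t V assume r: "i \<le> Suc (length x)" "rep V \<sigma> t"
  then have g: "gd (Ctl (a # ks), i, t, 0) p1 os" "gd (Ctl (b # ks), i, t, 0) p2 os"
    using assms(3,4) unfolding Gh_def by blast+
  show "gd (Ctl (Choice a b # ks), i, t, 0) (p1 \<noteq> p2) os"
    by (rule good.branch[where ?tr1.0 = "(Ctl (a # ks), Stay, t 0, Stay, None)" and ?tr2.0 = "(Ctl (b # ks), Stay, t 0, Stay, None)"])
      (use assms(1,2) r g in \<open>auto simp: move_in_def min_absorb1\<close>)
qed

lemma ret_home:
  assumes "t 0 = Mark" "\<And>j. t (Suc j) \<noteq> Mark" "gd (Ctl ks, i, t, 0) p os" "w \<le> Suc B" "i \<le> Suc (length x)"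
  shows "gd (Ret ks, i, t, w) p os"
  using assms(4)
proof (induction w)
  case 0
  have "gd (Ret ks, i, t, 0) p (tout (Ctl ks, Stay, t 0, Stay, None) @ os)"
    by (rule good.det) (use assms in \<open>auto simp: move_in_def min_absorb1 fun_upd_idem\<close>)
  then show ?case by simp
next
  case (Suc w)
  have "gd (Ret ks, i, t, Suc w) p (tout (Ret ks, Stay, t (Suc w), Lft, None) @ os)"
    by (rule good.det) (use assms(1,2,5) Suc in \<open>auto simp: move_in_def min_absorb1\<close>)
  then show ?case by simp
qed

lemma col_bound:
  assumes "bd \<sigma>" "B \<le> j"
  shows "col \<sigma> j = {}"
proof -
  have "\<sigma> r div 2 ^ j = 0" for r
  proof -
    have "\<sigma> r < 2 ^ B" "(2::nat) ^ B \<le> 2 ^ j" using assms by (auto simp: bd_def)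
    then show ?thesis by (intro div_less) linarith
  qed
  then show ?thesis by (simp add: col_def)
qed

text \<open>\<open>c\<close> is the trace of control states on infinitely many columns. The machine
  stops at the first blank column where nothing is written, and from there on \<open>st\<close>
  freezes the control, so the state found there is already the limit \<open>b\<close>. The induction
  runs over the columns left below \<open>B\<close>.\<close>

lemma scan_run:
  assumes st: "\<And>b. snd (f b {}) = {} \<Longrightarrow> fst (f b {}) = b"
    and c: "\<And>j. f (c j) (col \<sigma> j) = (c (Suc j), col \<sigma>' j)"
    and lim: "\<And>j. j \<ge> j0 \<Longrightarrow> c j = b"
    and bd: "bd \<sigma>" "bd \<sigma>'" and i: "i \<le> Suc (length x)"
    and fin: "\<And>t V. rep V \<sigma>' t \<Longrightarrow> gd (Ctl (if b then k1 else k0), i, t, 0) p os"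
    and V: "\<And>j. j \<ge> V \<Longrightarrow> col \<sigma> j = {}"
    and j: "j \<le> B"
    and t: "t 0 = Mark" "\<And>m. m < j \<Longrightarrow> t (Suc m) = Bits (col \<sigma>' m)"
      "\<And>m. m \<ge> j \<Longrightarrow> t (Suc m) = (if m < V then Bits (col \<sigma> m) else Blank)"
    and VALIDATE: "V \<le> B"
  shows "gd (Sc f (c j) k1 k0, i, t, Suc j) p os"
  using j t
proof (induction "B - j" arbitrary: j t rule: less_induct)
  case less
  have bits: "bits_of (t (Suc j)) = col \<sigma> j" using less.prems(4)[of j] V[of j] by auto
  show ?case
  proof (cases "col \<sigma>' j = {} \<and> t (Suc j) = Blank")
    case True
    then have jV: "j \<ge> V" using less.prems(4)[of j] by (auto split: if_splits)
    \<comment> \<open>Beyond the stopping column every input column is empty, and an empty output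
      keeps the control state, hence also the next output, unchanged.\<close>
    have const: "c m = c j \<and> col \<sigma>' m = {}" if "m \<ge> j" for m
      using that
    proof (induction m rule: dec_induct)
      case (step m)
      have "f (c m) {} = (c (Suc m), {})" using c[of m] V[of m] step jV by simp
      then have "c (Suc m) = c j" using st[of "c m"] step by simp
      moreover have "col \<sigma>' (Suc m) = {}"
        using \<open>f (c m) {} = (c (Suc m), {})\<close> c[of "Suc m"] V[of "Suc m"] step jV st[of "c m"] by simp
      ultimately show ?case by simp
    qed (use True in simp)
    have cb: "c j = b" using const[of "max j j0"] lim[of "max j j0"] by simp
    have "rep j \<sigma>' t" unfolding rep_def using less.prems const bd jV by auto
    then have "gd (Ctl (if b then k1 else k0), i, t, 0) p os" by (rule fin)
    moreover have "t (Suc m) \<noteq> Mark" for m using less.prems(3)[of m] less.prems(4)[of m] by (cases "m < j") auto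
    ultimately have r: "gd (Ret (if b then k1 else k0), i, t, j) p os"
      using ret_home less.prems(1,2) i by simp
    have "gd (Sc f (c j) k1 k0, i, t, Suc j) p (tout (Ret (if b then k1 else k0), Stay, t (Suc j), Lft, None) @ os)"
      by (rule good.det)
        (use True bits c[of j] r cb less.prems(1) i in \<open>auto simp: move_in_def min_absorb1 fun_upd_idem\<close>)
    then show ?thesis by simp
  next
    case False
    \<comment> \<open>Column \<open>B\<close> is blank and, since values stay below
      \<open>2 ^ B\<close>, receives no digit. The scan therefore stops there at the latest, which
      confines the head to \<open>Suc B\<close>.\<close>
    have jB: "j < B"
    proof (rule ccontr)
      assume "\<not> j < B"
      then have "j = B" using less.prems(1) by simp
      then show False using False col_bound[OF bd(2), of j] less.prems(4)[of j] VALIDATE by auto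
    qed
    have "gd (Sc f (c (Suc j)) k1 k0, i, t(Suc j := Bits (col \<sigma>' j)), Suc (Suc j)) p os"
    proof (rule less.hyps)
      fix m assume "m < Suc j"
      then show "(t(Suc j := Bits (col \<sigma>' j))) (Suc m) = Bits (col \<sigma>' m)" using less.prems(3)[of m] by auto
    next
      fix m assume "Suc j \<le> m"
      then show "(t(Suc j := Bits (col \<sigma>' j))) (Suc m) = (if m < V then Bits (col \<sigma> m) else Blank)"
        using less.prems(4)[of m] by auto
    qed (use jB less.prems in auto)
    moreover have "delta (Sc f (c j) k1 k0) (read_in x i) (t (Suc j)) =
        [(Sc f (c (Suc j)) k1 k0, Stay, Bits (col \<sigma>' j), Rgt, None)]"
      using False by (auto simp: bits c)
    ultimately have "gd (Sc f (c j) k1 k0, i, t, Suc j) p (tout (Sc f (c (Suc j)) k1 k0, Stay, Bits (col \<sigma>' j), Rgt, None) @ os)"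
      by (intro good.det) (use jB i in \<open>auto simp: move_in_def min_absorb1\<close>)
    then show ?thesis by simp
  qed
qed

lemma Gh_Scan:
  assumes "bd \<sigma> \<Longrightarrow> bd \<sigma>'" "scans f \<sigma> \<sigma>' b" "Gh ((if b then a1 else a0) # ks) \<sigma>' i p os"
  shows "Gh (If (Scan f) a1 a0 # ks) \<sigma> i p os"
  unfolding Gh_def
proof (intro allI impI)
  fix t V assume i: "i \<le> Suc (length x)" and r: "rep V \<sigma> t"
  obtain c j0 where c: "\<And>b. snd (f b {}) = {} \<Longrightarrow> fst (f b {}) = b" "\<not> c 0"
    "\<And>j. f (c j) (col \<sigma> j) = (c (Suc j), col \<sigma>' j)" "\<And>j. j \<ge> j0 \<Longrightarrow> c j = b"
    using assms(2) unfolding scans_def by blast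
  have b: "bd \<sigma>" "bd \<sigma>'" using r assms(1) by (auto simp: rep_def)
  have "gd (Sc f (c 0) (a1 # ks) (a0 # ks), i, t, Suc 0) p os"
  proof (rule scan_run[OF c(1) c(3) c(4) b i, where V = V])
    fix t V assume "rep V \<sigma>' t"
    then show "gd (Ctl (if b then a1 # ks else a0 # ks), i, t, 0) p os"
      using assms(3) i by (cases b) (auto simp: Gh_def)
  qed (use r in \<open>auto simp: rep_def\<close>)
  then have "gd (Sc f False (a1 # ks) (a0 # ks), i, t, Suc 0) p os" using c(2) by simp
  then have "gd (Ctl (If (Scan f) a1 a0 # ks), i, t, 0) p (tout (Sc f False (a1 # ks) (a0 # ks), Stay, t 0, Rgt, None) @ os)"
    by (intro good.det) (use i r in \<open>auto simp: move_in_def min_absorb1 rep_def fun_upd_idem\<close>)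
  then show "gd (Ctl (If (Scan f) a1 a0 # ks), i, t, 0) p os" by simp
qed

lemma good_of_G:
  assumes "G [c] (\<lambda>_. 0) p os"
  shows "gd (Start c, 0, \<lambda>_. Blank, 0) p os"
proof -
  have "rep 0 (\<lambda>_. 0) ((\<lambda>_. Blank)(0 := Mark))" by (auto simp: rep_def col_def bd_def)
  then have "gd (Ctl [c], 0, (\<lambda>_. Blank)(0 := Mark), 0) p os" using assms by (auto simp: G_def Gh_def)
  then have "gd (Start c, 0, \<lambda>_. Blank, 0) p (tout (Ctl [c], Stay, Mark, Stay, None) @ os)"
    by (intro good.det) (auto simp: move_in_def)
  then show ?thesis by simp
qed

end

section \<open>Logarithmic register width\<close>

definition lg :: "sym list \<Rightarrow> nat" where "lg x = nat \<lceil>log 2 (real (length x + 2))\<rceil>"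

lemma lg_pos: "lg x \<ge> 1"
proof -
  have "log 2 (real (length x + 2)) \<ge> log 2 2" by (subst log_le_cancel_iff) auto
  then have "log 2 (real (length x + 2)) \<ge> 1" by simp
  then have "\<lceil>log 2 (real (length x + 2))\<rceil> \<ge> 1" by linarith
  then show ?thesis unfolding lg_def by linarith
qed

lemma two_pow_lg: "length x + 2 \<le> 2 ^ lg x"
proof -
  have "real (length x + 2) = 2 powr (log 2 (real (length x + 2)))" by simp
  also have "\<dots> \<le> 2 powr (real (lg x))"
  proof (rule powr_mono)
    show "log 2 (real (length x + 2)) \<le> real (lg x)"
      unfolding lg_def by (meson real_nat_ceiling_ge)
  qed simp
  also have "\<dots> = real (2 ^ lg x)" by (simp add: powr_realpow)
  finally show ?thesis by linarith
qed

lemma two_pow_lg_le: "2 ^ lg x \<le> 2 * (length x + 2)"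
proof -
  have p: "log 2 (real (length x + 2)) \<ge> 0" by simp
  have "2 powr real (lg x) \<le> 2 powr (log 2 (real (length x + 2)) + 1)"
    unfolding lg_def using p by (intro powr_mono) linarith+
  also have "\<dots> = 2 * real (length x + 2)" by (simp add: powr_add)
  finally have "2 powr real (lg x) \<le> real (2 * (length x + 2))" by simp
  moreover have "2 powr real (lg x) = real (2 ^ lg x)" by (simp add: powr_realpow)
  ultimately show ?thesis by linarith
qed

text \<open>The work head may reach cell \<open>Suc (d * lg x)\<close>; passing from
  \<open>d\<close> to \<open>d + 1\<close> absorbs the extra cell because \<open>lg x\<close> is at
  least 1.\<close>

lemma parityL_of_program:
  assumes "cok n c" "\<And>x. \<exists>os. prog.G x (d * lg x) True [c] (\<lambda>_. 0) (x \<in> A) os"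
  shows "A \<in> parityL"
proof (rule tm_closed.parityL_of_good[OF tm_closed_compile[OF assms(1)], of "d + 1"])
  fix x
  obtain os where "prog.G x (d * lg x) True [c] (\<lambda>_. 0) (x \<in> A) os" using assms(2) by blast
  from prog.good_of_G[OF this] have "good delta (Ctl []) x (Suc (d * lg x)) True (Start c, 0, \<lambda>_. Blank, 0) (x \<in> A) os" .
  moreover have "logspace_bound (d + 1) x (Suc (d * lg x))"
    using lg_pos[of x] unfolding logspace_bound_def lg_def[symmetric] by simp
  ultimately show "\<exists>H os. logspace_bound (d + 1) x H \<and> good delta (Ctl []) x H True (Start c, 0, \<lambda>_. Blank, 0) (x \<in> A) os"
    by blast
qed

lemma logspace_computable_of_program:
  assumes "cok n c" "\<And>x. prog.G x (d * lg x) False [c] (\<lambda>_. 0) True (f x)"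
  shows "logspace_computable f"
proof (rule tm_closed.logspace_computable_of_good[OF tm_closed_compile[OF assms(1)], of "d + 1"])
  fix x
  from prog.good_of_G[OF assms(2)] have "good delta (Ctl []) x (Suc (d * lg x)) False (Start c, 0, \<lambda>_. Blank, 0) True (f x)" .
  moreover have "logspace_bound (d + 1) x (Suc (d * lg x))"
    using lg_pos[of x] unfolding logspace_bound_def lg_def[symmetric] by simp
  ultimately show "\<exists>H. logspace_bound (d + 1) x H \<and> good delta (Ctl []) x H False (Start c, 0, \<lambda>_. Blank, 0) True (f x)"
    by blast
qed

section \<open>Basic commands\<close>

text \<open>In \<open>f_inc\<close> and \<open>f_dec\<close> the control state \<open>False\<close> means that a carry is pending. \<open>f_dec\<close> runs forever on a zero register.\<close>

definition f_inc :: "nat \<Rightarrow> bool \<Rightarrow> nat set \<Rightarrow> bool \<times> nat set" where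
  "f_inc r b A = (if b then (True, A) else if r \<in> A then (False, A - {r}) else (True, insert r A))"
definition f_dec :: "nat \<Rightarrow> bool \<Rightarrow> nat set \<Rightarrow> bool \<times> nat set" where
  "f_dec r b A = (if b then (True, A) else if r \<in> A then (True, A - {r}) else (False, insert r A))"
definition f_copy :: "nat \<Rightarrow> nat \<Rightarrow> bool \<Rightarrow> nat set \<Rightarrow> bool \<times> nat set" where
  "f_copy r s b A = (b, if s \<in> A then insert r A else A - {r})"
definition f_clr :: "nat \<Rightarrow> bool \<Rightarrow> nat set \<Rightarrow> bool \<times> nat set" where
  "f_clr r b A = (b, A - {r})"
definition f_nz :: "nat \<Rightarrow> bool \<Rightarrow> nat set \<Rightarrow> bool \<times> nat set" where
  "f_nz r b A = (b \<or> r \<in> A, A)"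

lemma div_Suc_cases: "Suc n div d = n div d \<or> Suc n div d = Suc (n div d)"
  by (simp add: div_Suc)

lemma pow_gt: "n < j \<Longrightarrow> (n::nat) < 2 ^ j"
  using less_exp[of j] by linarith

lemma div_pow_Suc: "(n::nat) div 2 ^ Suc j = n div 2 ^ j div 2"
  by (simp add: div_mult2_eq mult.commute[of 2])

lemma mod_pow_Suc: "(n::nat) mod 2 ^ Suc j = 2 ^ j * (n div 2 ^ j mod 2) + n mod 2 ^ j"
  by (simp add: mod_mult2_eq mult.commute[of 2])

text \<open>The carry rule, with \<open>m\<close> and \<open>m'\<close> the quotients of
  \<open>n\<close> and \<open>Suc n\<close> by \<open>2 ^ j\<close>: they differ iff a carry reaches
  digit \<open>j\<close>, and the difference survives halving iff that digit of \<open>n\<close> is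
  1.\<close>

lemma half_step:
  assumes "(m'::nat) = m \<or> m' = Suc m"
  shows "(m' div 2 = m div 2) = (m' = m \<or> even m)" "odd m' = (odd m \<noteq> (m' \<noteq> m))"
  using assms by presburger+

lemma col_upd: "col (\<sigma>(r := v)) j = (if odd (v div 2 ^ j) then insert r (col \<sigma> j) else col \<sigma> j - {r})"
  by (auto simp: col_def)

lemma col_iff: "r \<in> col \<sigma> j \<longleftrightarrow> odd (\<sigma> r div 2 ^ j)"
  by (simp add: col_def)

lemma scans_inc: "scans (f_inc r) \<sigma> (\<sigma>(r := Suc (\<sigma> r))) True"
  unfolding scans_def
\<comment> \<open>The trace says at digit \<open>j\<close> that the carry has already been absorbed.
  At \<open>j = 0\<close> it is false, and once \<open>2 ^ j\<close> exceeds both numbers the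
  quotients are 0.\<close>
proof (intro conjI exI[of _ "\<lambda>j. Suc (\<sigma> r) div 2 ^ j = \<sigma> r div 2 ^ j"] exI[of _ "Suc (Suc (\<sigma> r))"] allI impI)
  fix j
  show "f_inc r (Suc (\<sigma> r) div 2 ^ j = \<sigma> r div 2 ^ j) (col \<sigma> j) =
      (Suc (\<sigma> r) div 2 ^ Suc j = \<sigma> r div 2 ^ Suc j, col (\<sigma>(r := Suc (\<sigma> r))) j)"
    using half_step[OF div_Suc_cases[of "\<sigma> r" "2 ^ j"]] unfolding div_pow_Suc
    by (auto simp: f_inc_def col_upd col_iff insert_absorb)
next
  fix j assume "Suc (Suc (\<sigma> r)) \<le> j"
  then show "(Suc (\<sigma> r) div 2 ^ j = \<sigma> r div 2 ^ j) = True"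
    using pow_gt[of "Suc (\<sigma> r)" j] by simp
qed (auto simp: f_inc_def split: if_splits)

lemma scans_dec:
  assumes "\<sigma> r \<noteq> 0"
  shows "scans (f_dec r) \<sigma> (\<sigma>(r := \<sigma> r - 1)) True"
proof -
  obtain n where n: "\<sigma> r = Suc n" using assms by (cases "\<sigma> r") auto
  show ?thesis unfolding scans_def
  \<comment> \<open>The same trace as for the increment of \<open>n\<close>: the borrow in
    \<open>Suc n - 1\<close> runs through exactly the digits that the carry in \<open>n + 1\<close>
    does.\<close>
  proof (intro conjI exI[of _ "\<lambda>j. Suc n div 2 ^ j = n div 2 ^ j"] exI[of _ "Suc (Suc n)"] allI impI)
    fix j
    show "f_dec r (Suc n div 2 ^ j = n div 2 ^ j) (col \<sigma> j) =
        (Suc n div 2 ^ Suc j = n div 2 ^ Suc j, col (\<sigma>(r := \<sigma> r - 1)) j)"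
      using half_step[OF div_Suc_cases[of n "2 ^ j"]] unfolding div_pow_Suc
      by (auto simp: f_dec_def col_upd col_iff n insert_absorb)
  next
    fix j assume "Suc (Suc n) \<le> j"
    then show "(Suc n div 2 ^ j = n div 2 ^ j) = True"
      using pow_gt[of "Suc n" j] by simp
  qed (auto simp: f_dec_def split: if_splits)
qed

lemma scans_copy: "scans (f_copy r s) \<sigma> (\<sigma>(r := \<sigma> s)) False"
  unfolding scans_def
  by (intro conjI exI[of _ "\<lambda>j. False"] exI[of _ "0::nat"]) (auto simp: f_copy_def col_def)

lemma scans_clr: "scans (f_clr r) \<sigma> (\<sigma>(r := 0)) False"
  unfolding scans_def
  by (intro conjI exI[of _ "\<lambda>j. False"] exI[of _ "0::nat"]) (auto simp: f_clr_def col_def)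

lemma scans_nz: "scans (f_nz r) \<sigma> \<sigma> (\<sigma> r \<noteq> 0)"
  unfolding scans_def
\<comment> \<open>The trace records whether one of the \<open>j\<close> lowest digits is 1.\<close>
proof (intro conjI exI[of _ "\<lambda>j. \<sigma> r mod 2 ^ j \<noteq> 0"] exI[of _ "Suc (\<sigma> r)"] allI impI)
  fix j
  show "f_nz r (\<sigma> r mod 2 ^ j \<noteq> 0) (col \<sigma> j) = (\<sigma> r mod 2 ^ Suc j \<noteq> 0, col \<sigma> j)"
    unfolding mod_pow_Suc by (auto simp: f_nz_def col_def odd_iff_mod_2_eq_one)
next
  fix j assume "Suc (\<sigma> r) \<le> j"
  then show "(\<sigma> r mod 2 ^ j \<noteq> 0) = (\<sigma> r \<noteq> 0)" using pow_gt[of "\<sigma> r" j] by simp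
qed (auto simp: f_nz_def)

definition "INC r = If (Scan (f_inc r)) Skip Skip"
definition "DEC r = If (Scan (f_dec r)) Skip Skip"
definition "CLR r = If (Scan (f_clr r)) Skip Skip"
definition "COPY r s = If (Scan (f_copy r s)) Skip Skip"
definition "IFNZ r a b = If (Scan (f_nz r)) a b"
definition "WHNZ r a = While Skip (Scan (f_nz r)) a"
text \<open>The head position is not known, so the head is rewound to the left end and then moved
  right while register 0 counts down. Register 0 is zero again afterwards, which is why the rules
  below assume \<open>\<sigma> 0 = 0\<close>.\<close>

definition "GOTO r = While Skip (At (\<lambda>c. c \<noteq> LEnd)) MvL ;; COPY 0 r ;; While Skip (Scan (f_nz 0)) (DEC 0 ;; MvR)"
definition "BR r P a b = GOTO r ;; If (At P) a b"
definition "WHR r P a = While (GOTO r) (At P) a"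

lemma tok_scan: "r < n \<Longrightarrow> tok n (Scan (f_inc r))" "r < n \<Longrightarrow> tok n (Scan (f_dec r))"
  "r < n \<Longrightarrow> tok n (Scan (f_clr r))" "r < n \<Longrightarrow> tok n (Scan (f_copy r s))"
  "tok n (Scan (f_nz s))"
  by (auto simp: f_inc_def f_dec_def f_clr_def f_copy_def f_nz_def)

lemma cok_macro [simp]:
  "r < n \<Longrightarrow> cok n (INC r)" "r < n \<Longrightarrow> cok n (DEC r)" "r < n \<Longrightarrow> cok n (CLR r)" "r < n \<Longrightarrow> cok n (COPY r s)"
  "cok n (IFNZ r a b) = (cok n a \<and> cok n b)" "cok n (WHNZ r a) = cok n a"
  "0 < n \<Longrightarrow> cok n (BR r P a b) = (cok n a \<and> cok n b)" "0 < n \<Longrightarrow> cok n (WHR r P a) = cok n a"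
  using tok_scan(1-4)[of _ n] tok_scan(5)
  by (auto simp: INC_def DEC_def CLR_def COPY_def IFNZ_def WHNZ_def GOTO_def BR_def WHR_def simp del: tok.simps(1))

section \<open>Counting semantics of commands\<close>

context prog
begin

text \<open>\<open>\<Omega>\<close> lists the states in which the branches of \<open>c\<close> that do not fail end; commands compose as in the list monad.\<close>

definition run :: "com \<Rightarrow> (nat \<Rightarrow> nat) \<Rightarrow> (nat \<Rightarrow> nat) list \<Rightarrow> sym list \<Rightarrow> bool" where
  "run c \<sigma> \<Omega> os \<longleftrightarrow> (\<forall>ks P os'. (\<forall>\<sigma>' \<in> set \<Omega>. G ks \<sigma>' (P \<sigma>') os') \<longrightarrow>
     G (c # ks) \<sigma> (odd (length (filter P \<Omega>))) (os @ os'))"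

lemma G_of_run: "run c \<sigma> \<Omega> os \<Longrightarrow> G [c] \<sigma> (odd (length \<Omega>)) os"
proof -
  assume "run c \<sigma> \<Omega> os"
  then have "G [c] \<sigma> (odd (length (filter (\<lambda>_. True) \<Omega>))) (os @ [])"
    unfolding run_def by (metis G_def Gh_Nil)
  then show ?thesis by simp
qed

lemma run_Skip: "run Skip \<sigma> [\<sigma>] []"
  by (auto simp: run_def G_def intro: Gh_Skip)

lemma run_Fail: "run Fail \<sigma> [] os"
  by (auto simp: run_def G_def intro: Gh_Fail)

lemma run_Out: "run (Out s) \<sigma> [\<sigma>] [s]"
  by (auto simp: run_def G_def intro: Gh_Out)

text \<open>Why a semantics by parities composes: modulo 2 a sum depends only on the parities of its
  terms.\<close>

lemma odd_filter_concat:
  assumes "\<And>s. s \<in> set xs \<Longrightarrow> Q s = odd (length (filter P (F s)))"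
  shows "odd (length (filter P (concat (map F xs)))) = odd (length (filter Q xs))"
  using assms by (induction xs) auto

lemma run_Seq:
  assumes "run a \<sigma> \<Omega>1 o1" "\<And>\<sigma>1. \<sigma>1 \<in> set \<Omega>1 \<Longrightarrow> run b \<sigma>1 (F \<sigma>1) o2"
  shows "run (a ;; b) \<sigma> (concat (map F \<Omega>1)) (o1 @ o2)"
  unfolding run_def
proof (intro allI impI)
  fix ks P os'
  assume k: "\<forall>\<sigma>' \<in> set (concat (map F \<Omega>1)). G ks \<sigma>' (P \<sigma>') os'"
  define Q where "Q s = odd (length (filter P (F s)))" for s
  have "G (b # ks) \<sigma>1 (Q \<sigma>1) (o2 @ os')" if "\<sigma>1 \<in> set \<Omega>1" for \<sigma>1
    using assms(2)[OF that] k that unfolding run_def Q_def by auto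
  then have "G (a # b # ks) \<sigma> (odd (length (filter Q \<Omega>1))) (o1 @ o2 @ os')"
    using assms(1) unfolding run_def by blast
  then have "G (a # b # ks) \<sigma> (odd (length (filter P (concat (map F \<Omega>1))))) (o1 @ o2 @ os')"
    using odd_filter_concat[of \<Omega>1 Q P F] Q_def by simp
  then show "G ((a ;; b) # ks) \<sigma> (odd (length (filter P (concat (map F \<Omega>1))))) ((o1 @ o2) @ os')"
    unfolding G_def append_assoc using Gh_Seq by blast
qed

lemma run_seq: "run a \<sigma> [\<sigma>1] [] \<Longrightarrow> run b \<sigma>1 \<Omega> os \<Longrightarrow> run (a ;; b) \<sigma> \<Omega> os"
  using run_Seq[of a \<sigma> "[\<sigma>1]" "[]" b "\<lambda>_. \<Omega>" os] by simp

lemma run_seq_out: "run a \<sigma> [\<sigma>1] o1 \<Longrightarrow> run b \<sigma>1 \<Omega> o2 \<Longrightarrow> os = o1 @ o2 \<Longrightarrow> run (a ;; b) \<sigma> \<Omega> os"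
  using run_Seq[of a \<sigma> "[\<sigma>1]" o1 b "\<lambda>_. \<Omega>" o2] by simp

lemma run_seq_fail: "run a \<sigma> [] os \<Longrightarrow> run (a ;; b) \<sigma> [] os"
  using run_Seq[of a \<sigma> "[]" os b "\<lambda>_. []" "[]"] by simp

text \<open>Counts multiply because all surviving branches of \<open>a\<close> end in one state. For
  this reason subroutines restore their scratch registers.\<close>

lemma run_seq_rep:
  assumes "run a \<sigma> (replicate m \<sigma>1) []" "run b \<sigma>1 (replicate n \<sigma>2) []"
  shows "run (a ;; b) \<sigma> (replicate (m * n) \<sigma>2) []"
proof -
  have "concat (replicate m (replicate n \<sigma>2)) = replicate (m * n) \<sigma>2"
    by (induction m) (simp_all add: replicate_add)
  then show ?thesis using run_Seq[OF assms(1), of b "\<lambda>_. replicate n \<sigma>2" "[]"] assms(2) by simp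
qed

lemma run_Scan:
  assumes "bd \<sigma> \<Longrightarrow> bd \<sigma>'" "scans f \<sigma> \<sigma>' b" "run (if b then a1 else a0) \<sigma>' \<Omega> os"
  shows "run (If (Scan f) a1 a0) \<sigma> \<Omega> os"
  using assms(3) Gh_Scan[OF assms(1,2), of a1 a0] unfolding run_def G_def by blast

lemma run_While:
  "run (q ;; If t (a ;; While q t a) Skip) \<sigma> \<Omega> os \<Longrightarrow> run (While q t a) \<sigma> \<Omega> os"
  unfolding run_def G_def using Gh_While by blast

text \<open>Different commands give different stacks, hence the different target states that
  \<open>branch\<close> asks for.\<close>

lemma run_Choice:
  assumes "nd" "a \<noteq> b" "run a \<sigma> \<Omega>1 os" "run b \<sigma> \<Omega>2 os"
  shows "run (Choice a b) \<sigma> (\<Omega>1 @ \<Omega>2) os"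
  unfolding run_def
proof (intro allI impI)
  fix ks P os' assume k: "\<forall>\<sigma>' \<in> set (\<Omega>1 @ \<Omega>2). G ks \<sigma>' (P \<sigma>') os'"
  have "G (a # ks) \<sigma> (odd (length (filter P \<Omega>1))) (os @ os')" "G (b # ks) \<sigma> (odd (length (filter P \<Omega>2))) (os @ os')"
    using assms(3,4) k unfolding run_def by auto
  then have "G (Choice a b # ks) \<sigma> (odd (length (filter P \<Omega>1)) \<noteq> odd (length (filter P \<Omega>2))) (os @ os')"
    using Gh_Choice[OF assms(1,2)] unfolding G_def by blast
  moreover have "(odd (length (filter P \<Omega>1)) \<noteq> odd (length (filter P \<Omega>2))) = odd (length (filter P (\<Omega>1 @ \<Omega>2)))"
    by simp
  ultimately show "G (Choice a b # ks) \<sigma> (odd (length (filter P (\<Omega>1 @ \<Omega>2)))) (os @ os')" by simp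
qed

lemma run_INC: "Suc (\<sigma> r) < 2 ^ B \<Longrightarrow> run (INC r) \<sigma> [\<sigma>(r := Suc (\<sigma> r))] []"
  unfolding INC_def by (rule run_Scan[OF _ scans_inc]) (auto simp: bd_def run_Skip)

lemma run_DEC: "\<sigma> r \<noteq> 0 \<Longrightarrow> run (DEC r) \<sigma> [\<sigma>(r := \<sigma> r - 1)] []"
  unfolding DEC_def by (rule run_Scan[OF _ scans_dec]) (auto simp: bd_def run_Skip intro: le_less_trans[OF diff_le_self])

lemma run_CLR: "run (CLR r) \<sigma> [\<sigma>(r := 0)] []"
  unfolding CLR_def by (rule run_Scan[OF _ scans_clr]) (auto simp: bd_def run_Skip)

lemma run_COPY: "run (COPY r s) \<sigma> [\<sigma>(r := \<sigma> s)] []"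
  unfolding COPY_def by (rule run_Scan[OF _ scans_copy]) (auto simp: bd_def run_Skip)

lemma run_IFNZ: "run (if \<sigma> r \<noteq> 0 then a else b) \<sigma> \<Omega> os \<Longrightarrow> run (IFNZ r a b) \<sigma> \<Omega> os"
  unfolding IFNZ_def by (rule run_Scan[OF _ scans_nz]) auto

lemma run_WHNZ:
  assumes "run (if \<sigma> r \<noteq> 0 then a ;; WHNZ r a else Skip) \<sigma> \<Omega> os"
  shows "run (WHNZ r a) \<sigma> \<Omega> os"
  unfolding WHNZ_def
  by (rule run_While, rule run_seq[OF run_Skip], rule run_Scan[OF _ scans_nz]) (use assms in \<open>auto simp: WHNZ_def\<close>)

lemma Gh_rewind: "Gh ks \<sigma> 0 p os \<Longrightarrow> Gh (While Skip (At (\<lambda>c. c \<noteq> LEnd)) MvL # ks) \<sigma> i p os"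
proof (induction i)
  case 0
  show ?case by (rule Gh_While, rule Gh_Seq, rule Gh_Skip, rule Gh_At) (simp add: read_in_def 0 Gh_Skip)
next
  case (Suc i)
  show ?case
  proof (cases "Suc i \<le> Suc (length x)")
    case True
    then have "read_in x (Suc i) \<noteq> LEnd" by (auto simp: read_in_def)
    then show ?thesis
      by (intro Gh_While, intro Gh_Seq, intro Gh_Skip, intro Gh_At)
        (use Suc True in \<open>simp, intro Gh_Seq Gh_MvL, simp add: min_absorb1\<close>)
  qed (simp add: Gh_def)
qed

lemma Gh_forward:
  assumes "Gh ks (\<sigma>(0 := 0)) (min (i + n) (Suc (length x))) p os" "i \<le> Suc (length x)"
  shows "Gh (While Skip (Scan (f_nz 0)) (DEC 0 ;; MvR) # ks) (\<sigma>(0 := n)) i p os"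
  using assms
proof (induction n arbitrary: i)
  case 0
  have "Gh ((if (\<sigma>(0 := 0)) 0 \<noteq> 0 then (DEC 0 ;; MvR) ;; While Skip (Scan (f_nz 0)) (DEC 0 ;; MvR) else Skip) # ks) (\<sigma>(0 := 0)) i p os"
    using Gh_Skip[OF 0(1)] 0(2) by (simp only: fun_upd_same simp_thms if_False add_0_right min_absorb1)
  then show ?case by (intro Gh_While Gh_Seq Gh_Skip) (rule Gh_Scan[OF _ scans_nz])
next
  case (Suc n)
  have "Gh (While Skip (Scan (f_nz 0)) (DEC 0 ;; MvR) # ks) (\<sigma>(0 := n)) (min (Suc i) (Suc (length x))) p os"
    by (rule Suc.IH) (use Suc.prems in \<open>auto simp: min_def split: if_splits\<close>)
  then have "Gh (MvR # While Skip (Scan (f_nz 0)) (DEC 0 ;; MvR) # ks) (\<sigma>(0 := n)) i p os" by (rule Gh_MvR)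
  moreover have "scans (f_dec 0) (\<sigma>(0 := Suc n)) (\<sigma>(0 := n)) True"
    using scans_dec[of "\<sigma>(0 := Suc n)" 0] by simp
  ultimately have "Gh (DEC 0 # MvR # While Skip (Scan (f_nz 0)) (DEC 0 ;; MvR) # ks) (\<sigma>(0 := Suc n)) i p os"
    unfolding DEC_def by (intro Gh_Scan[where \<sigma>' = "\<sigma>(0 := n)" and b = True]) (auto simp: bd_def Gh_Skip split: if_splits)
  then have "Gh ((if (\<sigma>(0 := Suc n)) 0 \<noteq> 0 then (DEC 0 ;; MvR) ;; While Skip (Scan (f_nz 0)) (DEC 0 ;; MvR) else Skip) # ks) (\<sigma>(0 := Suc n)) i p os"
    by (simp add: Gh_Seq)
  then show ?case by (intro Gh_While Gh_Seq Gh_Skip) (rule Gh_Scan[OF _ scans_nz])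
qed

lemma Gh_GOTO:
  assumes "\<sigma> 0 = 0" "Gh ks \<sigma> (min (\<sigma> r) (Suc (length x))) p os"
  shows "Gh (GOTO r # ks) \<sigma> i p os"
proof -
  have "Gh (While Skip (Scan (f_nz 0)) (DEC 0 ;; MvR) # ks) (\<sigma>(0 := \<sigma> r)) 0 p os"
    by (rule Gh_forward) (use assms in \<open>auto simp: fun_upd_idem\<close>)
  then have "Gh (COPY 0 r # While Skip (Scan (f_nz 0)) (DEC 0 ;; MvR) # ks) \<sigma> 0 p os"
    unfolding COPY_def by (intro Gh_Scan[OF _ scans_copy]) (auto simp: bd_def Gh_Skip)
  then show ?thesis unfolding GOTO_def by (intro Gh_Seq Gh_rewind)
qed

text \<open>Every position behind the input reads \<open>REnd\<close>, so stopping the head at the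
  right end does not change what \<open>GOTO\<close> lets one read.\<close>

lemma read_in_min: "read_in x (min i (Suc (length x))) = read_in x i"
  by (auto simp: read_in_def min_def)

lemma run_BR:
  assumes "\<sigma> 0 = 0" "run (if P (read_in x (\<sigma> r)) then a else b) \<sigma> \<Omega> os"
  shows "run (BR r P a b) \<sigma> \<Omega> os"
  unfolding run_def G_def BR_def
proof (intro allI impI)
  fix ks Pr os' i assume k: "\<forall>\<sigma>' \<in> set \<Omega>. \<forall>i. Gh ks \<sigma>' i (Pr \<sigma>') os'"
  show "Gh ((GOTO r ;; If (At P) a b) # ks) \<sigma> i (odd (length (filter Pr \<Omega>))) (os @ os')"
    by (intro Gh_Seq Gh_GOTO assms(1) Gh_At) (use assms(2) k in \<open>simp add: run_def G_def read_in_min\<close>)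
qed

lemma run_WHR:
  assumes "\<sigma> 0 = 0" "run (if P (read_in x (\<sigma> r)) then a ;; WHR r P a else Skip) \<sigma> \<Omega> os"
  shows "run (WHR r P a) \<sigma> \<Omega> os"
  unfolding WHR_def
  by (rule run_While, rule run_BR[unfolded BR_def], rule assms(1), rule assms(2)[unfolded WHR_def])

end

section \<open>The Heisenberg picture\<close>

declare bin.simps [simp del]

text \<open>Heisenberg picture: the bit at qubit \<open>q\<close> of the X-part (\<open>k = False\<close>) or Z-part (\<open>k = True\<close>) of
  the observable \<open>Z\<^sub>1\<close> conjugated back through \<open>gs\<close> is the parity of the following count of
  paths through the circuit.\<close>

fun cnt :: "gate list \<Rightarrow> bool \<Rightarrow> nat \<Rightarrow> nat" where
  "cnt [] k q = (if k \<and> q = 1 then 1 else 0)"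
| "cnt (CNOT a b # gs) k q = cnt gs k q + (if \<not> k \<and> q = b then cnt gs False a else 0)
     + (if k \<and> q = a then cnt gs True b else 0)"
| "cnt (Hadamard a # gs) k q = cnt gs (if q = a then \<not> k else k) q"
| "cnt (Phase a # gs) k q = cnt gs k q + (if k \<and> q = a then cnt gs False a else 0)"
| "cnt (Measure a # gs) k q = cnt gs k q"

abbreviation "xb gs \<equiv> (\<lambda>q. odd (cnt gs False q))"
abbreviation "zb gs \<equiv> (\<lambda>q. odd (cnt gs True q))"

text \<open>A measurement of an anticommuting qubit annihilates the conjugated observable.\<close>

fun alive :: "gate list \<Rightarrow> bool" where
  "alive [] = True"
| "alive (Measure a # gs) = (\<not> xb gs a \<and> alive gs)"
| "alive (g # gs) = alive gs"

text \<open>In the normal form \<open>i^k Z X\<close> of \<open>pauli\<close>, a Hadamard gate turns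
  \<open>Z X\<close> on its qubit into \<open>X Z = - Z X\<close>, which costs 2, and a Phase gate
  turns \<open>X\<close> into \<open>i Z X\<close>, which costs 1.\<close>

fun phase_exp :: "gate list \<Rightarrow> nat" where
  "phase_exp [] = 0"
| "phase_exp (Hadamard a # gs) = phase_exp gs + (if xb gs a \<and> zb gs a then 2 else 0)"
| "phase_exp (Phase a # gs) = phase_exp gs + (if xb gs a then 1 else 0)"
| "phase_exp (g # gs) = phase_exp gs"

section \<open>Pauli operators and their conjugation by gates\<close>

definition chi :: "(nat \<Rightarrow> bool) \<Rightarrow> (nat \<Rightarrow> bool) \<Rightarrow> complex" where
  "chi Z y = (\<Prod>j \<in> {j. Z j}. if y j then -1 else 1)"

definition pauli :: "(nat \<Rightarrow> bool) \<Rightarrow> (nat \<Rightarrow> bool) \<Rightarrow> nat \<Rightarrow> qstate \<Rightarrow> qstate" where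
  "pauli X Z k \<psi> = (\<lambda>y. \<i> ^ k * chi Z y * \<psi> (\<lambda>j. y j \<noteq> X j))"

lemma finite_upd: "finite {j. Z j} \<Longrightarrow> finite (Collect (Z(a := v)))"
  by (rule finite_subset[of _ "insert a {j. Z j}"]) auto

text \<open>\<open>chi Z\<close> is the character given by the sign of the overlap of
  \<open>Z\<close> and \<open>y\<close>, the diagonal of the Z-part. Finiteness matters because a
  product over an infinite set is 1 by convention; \<open>finite_cnt\<close> provides it.\<close>

lemma chi_split:
  assumes "finite {j. Z j}"
  shows "chi Z y = chi (Z(a := False)) y * (if Z a \<and> y a then -1 else 1)"
proof (cases "Z a")
  case True
  have e: "{j. Z j} = insert a {j. (Z(a := False)) j}" using True by auto
  note finite_upd[OF assms, of a False]
  from prod.insert[OF this, of a "\<lambda>j. if y j then -1 else (1::complex)"] show ?thesis unfolding chi_def e using True by simp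
next
  case False
  then have "Z(a := False) = Z" by (auto simp: fun_eq_iff)
  then show ?thesis using False by simp
qed

lemma chi_irrel: "chi (Z(a := False)) (y(a := v)) = chi (Z(a := False)) y"
  unfolding chi_def by (rule prod.cong) auto

lemma xor_upd: "(\<lambda>j. (y(a := v)) j \<noteq> (X(a := w)) j) = (\<lambda>j. y j \<noteq> X j)(a := (v \<noteq> w))"
  by auto

text \<open>Stated as \<open>P U = U P'\<close>, which avoids inverse gates. X spreads from control
  to target and Z from target to control; with Z written left of X no sign arises.\<close>

lemma pauli_CNOT:
  assumes "finite {j. Z j}" "a \<noteq> b"
  shows "pauli X Z k (apply_unitary (CNOT a b) \<psi>) =
    apply_unitary (CNOT a b) (pauli (X(b := (X b \<noteq> X a))) (Z(a := (Z a \<noteq> Z b))) k \<psi>)"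
proof
  fix y
  define R where "R = chi (Z(a := False, b := False)) y"
  let ?Z = "Z(a := (Z a \<noteq> Z b))" and ?y = "y(b := (y b \<noteq> y a))"
  have "chi Z y = R * (if Z b \<and> y b then -1 else 1) * (if Z a \<and> y a then -1 else 1)"
    unfolding R_def chi_split[OF assms(1), of y a] chi_split[OF finite_upd[OF assms(1), of a False], of y b]
    using assms(2) by simp
  moreover have "chi ?Z ?y = chi (Z(a := False, b := False)) ?y * (if Z b \<and> ?y b then -1 else 1) * (if ?Z a \<and> y a then -1 else 1)"
    using assms(2) chi_split[OF finite_upd[OF assms(1), of a "Z a \<noteq> Z b"], of ?y a]
      chi_split[OF finite_upd[OF assms(1), of a False], of ?y b] by (simp add: fun_upd_upd del: fun_upd_apply) simp
  moreover have "chi (Z(a := False, b := False)) ?y = R" unfolding R_def by (rule chi_irrel)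
  ultimately have "chi ?Z ?y = chi Z y" using assms(2) by auto
  moreover have "(\<lambda>j. ?y j \<noteq> (X(b := (X b \<noteq> X a))) j) = (\<lambda>j. y j \<noteq> X j)(b := ((y b \<noteq> X b) \<noteq> (y a \<noteq> X a)))"
    by (rule ext) auto
  ultimately show "pauli X Z k (apply_unitary (CNOT a b) \<psi>) y =
      apply_unitary (CNOT a b) (pauli (X(b := (X b \<noteq> X a))) ?Z k \<psi>) y"
    by (simp add: pauli_def)
qed

lemma pauli_Phase:
  assumes "finite {j. Z j}"
  shows "pauli X Z k (apply_unitary (Phase a) \<psi>) =
    apply_unitary (Phase a) (pauli X (Z(a := (Z a \<noteq> X a))) (k + (if X a then 1 else 0)) \<psi>)"
proof
  fix y
  show "pauli X Z k (apply_unitary (Phase a) \<psi>) y =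
      apply_unitary (Phase a) (pauli X (Z(a := (Z a \<noteq> X a))) (k + (if X a then 1 else 0)) \<psi>) y"
    unfolding pauli_def apply_unitary.simps chi_split[OF assms, of y a] chi_split[OF finite_upd[OF assms, of a "Z a \<noteq> X a"], of y a]
    by (cases "X a"; cases "Z a"; cases "y a") (simp_all add: algebra_simps)
qed

lemma pauli_Hadamard:
  assumes "finite {j. Z j}"
  shows "pauli X Z k (apply_unitary (Hadamard a) \<psi>) =
    apply_unitary (Hadamard a) (pauli (X(a := Z a)) (Z(a := X a)) (k + (if X a \<and> Z a then 2 else 0)) \<psi>)"
proof
  fix y
  have c: "chi (Z(a := v)) (y(a := w)) = chi (Z(a := False)) y * (if v \<and> w then -1 else 1)" for v w
    using chi_split[OF finite_upd[OF assms, of a v], of "y(a := w)" a] by (simp only: chi_irrel fun_upd_upd fun_upd_same)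
  show "pauli X Z k (apply_unitary (Hadamard a) \<psi>) y =
      apply_unitary (Hadamard a) (pauli (X(a := Z a)) (Z(a := X a)) (k + (if X a \<and> Z a then 2 else 0)) \<psi>) y"
    unfolding pauli_def apply_unitary.simps chi_split[OF assms, of y a] c xor_upd
    by (cases "X a"; cases "Z a"; cases "y a") (simp_all add: algebra_simps diff_divide_distrib add_divide_distrib)
qed

text \<open>Because the gate rules have the form \<open>P U = U P'\<close>, injectivity is what
  carries an eigenvalue equation across a gate. A CNOT with equal control and target would erase a
  bit and is not injective.\<close>

lemma unitary_inj:
  assumes "apply_unitary g \<phi> = apply_unitary g \<psi>" "\<And>a b. g = CNOT a b \<Longrightarrow> a \<noteq> b"
  shows "\<phi> = \<psi>"
proof
  fix y
  show "\<phi> y = \<psi> y"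
  proof (cases g)
    case (CNOT a b)
    have "apply_unitary g \<phi> (y(b := (y b \<noteq> y a))) = apply_unitary g \<psi> (y(b := (y b \<noteq> y a)))" using assms by simp
    moreover have "(y b = (\<not> y a)) = (\<not> y a) \<longleftrightarrow> y b" by auto
    ultimately show ?thesis using CNOT assms(2)[OF CNOT] by simp
  next
    case (Hadamard a)
    have s: "complex_of_real (sqrt 2) \<noteq> 0" by simp
    have 0: "\<phi> (y(a := False)) + \<phi> (y(a := True)) = \<psi> (y(a := False)) + \<psi> (y(a := True))"
      using fun_cong[OF assms(1), of "y(a := False)"] s by (simp add: Hadamard)
    have 1: "\<phi> (y(a := False)) - \<phi> (y(a := True)) = \<psi> (y(a := False)) - \<psi> (y(a := True))"
      using fun_cong[OF assms(1), of "y(a := True)"] s by (simp add: Hadamard)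
    have lin: "u = u' \<and> v = v'" if "u + v = u' + v'" "u - v = u' - v'" for u v u' v' :: complex
      using that by (auto simp: complex_eq_iff)
    note lin[OF 0 1]
    then have "\<phi> (y(a := y a)) = \<psi> (y(a := y a))" by (cases "y a") (simp_all del: fun_upd_triv)
    then show ?thesis by simp
  next
    case (Phase a)
    then show ?thesis using fun_cong[OF assms(1), of y] by (auto split: if_splits)
  next
    case (Measure a)
    then show ?thesis using fun_cong[OF assms(1), of y] by simp
  qed
qed

lemma unitary_neg: "apply_unitary g (\<lambda>y. - \<psi> y) = (\<lambda>y. - apply_unitary g \<psi> y)"
  by (cases g) (auto simp: fun_eq_iff field_simps)

lemma unitary_zero: "apply_unitary g (\<lambda>y. 0) = (\<lambda>y. 0)"
  by (cases g) auto

fun operands :: "gate \<Rightarrow> nat list" where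
  "operands (CNOT a b) = [a, b]"
| "operands (Hadamard a) = [a]"
| "operands (Phase a) = [a]"
| "operands (Measure a) = [a]"

lemma cnt_unused: "q \<notin> (\<Union>g \<in> set gs. set (operands g)) \<Longrightarrow> cnt gs k q = cnt [] k q"
  by (induction gs k q rule: cnt.induct) auto

lemma finite_cnt: "finite {q. odd (cnt gs k q)}"
proof (rule finite_subset)
  show "{q. odd (cnt gs k q)} \<subseteq> insert 1 (\<Union>g \<in> set gs. set (operands g))"
  proof
    fix q assume "q \<in> {q. odd (cnt gs k q)}"
    then show "q \<in> insert 1 (\<Union>g \<in> set gs. set (operands g))" using cnt_unused[of q gs k] by (auto split: if_splits)
  qed
qed auto

section \<open>Certainty as an eigenvalue equation\<close>

definition allzero :: "gate list \<Rightarrow> qstate \<Rightarrow> bool" where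
  "allzero gs \<psi> \<longleftrightarrow> (\<forall>\<phi> \<in> branches gs \<psi>. \<forall>x. \<not> x 1 \<longrightarrow> \<phi> x = 0)"

abbreviation obs :: "gate list \<Rightarrow> qstate \<Rightarrow> qstate" where
  "obs gs \<equiv> pauli (xb gs) (zb gs) (phase_exp gs)"

lemma obs_Nil: "obs [] \<psi> y = (if y 1 then - \<psi> y else \<psi> y)"
proof -
  have "{j. (\<lambda>q. odd (cnt [] True q)) j} = {1}" by auto
  then show ?thesis by (simp add: pauli_def chi_def)
qed

lemma obs_unitary:
  assumes "\<And>a. g \<noteq> Measure a" "\<And>a b. g = CNOT a b \<Longrightarrow> a \<noteq> b"
  shows "obs gs (apply_unitary g \<psi>) = apply_unitary g (obs (g # gs) \<psi>)"
proof (cases g)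
  case (CNOT a b)
  have "xb (g # gs) = (xb gs)(b := (xb gs b \<noteq> xb gs a))" "zb (g # gs) = (zb gs)(a := (zb gs a \<noteq> zb gs b))"
    "phase_exp (g # gs) = phase_exp gs"
    using assms(2)[OF CNOT] by (auto simp: CNOT fun_eq_iff)
  then show ?thesis using pauli_CNOT[where Z = "zb gs", OF finite_cnt assms(2)[OF CNOT], of "xb gs" "phase_exp gs" \<psi>] CNOT by simp
next
  case (Hadamard a)
  have "xb (g # gs) = (xb gs)(a := zb gs a)" "zb (g # gs) = (zb gs)(a := xb gs a)"
    by (auto simp: Hadamard fun_eq_iff)
  then show ?thesis using pauli_Hadamard[where Z = "zb gs", OF finite_cnt, of "xb gs" "phase_exp gs" a \<psi>] Hadamard by simp
next
  case (Phase a)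
  have "xb (g # gs) = xb gs" "zb (g # gs) = (zb gs)(a := (zb gs a \<noteq> xb gs a))"
    by (auto simp: Phase fun_eq_iff)
  then show ?thesis using pauli_Phase[where Z = "zb gs", OF finite_cnt, of "xb gs" "phase_exp gs" a \<psi>] Phase by simp
qed (use assms in auto)

lemma branches_unitary:
  "(\<And>a. g \<noteq> Measure a) \<Longrightarrow> branches (g # gs) \<psi> = branches gs (apply_unitary g \<psi>)"
  by (cases g) auto

lemma alive_unitary: "(\<And>a. g \<noteq> Measure a) \<Longrightarrow> alive (g # gs) = alive gs"
  by (cases g) auto

text \<open>An X at qubit \<open>a\<close> exchanges the two outcome subspaces, and without it the
  operator preserves both. This is all that a measurement does to the observable.\<close>

lemma pauli_proj:
  "pauli X Z k (proj a b \<psi>) = proj a (b \<noteq> X a) (pauli X Z k \<psi>)"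
  by (auto simp: pauli_def proj_def fun_eq_iff)

lemma proj_eqI: "\<lbrakk>\<And>b. proj a b \<phi> = proj a b \<psi>\<rbrakk> \<Longrightarrow> \<phi> = \<psi>"
proof
  fix y assume "\<And>b. proj a b \<phi> = proj a b \<psi>"
  from fun_cong[OF this[of "y a"], of y] show "\<phi> y = \<psi> y" by (simp add: proj_def)
qed

lemma proj_neg: "proj a b (\<lambda>y. - \<psi> y) = (\<lambda>y. - proj a b \<psi> y)"
  by (auto simp: proj_def)

lemma proj_zero: "proj a b (\<lambda>y. 0) = (\<lambda>y. 0)"
  by (auto simp: proj_def)

text \<open>Reading zero is impossible iff the state is a (-1)-eigenvector of Z on qubit 1, and this
  is pulled back gate by gate. The alternative \<open>\<psi> = 0\<close> has to be carried along
  since branches of probability 0 are zero vectors.\<close>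

lemma allzero_iff:
  assumes "\<And>a b. CNOT a b \<in> set gs \<Longrightarrow> a \<noteq> b"
  shows "allzero gs \<psi> \<longleftrightarrow> \<psi> = (\<lambda>y. 0) \<or> (alive gs \<and> obs gs \<psi> = (\<lambda>y. - \<psi> y))"
  using assms
proof (induction gs arbitrary: \<psi>)
  case Nil
  have "allzero [] \<psi> \<longleftrightarrow> obs [] \<psi> = (\<lambda>y. - \<psi> y)"
    unfolding fun_eq_iff obs_Nil by (auto simp: allzero_def)
  moreover have "obs gs (\<lambda>y. 0) = (\<lambda>y. 0)" for gs unfolding pauli_def by simp
  ultimately show ?case by (cases "\<psi> = (\<lambda>y. 0)") (simp_all del: cnt.simps phase_exp.simps)
next
  case (Cons g gs)
  note IH = Cons.IH[OF Cons.prems, OF list.set_intros(2)]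
  show ?case
  proof (cases "\<exists>a. g = Measure a")
    case False
    then have g: "\<And>a. g \<noteq> Measure a" by auto
    have c: "\<And>a b. g = CNOT a b \<Longrightarrow> a \<noteq> b" using Cons.prems by auto
    have "allzero (g # gs) \<psi> \<longleftrightarrow> allzero gs (apply_unitary g \<psi>)"
      unfolding allzero_def branches_unitary[OF g] ..
    also have "\<dots> \<longleftrightarrow> apply_unitary g \<psi> = (\<lambda>y. 0) \<or>
        alive gs \<and> obs gs (apply_unitary g \<psi>) = (\<lambda>y. - apply_unitary g \<psi> y)" by (rule IH)
    also have "apply_unitary g \<psi> = (\<lambda>y. 0) \<longleftrightarrow> \<psi> = (\<lambda>y. 0)"
      using unitary_inj[of g \<psi> "\<lambda>y. 0"] unitary_zero[of g] c by auto
    also have "obs gs (apply_unitary g \<psi>) = (\<lambda>y. - apply_unitary g \<psi> y) \<longleftrightarrow> obs (g # gs) \<psi> = (\<lambda>y. - \<psi> y)"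
    proof -
      have o: "obs gs (apply_unitary g \<psi>) = apply_unitary g (obs (g # gs) \<psi>)" by (rule obs_unitary[OF g c])
      show ?thesis unfolding o unitary_neg[symmetric]
        using unitary_inj[of g "obs (g # gs) \<psi>" "\<lambda>y. - \<psi> y", OF _ c] by (metis (no_types))
    qed
    finally show ?thesis unfolding alive_unitary[OF g] .
  next
    case True
    then obtain a where g: "g = Measure a" by blast
    have X: "obs (g # gs) = obs gs" by (simp add: g)
    have "allzero (g # gs) \<psi> \<longleftrightarrow> (\<forall>b. allzero gs (proj a b \<psi>))"
      unfolding allzero_def g by (auto simp: all_bool_eq)
    also have "\<dots> \<longleftrightarrow> (\<forall>b. proj a b \<psi> = (\<lambda>y. 0) \<or> alive gs \<and> obs gs (proj a b \<psi>) = (\<lambda>y. - proj a b \<psi> y))"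
      using IH by simp
    also have "\<dots> \<longleftrightarrow> \<psi> = (\<lambda>y. 0) \<or> (alive (g # gs) \<and> obs (g # gs) \<psi> = (\<lambda>y. - \<psi> y))"
    proof (cases "xb gs a")
      case True
      \<comment> \<open>The observable has an X at \<open>a\<close>, so the two sides of
        \<open>h\<close> are supported on opposite values of that bit and both vanish.\<close>
      have "proj a b \<psi> = (\<lambda>y. 0)" if h: "obs gs (proj a b \<psi>) = (\<lambda>y. - proj a b \<psi> y)" for b
      proof
        fix y
        have "proj a (\<not> b) (obs gs \<psi>) y = - proj a b \<psi> y"
          using fun_cong[OF h, of y] True unfolding pauli_proj by simp
        then show "proj a b \<psi> y = 0" by (simp add: proj_def split: if_splits)
      qed
      then have "(\<forall>b. proj a b \<psi> = (\<lambda>y. 0) \<or> alive gs \<and> obs gs (proj a b \<psi>) = (\<lambda>y. - proj a b \<psi> y)) \<longleftrightarrow>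
          (\<forall>b. proj a b \<psi> = (\<lambda>y. 0))" by blast
      also have "\<dots> \<longleftrightarrow> \<psi> = (\<lambda>y. 0)" using proj_eqI[of a \<psi> "\<lambda>y. 0"] proj_zero by (metis (no_types))
      finally show ?thesis using True by (simp only: g alive.simps simp_thms)
    next
      case False
      \<comment> \<open>The observable commutes with both projections, so the equations for the two
        outcomes are the two components of the equation before the measurement.\<close>
      have e: "obs gs (proj a b \<psi>) = (\<lambda>y. - proj a b \<psi> y) \<longleftrightarrow> proj a b (obs gs \<psi>) = proj a b (\<lambda>y. - \<psi> y)" for b
        unfolding pauli_proj proj_neg using False by simp
      have z: "proj a b \<psi> = (\<lambda>y. 0) \<Longrightarrow> proj a b (obs gs \<psi>) = proj a b (\<lambda>y. - \<psi> y)" for b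
        unfolding e[symmetric] by (simp add: pauli_def)
      have "(\<forall>b. proj a b \<psi> = (\<lambda>y. 0)) \<longleftrightarrow> \<psi> = (\<lambda>y. 0)"
        using proj_eqI[of a \<psi> "\<lambda>y. 0"] proj_zero by (metis (no_types))
      moreover have "(\<forall>b. proj a b (obs gs \<psi>) = proj a b (\<lambda>y. - \<psi> y)) \<longleftrightarrow> obs gs \<psi> = (\<lambda>y. - \<psi> y)"
        using proj_eqI[of a "obs gs \<psi>" "\<lambda>y. - \<psi> y"] by (metis (no_types))
      moreover have "alive (g # gs) = alive gs" using False by (simp add: g)
      ultimately show ?thesis unfolding X e using z by blast
    qed
    finally show ?thesis .
  qed
qed

text \<open>Counts the ways to choose two Phase gates or one Hadamard gate, weighted by the bits that make them contribute to
  \<open>phase_exp\<close>; in mode 1 the first Phase gate, in mode 2 everything has been chosen.\<close>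

fun sign_cnt :: "nat \<Rightarrow> gate list \<Rightarrow> nat" where
  "sign_cnt m [] = (if m = 2 then 1 else 0)"
| "sign_cnt m (Hadamard a # gs) = sign_cnt m gs + (if m = 0 then cnt gs False a * cnt gs True a * sign_cnt 2 gs else 0)"
| "sign_cnt m (Phase a # gs) = sign_cnt m gs + (if m < 2 then cnt gs False a * sign_cnt (Suc m) gs else 0)"
| "sign_cnt m (g # gs) = sign_cnt m gs"

lemma sign_cnt_2: "sign_cnt 2 gs = 1"
proof (induction gs)
  case (Cons g gs)
  then show ?case by (cases g) auto
qed simp

section \<open>The exponent of the imaginary unit modulo 4\<close>

lemma mod4_add2:
  assumes "(k::nat) mod 4 = 2 * (s mod 2) + t mod 2"
  shows "(k + (if odd p then 2 else 0)) mod 4 = 2 * ((s + p) mod 2) + t mod 2"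
  unfolding mod_add_left_eq[of k 4, symmetric] mod_add_eq[of s 2 p, symmetric] assms
  by (cases "even s"; cases "even t"; cases "even p") (simp_all add: mod2_eq_if)

text \<open>Adding a bit \<open>c\<close> to the two-bit number with digits \<open>s\<close> and
  \<open>t\<close> carries \<open>c * t\<close> into the high digit. Iterated over the Phase gates,
  these carries are the pairs counted by mode 0 of \<open>sign_cnt\<close>.\<close>

lemma mod4_add1:
  assumes "(k::nat) mod 4 = 2 * (s mod 2) + t mod 2"
  shows "(k + (if odd c then 1 else 0)) mod 4 = 2 * ((s + c * t) mod 2) + (t + c) mod 2"
  unfolding mod_add_left_eq[of k 4, symmetric] mod_add_eq[of s 2 "c * t", symmetric] mod_add_eq[of t 2 c, symmetric] assms
  by (cases "even s"; cases "even t"; cases "even c") (simp_all add: mod2_eq_if)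

lemma phase_exp_mod_4: "phase_exp gs mod 4 = 2 * (sign_cnt 0 gs mod 2) + sign_cnt 1 gs mod 2"
proof (induction gs rule: phase_exp.induct)
  case (2 a gs)
  from mod4_add2[OF this, of "cnt gs False a * cnt gs True a"] show ?case by (simp add: sign_cnt_2)
next
  case (3 a gs)
  from mod4_add1[OF this, of "cnt gs False a"] show ?case using sign_cnt_2[of gs] by (simp add: numeral_2_eq_2)
qed auto

lemma i_power_mod4: "\<i> ^ k = -1 \<longleftrightarrow> k mod 4 = (2::nat)"
proof -
  have "\<i> ^ k = \<i> ^ (k mod 4)"
  proof -
    have "\<i> ^ k = \<i> ^ (4 * (k div 4) + k mod 4)" by simp
    also have "\<dots> = (\<i> ^ 4) ^ (k div 4) * \<i> ^ (k mod 4)" by (simp only: power_add power_mult)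
    also have "\<i> ^ 4 = 1" by (simp add: power4_eq_xxxx)
    finally show ?thesis by simp
  qed
  moreover have "k mod 4 = 0 \<or> k mod 4 = 1 \<or> k mod 4 = 2 \<or> k mod 4 = 3" by auto
  ultimately show ?thesis by (auto simp: power3_eq_cube complex_eq_iff)
qed

text \<open>Z factors fix the all-zero state and any X factor moves it to an orthogonal one, so an
  eigenvector needs an empty X-part and then the scalar alone decides.\<close>

lemma obs_init: "obs gs init_state = (\<lambda>y. - init_state y) \<longleftrightarrow> (\<forall>q. \<not> xb gs q) \<and> \<i> ^ phase_exp gs = -1"
proof
  assume h: "obs gs init_state = (\<lambda>y. - init_state y)"
  have c: "chi (zb gs) (\<lambda>_. False) = 1" by (simp add: chi_def)
  have "\<i> ^ phase_exp gs * init_state (xb gs) = - 1"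
    using fun_cong[OF h, of "\<lambda>_. False"] by (simp add: pauli_def c) (simp add: init_state_def)
  then show "(\<forall>q. \<not> xb gs q) \<and> \<i> ^ phase_exp gs = -1" by (auto simp: init_state_def split: if_splits)
next
  assume h: "(\<forall>q. \<not> xb gs q) \<and> \<i> ^ phase_exp gs = -1"
  have "chi (zb gs) y = 1" if "\<forall>i. \<not> y i" for y using that by (simp add: chi_def)
  then show "obs gs init_state = (\<lambda>y. - init_state y)" using h by (auto simp: pauli_def init_state_def fun_eq_iff)
qed

text \<open>The condition on the X-part is restricted to operands of gates: a qubit that no gate
  mentions keeps X-bit 0, and a machine can visit qubits only by visiting gates.\<close>

theorem certainly_one_iff:
  assumes "\<And>a b. CNOT a b \<in> set gs \<Longrightarrow> a \<noteq> b"
  shows "qubit1_certainly_one gs \<longleftrightarrow>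
    alive gs \<and> (\<forall>g \<in> set gs. \<forall>q \<in> set (operands g). even (cnt gs False q)) \<and> even (sign_cnt 1 gs) \<and> odd (sign_cnt 0 gs)"
proof -
  have ne: "init_state \<noteq> (\<lambda>y. 0)" by (auto simp: init_state_def fun_eq_iff)
  have u: "(\<forall>q. even (cnt gs False q)) \<longleftrightarrow> (\<forall>g \<in> set gs. \<forall>q \<in> set (operands g). even (cnt gs False q))"
  proof (intro iffI allI)
    fix q assume "\<forall>g \<in> set gs. \<forall>q \<in> set (operands g). even (cnt gs False q)"
    then show "even (cnt gs False q)" using cnt_unused[of q gs False] by (cases "q \<in> (\<Union>g \<in> set gs. set (operands g))") auto
  qed auto
  have "qubit1_certainly_one gs \<longleftrightarrow> allzero gs init_state" by (simp add: qubit1_certainly_one_def allzero_def)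
  also have "\<dots> \<longleftrightarrow> alive gs \<and> (\<forall>q. even (cnt gs False q)) \<and> phase_exp gs mod 4 = 2"
    using allzero_iff[where gs = gs and \<psi> = init_state, OF assms] ne obs_init[of gs] i_power_mod4[of "phase_exp gs"] by auto
  also have "phase_exp gs mod 4 = 2 \<longleftrightarrow> even (sign_cnt 1 gs) \<and> odd (sign_cnt 0 gs)"
    unfolding phase_exp_mod_4 by (auto simp: mod2_eq_if)
  finally show ?thesis unfolding u .
qed

section \<open>Register programs and numerals\<close>

datatype op = C nat nat | Z nat | I nat

fun cop :: "op \<Rightarrow> com" where
  "cop (C r s) = COPY r s"
| "cop (Z r) = CLR r"
| "cop (I r) = INC r"

fun evop :: "op \<Rightarrow> (nat \<Rightarrow> nat) \<Rightarrow> nat \<Rightarrow> nat" where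
  "evop (C r s) \<sigma> = \<sigma>(r := \<sigma> s)"
| "evop (Z r) \<sigma> = \<sigma>(r := 0)"
| "evop (I r) \<sigma> = \<sigma>(r := Suc (\<sigma> r))"

fun OPS :: "op list \<Rightarrow> com" where
  "OPS [] = Skip"
| "OPS (p # ps) = cop p ;; OPS ps"

fun evops :: "op list \<Rightarrow> (nat \<Rightarrow> nat) \<Rightarrow> nat \<Rightarrow> nat" where
  "evops [] \<sigma> = \<sigma>"
| "evops (p # ps) \<sigma> = evops ps (evop p \<sigma>)"

fun okops :: "nat \<Rightarrow> op list \<Rightarrow> (nat \<Rightarrow> nat) \<Rightarrow> bool" where
  "okops n [] \<sigma> = True"
| "okops n (I r # ps) \<sigma> = (Suc (\<sigma> r) < n \<and> okops n ps (evop (I r) \<sigma>))"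
| "okops n (p # ps) \<sigma> = okops n ps (evop p \<sigma>)"

text \<open>Inverting this one step turns \<open>Gh_Seq\<close> into the equivalence
  \<open>G_Seq_iff\<close>, by which a loop and the command after it can be treated as one
  unit.\<close>

lemma (in prog) good_Seq_inv:
  assumes "gd (Ctl ((a ;; b) # ks), i, t, 0) p os" "i \<le> Suc (length x)"
  shows "gd (Ctl (a # b # ks), i, t, 0) p os"
  using assms(1)
proof (cases rule: good.cases)
  case (det tr os')
  then have "tr = (Ctl (a # b # ks), Stay, t 0, Stay, None)" by simp
  then show ?thesis using det assms(2) by (simp add: move_in_def min_absorb1)
qed auto

context prog
begin

lemma G_Seq_iff: "G ((a ;; b) # ks) \<sigma> p os \<longleftrightarrow> G (a # b # ks) \<sigma> p os"
proof
  assume "G ((a ;; b) # ks) \<sigma> p os"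
  then show "G (a # b # ks) \<sigma> p os" unfolding G_def Gh_def using good_Seq_inv by blast
qed (auto simp: G_def intro: Gh_Seq)

lemma Gh_WHR:
  assumes "\<sigma> 0 = 0" "G ((if P (read_in x (\<sigma> r)) then a ;; WHR r P a else Skip) # c # ks) \<sigma> p os"
  shows "G (WHR r P a # c # ks) \<sigma> p os"
  unfolding G_def WHR_def
proof
  fix i
  show "Gh (While (GOTO r) (At P) a # c # ks) \<sigma> i p os"
    by (intro Gh_While Gh_Seq Gh_GOTO assms(1) Gh_At)
      (use assms(2) in \<open>simp add: read_in_min G_def WHR_def split: if_splits\<close>)
qed

lemma run_WHR_end:
  assumes "\<sigma> 0 = 0" "\<not> P (read_in x (\<sigma> r))" "run c \<sigma> \<Omega> os"
  shows "run (WHR r P a ;; c) \<sigma> \<Omega> os"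
  unfolding run_def G_Seq_iff
  by (intro allI impI Gh_WHR assms(1)) (use assms(2,3) in \<open>simp add: run_def G_def Gh_Skip\<close>)

text \<open>The rule includes the continuation \<open>c\<close> because branches leave the loop in
  different states; only after \<open>c\<close> has discarded the wrong ones do the survivors agree
  and give a plain count.\<close>

lemma run_WHR_body:
  assumes "\<sigma> 0 = 0" "P (read_in x (\<sigma> r))" "run a \<sigma> \<Omega>1 o1"
    and "\<And>\<sigma>1. \<sigma>1 \<in> set \<Omega>1 \<Longrightarrow> run (WHR r P a ;; c) \<sigma>1 (F \<sigma>1) o2"
  shows "run (WHR r P a ;; c) \<sigma> (concat (map F \<Omega>1)) (o1 @ o2)"
  unfolding run_def G_Seq_iff
proof (intro allI impI Gh_WHR assms(1))
  fix ks Q os' assume k: "\<forall>\<sigma>' \<in> set (concat (map F \<Omega>1)). G ks \<sigma>' (Q \<sigma>') os'"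
  define R where "R s = odd (length (filter Q (F s)))" for s
  have "G (WHR r P a # c # ks) \<sigma>1 (R \<sigma>1) (o2 @ os')" if "\<sigma>1 \<in> set \<Omega>1" for \<sigma>1
    using assms(4)[OF that] k that unfolding run_def R_def G_Seq_iff by auto
  then have "G (a # WHR r P a # c # ks) \<sigma> (odd (length (filter R \<Omega>1))) (o1 @ o2 @ os')"
    using assms(3) unfolding run_def by blast
  then show "G ((if P (read_in x (\<sigma> r)) then a ;; WHR r P a else Skip) # c # ks) \<sigma>
      (odd (length (filter Q (concat (map F \<Omega>1))))) ((o1 @ o2) @ os')"
    using odd_filter_concat[of \<Omega>1 R Q F] R_def assms(2) by (simp add: G_Seq_iff)
qed

lemma run_OPS: "okops (2 ^ B) ps \<sigma> \<Longrightarrow> run (OPS ps) \<sigma> [evops ps \<sigma>] []"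
proof (induction ps arbitrary: \<sigma>)
  case Nil
  then show ?case by (simp add: run_Skip)
next
  case (Cons p ps)
  have "run (cop p) \<sigma> [evop p \<sigma>] [] \<and> okops (2 ^ B) ps (evop p \<sigma>)"
    using Cons.prems by (cases p) (auto intro: run_COPY run_CLR run_INC)
  then show ?case using Cons.IH run_seq by auto
qed

lemma run_OPS_seq:
  "okops (2 ^ B) ps \<sigma> \<Longrightarrow> run c (evops ps \<sigma>) \<Omega> os \<Longrightarrow> run (OPS ps ;; c) \<sigma> \<Omega> os"
  by (rule run_seq[OF run_OPS])

lemma run_OPS_eq: "okops (2 ^ B) ps \<sigma> \<Longrightarrow> evops ps \<sigma> = \<sigma>' \<Longrightarrow> run (OPS ps) \<sigma> [\<sigma>'] []"
  using run_OPS by blast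

lemma run_eq: "run c \<sigma> \<Omega> os \<Longrightarrow> \<Omega> = \<Omega>' \<Longrightarrow> run c \<sigma> \<Omega>' os"
  by simp

end

section \<open>Canonical binary numerals\<close>

fun bval :: "sym list \<Rightarrow> nat" where
  "bval [] = 0"
| "bval (a # u) = (if a = S1 then 2 ^ length u else 0) + bval u"

lemma bval_lt: "bval u < 2 ^ length u"
  by (induction u) auto

lemma bval_snoc: "bval (u @ [a]) = 2 * bval u + (if a = S1 then 1 else 0)"
  by (induction u) auto

lemma bin_props: "bin q \<noteq> [] \<and> SHash \<notin> set (bin q) \<and> bval (bin q) = q \<and> (q \<ge> 1 \<longrightarrow> hd (bin q) = S1)"
proof (induction q rule: bin.induct)
  case (1 n)
  show ?case
  proof (cases "n < 2")
    case True
    then have "n = 0 \<or> n = 1" by auto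
    then show ?thesis by (auto simp: bin.simps[of n])
  next
    case False
    note IH = 1[OF False]
    have "bin n = bin (n div 2) @ [if even n then S0 else S1]" using False by (subst bin.simps) simp
    moreover have "n div 2 \<ge> 1" using False by auto
    ultimately show ?thesis using IH by (auto simp: bval_snoc elim: evenE oddE)
  qed
qed

lemma bin_bval: "SHash \<notin> set v \<Longrightarrow> bin (bval (S1 # v)) = S1 # v"
proof (induction v rule: rev_induct)
  case Nil
  then show ?case by (simp add: bin.simps[of "Suc 0"])
next
  case (snoc a v)
  let ?m = "bval (S1 # v)"
  have m: "?m \<ge> 1" by (simp add: Suc_le_eq)
  have e: "bval (S1 # v @ [a]) = 2 * ?m + (if a = S1 then 1 else 0)"
    using bval_snoc[of "S1 # v" a] by simp
  have "bin (2 * ?m + (if a = S1 then 1 else 0)) = bin ?m @ [a]"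
    using m snoc.prems by (subst bin.simps) (cases a; simp)
  then show ?case using e snoc by (cases a) simp_all
qed

text \<open>A leading \<open>S1\<close> makes a numeral canonical and excludes that of 0, which is
  right because qubits and \<open>n\<close> are positive.\<close>

definition isnum :: "sym list \<Rightarrow> bool" where
  "isnum u \<longleftrightarrow> (\<exists>v. u = S1 # v \<and> SHash \<notin> set v)"

lemma isnum_iff: "isnum u \<longleftrightarrow> (\<exists>q \<ge> 1. u = bin q)"
proof
  assume "isnum u"
  then obtain v where "u = S1 # v" "SHash \<notin> set v" by (auto simp: isnum_def)
  then show "\<exists>q \<ge> 1. u = bin q" using bin_bval[of v] by (intro exI[of _ "bval (S1 # v)"]) (simp add: Suc_le_eq)
next
  assume "\<exists>q \<ge> 1. u = bin q"
  then obtain q where q: "q \<ge> 1" "u = bin q" by blast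
  have "u = S1 # tl u" using bin_props[of q] q by (metis list.collapse)
  moreover have "SHash \<notin> set (tl u)" using bin_props[of q] q(2) by (metis list.set_sel(2))
  ultimately show "isnum u" unfolding isnum_def by blast
qed

lemma bin_split: "bin q @ SHash # r = bin q' @ SHash # r' \<Longrightarrow> q = q' \<and> r = r'"
proof -
  assume a: "bin q @ SHash # r = bin q' @ SHash # r'"
  have tw: "takeWhile (\<lambda>s. s \<noteq> SHash) (bin q @ SHash # r) = bin q" for q r
    using bin_props[of q] by (subst takeWhile_append2) auto
  have "bin q = bin q'" using tw a by metis
  moreover then have "q = q'" using bin_props by metis
  ultimately show ?thesis using a by simp
qed

definition posg :: "gate \<Rightarrow> bool" where "posg g \<longleftrightarrow> (\<forall>q \<in> set (operands g). q \<ge> 1)"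

definition enc :: "gate list \<Rightarrow> sym list" where "enc gs = concat (map enc_gate gs)"

lemma enc_simps [simp]: "enc [] = []" "enc (g # gs) = enc_gate g @ enc gs"
  by (auto simp: enc_def)

lemma enc_gate_split: "enc_gate g @ r = enc_gate g' @ r' \<Longrightarrow> g = g' \<and> r = r'"
  by (cases g; cases g') (auto dest!: bin_split)

lemma enc_gate_ne: "enc_gate g \<noteq> []"
  by (cases g) auto

text \<open>Comparison of numerals: 0, 1, 2 stand for equal, less, greater.\<close>

fun cmpl :: "nat \<Rightarrow> sym list \<Rightarrow> sym list \<Rightarrow> nat" where
  "cmpl c [] v = c"
| "cmpl c (a # u) [] = cmpl 2 u []"
| "cmpl c (a # u) (b # v) = cmpl (if c \<noteq> 0 then c else if a = b then 0 else if a = S1 then 2 else 1) u v"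

definition cmpf :: "sym list \<Rightarrow> sym list \<Rightarrow> nat" where
  "cmpf u v = (if length u < length v then 1 else cmpl 0 u v)"

lemma cmpl_2_Nil: "cmpl 2 u [] = 2"
  by (induction u) auto

lemma cmpl_long: "length v < length u \<Longrightarrow> cmpl c u v = 2"
  by (induction c u v rule: cmpl.induct) (auto simp: cmpl_2_Nil)

lemma cmpl_eq: "length u = length v \<Longrightarrow> cmpl c u v = 0 \<longleftrightarrow> c = 0 \<and> u = v"
  by (induction c u v rule: cmpl.induct) auto

text \<open>A tail of length \<open>l\<close> is worth less than \<open>2 ^ l\<close>, so the first
  differing digit decides, and \<open>c\<close> remembers that decision.\<close>

lemma cmpl_le:
  assumes "length u = length v" "SHash \<notin> set u" "SHash \<notin> set v" "c \<le> 2"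
  shows "cmpl c u v \<le> 2 \<and> (cmpl c u v \<noteq> 2 \<longleftrightarrow> c = 1 \<or> c = 0 \<and> bval u \<le> bval v)"
  using assms
proof (induction c u v rule: cmpl.induct)
  case (3 c a u b v)
  define d where "d = (if c \<noteq> 0 then c else if a = b then 0 else if a = S1 then 2 else 1)"
  note IH0 = 3(1)[folded d_def]
  note p = 3(2-5)
  have ab: "a \<noteq> SHash" "b \<noteq> SHash" "length u = length v" "SHash \<notin> set u" "SHash \<notin> set v" using p by auto
  have "d \<le> 2" using p(4) by (simp add: d_def)
  then have IH: "cmpl d u v \<le> 2 \<and> (cmpl d u v \<noteq> 2 \<longleftrightarrow> d = 1 \<or> d = 0 \<and> bval u \<le> bval v)"
    using IH0 ab by blast
  have lt: "bval u < 2 ^ length v" "bval v < 2 ^ length v" using bval_lt[of u] bval_lt[of v] ab by auto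
  have e: "cmpl c (a # u) (b # v) = cmpl d u v" by (simp add: d_def)
  have "d = 1 \<or> d = 0 \<and> bval u \<le> bval v \<longleftrightarrow> c = 1 \<or> c = 0 \<and> bval (a # u) \<le> bval (b # v)"
    using lt ab by (cases "c = 0"; cases a; cases b) (simp_all add: d_def)
  then show ?case unfolding e using IH by blast
qed auto

lemma bin_len_less: "length (bin p) < length (bin q) \<Longrightarrow> p < q" if "q \<ge> 1"
proof -
  assume l: "length (bin p) < length (bin q)"
  have "isnum (bin q)" using that isnum_iff by blast
  then obtain v where v: "bin q = S1 # v" unfolding isnum_def by blast
  have "p < 2 ^ length (bin p)" using bval_lt[of "bin p"] bin_props by simp
  also have "\<dots> \<le> 2 ^ length v" using l v by (intro power_increasing) auto
  also have "\<dots> \<le> bval (bin q)" by (simp add: v)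
  finally show "p < q" using bin_props by simp
qed

lemma cmpf_bin:
  assumes "p \<ge> 1" "q \<ge> 1"
  shows "cmpf (bin p) (bin q) \<le> 2" "cmpf (bin p) (bin q) = 0 \<longleftrightarrow> p = q" "cmpf (bin p) (bin q) = 2 \<longleftrightarrow> \<not> p \<le> q"
proof -
  have inj: "bin p = bin q \<longleftrightarrow> p = q" using bin_props by metis
  consider "length (bin p) < length (bin q)" | "length (bin q) < length (bin p)" | "length (bin p) = length (bin q)"
    by linarith
  then have "cmpf (bin p) (bin q) \<le> 2 \<and> (cmpf (bin p) (bin q) = 0 \<longleftrightarrow> p = q) \<and> (cmpf (bin p) (bin q) = 2 \<longleftrightarrow> \<not> p \<le> q)"
  proof cases
    case 1
    then show ?thesis using bin_len_less[OF assms(2) 1] by (simp add: cmpf_def)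
  next
    case 2
    then show ?thesis using bin_len_less[OF assms(1) 2] by (simp add: cmpf_def cmpl_long)
  next
    case 3
    then show ?thesis
      using cmpl_eq[OF 3, of 0] cmpl_le[OF 3, of 0] inj bin_props[of p] bin_props[of q] by (auto simp: cmpf_def)
  qed
  then show "cmpf (bin p) (bin q) \<le> 2" "cmpf (bin p) (bin q) = 0 \<longleftrightarrow> p = q" "cmpf (bin p) (bin q) = 2 \<longleftrightarrow> \<not> p \<le> q"
    by auto
qed

lemma drop_Cons_len: "drop (length (a # u)) (b # v) = drop (length u) v"
  by simp

declare OPS.simps [simp del] fun_upd_apply [simp del] fun_upd_other [simp] fun_upd_same [simp] One_nat_def [simp del] One_nat_def [symmetric, simp]

context prog
begin

lemma run_BR_T: "\<sigma> 0 = 0 \<Longrightarrow> P (read_in x (\<sigma> r)) \<Longrightarrow> run a \<sigma> \<Omega> os \<Longrightarrow> run (BR r P a b) \<sigma> \<Omega> os"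
  by (rule run_BR) auto

lemma run_BR_F: "\<sigma> 0 = 0 \<Longrightarrow> \<not> P (read_in x (\<sigma> r)) \<Longrightarrow> run b \<sigma> \<Omega> os \<Longrightarrow> run (BR r P a b) \<sigma> \<Omega> os"
  by (rule run_BR) auto

lemma run_chk:
  "\<sigma> 0 = 0 \<Longrightarrow> P (read_in x (\<sigma> r)) \<Longrightarrow> run c \<sigma> \<Omega> os \<Longrightarrow> run (BR r P Skip Fail ;; c) \<sigma> \<Omega> os"
  by (rule run_seq[OF run_BR_T[OF _ _ run_Skip]])

lemma run_chkops:
  "\<sigma> 0 = 0 \<Longrightarrow> P (read_in x (\<sigma> r)) \<Longrightarrow> okops (2 ^ B) ps \<sigma> \<Longrightarrow> run c (evops ps \<sigma>) \<Omega> os \<Longrightarrow>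
   run (BR r P (OPS ps) Fail ;; c) \<sigma> \<Omega> os"
  by (rule run_seq[OF run_BR_T[OF _ _ run_OPS]])

lemma run_chk_fail:
  "\<sigma> 0 = 0 \<Longrightarrow> \<not> P (read_in x (\<sigma> r)) \<Longrightarrow> run (BR r P a Fail ;; c) \<sigma> [] []"
  by (rule run_seq_fail[OF run_BR_F[OF _ _ run_Fail]])

lemma run_IFNZ_T: "\<sigma> r \<noteq> 0 \<Longrightarrow> run a \<sigma> \<Omega> os \<Longrightarrow> run (IFNZ r a b) \<sigma> \<Omega> os"
  by (rule run_IFNZ) auto

lemma run_IFNZ_F: "\<sigma> r = 0 \<Longrightarrow> run b \<sigma> \<Omega> os \<Longrightarrow> run (IFNZ r a b) \<sigma> \<Omega> os"
  by (rule run_IFNZ) auto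

lemma run_WHR_T: "\<sigma> 0 = 0 \<Longrightarrow> P (read_in x (\<sigma> r)) \<Longrightarrow> run (a ;; WHR r P a) \<sigma> \<Omega> os \<Longrightarrow> run (WHR r P a) \<sigma> \<Omega> os"
  by (rule run_WHR) auto

lemma run_WHR_F: "\<sigma> 0 = 0 \<Longrightarrow> \<not> P (read_in x (\<sigma> r)) \<Longrightarrow> \<Omega> = [\<sigma>] \<Longrightarrow> run (WHR r P a) \<sigma> \<Omega> []"
  by (rule run_WHR) (auto simp: run_Skip)

end

definition "isS0 c \<longleftrightarrow> c = Sym S0"
definition "isS1 c \<longleftrightarrow> c = Sym S1"
definition "isH c \<longleftrightarrow> c = Sym SHash"
definition "isbit c \<longleftrightarrow> c = Sym S0 \<or> c = Sym S1"
definition "nend c \<longleftrightarrow> c \<noteq> REnd"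

lemmas cell_defs = isS0_def isS1_def isH_def isbit_def nend_def

section \<open>The recognizer for GK\<close>

text \<open>Register conventions: 0 belongs to \<open>GOTO\<close>; 1 points to the current gate and 2 one symbol further; 3 and 4 point to
  its operands (equal for one-qubit gates) and 5 behind it; 6, 7 and 8 belong to \<open>CMP\<close>; 10 points to the qubit of a walk
  and 11 tells its kind; 12, 14 and 15 save 5, 3 and 4 during a walk; 13 points to the first gate, 16 to \<open>n\<close>;
  17 and 18 hold the mode of the sign computation.\<close>

definition "PNUM = BR 5 isS1 Skip Fail ;; WHR 5 isbit (OPS [I 5]) ;; BR 5 isH (OPS [I 5]) Fail"

definition "PARSE = BR 1 isbit Skip Fail ;; OPS [C 2 1, I 2] ;; BR 2 isbit Skip Fail ;; OPS [C 5 2, I 5] ;;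
  BR 5 isH (OPS [I 5, C 3 5]) Fail ;; PNUM ;; OPS [C 4 3] ;; BR 1 isS0 (BR 2 isS0 (OPS [C 4 5] ;; PNUM) Skip) Skip"

text \<open>Computes \<open>cmpf\<close> into register 8. If the second numeral ends first, each
  remaining digit forces the result 2; if the first one ends first, the final test on register 7
  overrides the result by 1.\<close>

definition "CMP = OPS [Z 8] ;; WHR 6 isbit (BR 7 isbit
    (IFNZ 8 Skip (BR 6 isS1 (BR 7 isS1 Skip (OPS [I 8, I 8])) (BR 7 isS1 (OPS [I 8]) Skip)) ;; OPS [I 6, I 7])
    (OPS [Z 8, I 8, I 8, I 6])) ;; BR 7 isbit (OPS [Z 8, I 8]) Skip ;; OPS [Z 6, Z 7]"

section \<open>Pointers into the input, parsing and comparison\<close>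

locale rec = prog x B True for x B +
  assumes big: "length x + 2 < 2 ^ B"
begin

text \<open>A position is identified with the suffix of the input that begins there, so that parsing
  becomes reasoning about lists.\<close>

definition suf :: "sym list \<Rightarrow> bool" where "suf l \<longleftrightarrow> (\<exists>pre. x = pre @ l)"
definition pos :: "sym list \<Rightarrow> nat" where "pos l = Suc (length x) - length l"

lemma suf_x: "suf x" "pos x = 1"
  by (auto simp: suf_def pos_def)

lemma suf_app: "suf (u @ l) \<Longrightarrow> suf l"
  unfolding suf_def by (metis append.assoc)

lemma suf_Cons: "suf (s # l) \<Longrightarrow> suf l"
  using suf_app[of "[s]" l] by simp

lemma read_Cons: "suf (s # l) \<Longrightarrow> read_in x (pos (s # l)) = Sym s"
  by (auto simp: suf_def read_in_def pos_def)

lemma pos_Cons: "suf (s # l) \<Longrightarrow> Suc (pos (s # l)) = pos l"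
  by (auto simp: suf_def pos_def)

lemma read_Nil: "read_in x (pos []) = REnd"
  by (auto simp: read_in_def pos_def)

lemma pos_big: "Suc (pos l) < 2 ^ B"
  using big by (auto simp: pos_def)

lemma pos_big0: "pos l < 2 ^ B" "1 < (2::nat) ^ B" "2 < (2::nat) ^ B"
  using big by (auto simp: pos_def)

lemmas bigs = pos_big pos_big0

text \<open>A register has logarithmically many bits, while a qubit number may have as many digits
  as the input allows. A qubit is therefore represented by any position at which a numeral for it
  starts.\<close>

definition numat :: "nat \<Rightarrow> nat \<Rightarrow> bool" where
  "numat p q \<longleftrightarrow> q \<ge> 1 \<and> (\<exists>r. suf (bin q @ SHash # r) \<and> p = pos (bin q @ SHash # r))"

lemma run_scan_bits:
  assumes "SHash \<notin> set v" "r = [] \<or> (\<exists>r'. r = SHash # r')" "suf (v @ r)" "\<sigma> 0 = 0" "\<sigma> 5 = pos (v @ r)"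
  shows "run (WHR 5 isbit (OPS [I 5])) \<sigma> [\<sigma>(5 := pos r)] []"
  using assms
proof (induction v arbitrary: \<sigma>)
  case Nil
  then have "\<not> isbit (read_in x (\<sigma> 5))" using read_Nil read_Cons[of SHash] by (auto simp: cell_defs)
  then show ?case using Nil by (intro run_WHR_F) (auto simp: fun_upd_idem)
next
  case (Cons a v)
  have r: "read_in x (\<sigma> 5) = Sym a" using Cons.prems read_Cons by auto
  have b: "isbit (read_in x (\<sigma> 5))" using r Cons.prems by (cases a) (auto simp: cell_defs)
  have n: "Suc (\<sigma> 5) = pos (v @ r)" "suf (v @ r)" using Cons.prems pos_Cons[of a "v @ r"] suf_Cons[of a "v @ r"] by auto
  have "run (WHR 5 isbit (OPS [I 5])) (\<sigma>(5 := pos (v @ r))) [\<sigma>(5 := pos (v @ r), 5 := pos r)] []"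
    using Cons n by (intro Cons.IH) auto
  then have "run (OPS [I 5] ;; WHR 5 isbit (OPS [I 5])) \<sigma> [\<sigma>(5 := pos r)] []"
    using n by (intro run_OPS_seq) (simp_all add: bigs)
  then show ?case using b Cons.prems by (intro run_WHR_T)
qed

text \<open>The second alternative matters as much as the first: a malformed numeral leaves no
  surviving branch, and an empty count is even, hence a rejection.\<close>

lemma run_PNUM:
  assumes "suf l" "\<sigma> 0 = 0" "\<sigma> 5 = pos l"
  shows "(\<exists>q r. q \<ge> 1 \<and> l = bin q @ SHash # r \<and> suf r \<and> numat (pos l) q \<and> run PNUM \<sigma> [\<sigma>(5 := pos r)] []) \<or>
    ((\<nexists>q r. q \<ge> 1 \<and> l = bin q @ SHash # r) \<and> run PNUM \<sigma> [] [])"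
proof (cases "\<exists>l'. l = S1 # l'")
  case False
  have "\<not> isS1 (read_in x (\<sigma> 5))"
    using False assms read_Nil read_Cons by (cases l) (auto simp: cell_defs)
  then have "run PNUM \<sigma> [] []" unfolding PNUM_def
    using assms(2) by (intro run_chk_fail)
  moreover have "\<nexists>q r. q \<ge> 1 \<and> l = bin q @ SHash # r"
  proof clarify
    fix q r assume "1 \<le> q" "l = bin q @ SHash # r"
    then show False using False bin_props[of q] by (cases "bin q") auto
  qed
  ultimately show ?thesis by blast
next
  case True
  then have 1: "isS1 (read_in x (\<sigma> 5))" using assms read_Cons by (auto simp: cell_defs)
  define v where "v = takeWhile (\<lambda>s. s \<noteq> SHash) l"
  define r where "r = dropWhile (\<lambda>s. s \<noteq> SHash) l"
  have l: "l = v @ r" by (simp add: v_def r_def)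
  have v: "SHash \<notin> set v" unfolding v_def by (auto dest: set_takeWhileD)
  have r: "r = [] \<or> (\<exists>r'. r = SHash # r')" unfolding r_def
    by (metis (mono_tags, lifting) hd_dropWhile list.exhaust_sel)
  obtain l' where l': "l = S1 # l'" using True by blast
  have "v = S1 # takeWhile (\<lambda>s. s \<noteq> SHash) l'" by (simp add: v_def l')
  then have nv: "isnum v" using v unfolding isnum_def by (metis list.set_intros(2))
  have run1: "run (WHR 5 isbit (OPS [I 5])) \<sigma> [\<sigma>(5 := pos r)] []"
    using run_scan_bits[OF v r] assms l by simp
  have sr: "suf r" using assms(1) l suf_app[of v r] by simp
  show ?thesis
  proof (cases r)
    case Nil
    have "\<not> isH (read_in x (pos r))" using Nil read_Nil by (simp add: cell_defs)
    then have "run (BR 5 isH (OPS [I 5]) Fail) (\<sigma>(5 := pos r)) [] []"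
      using assms(2) by (intro run_BR_F) (simp_all add: run_Fail)
    then have "run PNUM \<sigma> [] []" unfolding PNUM_def by (intro run_chk[where \<sigma> = \<sigma> and P = isS1 and r = 5, OF assms(2) 1] run_seq[OF run1])
    moreover have "SHash \<notin> set l" using l v Nil by simp
    then have "\<nexists>q r. q \<ge> 1 \<and> l = bin q @ SHash # r" by (metis in_set_conv_decomp)
    ultimately show ?thesis by blast
  next
    case (Cons a r')
    then have a: "a = SHash" using r by auto
    obtain q where q: "q \<ge> 1" "v = bin q" using nv isnum_iff by auto
    have ll: "l = bin q @ SHash # r'" using l Cons a q by simp
    have "run (BR 5 isH (OPS [I 5]) Fail) (\<sigma>(5 := pos r)) [\<sigma>(5 := pos r')] []"
      using read_Cons[of SHash r'] sr pos_Cons[of SHash r'] Cons a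
      by (intro run_BR_T run_OPS_eq) (simp_all add: assms cell_defs bigs)
    then have "run PNUM \<sigma> [\<sigma>(5 := pos r')] []" unfolding PNUM_def
      using assms(2) by (intro run_chk[where \<sigma> = \<sigma> and P = isS1 and r = 5, OF assms(2) 1] run_seq[OF run1])
    moreover have "numat (pos l) q" unfolding numat_def using q ll assms(1) by auto
    moreover have "suf r'" using sr Cons suf_Cons by auto
    ultimately show ?thesis using q ll by blast
  qed
qed

definition opA :: "gate \<Rightarrow> nat" where "opA g = hd (operands g)"
definition opB :: "gate \<Rightarrow> nat" where "opB g = last (operands g)"

lemma run_PARSE:
  assumes "suf l" "\<sigma> 0 = 0" "\<sigma> 1 = pos l"
  shows "(\<exists>g r A Bp. l = enc_gate g @ r \<and> posg g \<and> suf r \<and> numat A (opA g) \<and> numat Bp (opB g) \<and>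
      run PARSE \<sigma> [\<sigma>(2 := Suc (pos l), 3 := A, 4 := Bp, 5 := pos r)] []) \<or>
    ((\<nexists>g r. posg g \<and> l = enc_gate g @ r) \<and> run PARSE \<sigma> [] [])"
proof (cases "\<exists>t1 t2 l1. l = t1 # t2 # SHash # l1 \<and> t1 \<noteq> SHash \<and> t2 \<noteq> SHash")
  case False
  have "l \<noteq> enc_gate g @ r" for g r using False by (cases g) auto
  moreover have "run PARSE \<sigma> [] []"
  proof (cases "isbit (read_in x (\<sigma> 1))")
    case f: False
    then show ?thesis unfolding PARSE_def using assms(2) by (intro run_chk_fail)
  next
    case b1: True
    then obtain t1 l2 where l2: "l = t1 # l2" "t1 \<noteq> SHash"
      using assms read_Nil read_Cons by (cases l) (auto simp: cell_defs)
    have s2: "suf l2" "Suc (\<sigma> 1) = pos l2" using assms l2 suf_Cons pos_Cons by auto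
    let ?s2 = "\<sigma>(2 := pos l2)"
    have "run (BR 2 isbit Skip Fail ;; OPS [C 5 2, I 5] ;; BR 5 isH (OPS [I 5, C 3 5]) Fail ;; PNUM ;; OPS [C 4 3] ;;
      BR 1 isS0 (BR 2 isS0 (OPS [C 4 5] ;; PNUM) Skip) Skip) ?s2 [] []"
    proof (cases "isbit (read_in x (pos l2))")
      case f: False
      then show ?thesis by (intro run_chk_fail) (simp_all add: assms)
    next
      case b2: True
      then obtain t2 l3 where l3: "l2 = t2 # l3" "t2 \<noteq> SHash"
        using read_Nil read_Cons s2 by (cases l2) (auto simp: cell_defs)
      have s3: "suf l3" "Suc (pos l2) = pos l3" using l3 s2 suf_Cons pos_Cons by auto
      have "\<not> isH (read_in x (pos l3))"
        using False l2 l3 read_Nil read_Cons s3 by (cases l3) (auto simp: cell_defs)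
      then have "run (BR 5 isH (OPS [I 5, C 3 5]) Fail ;; PNUM ;; OPS [C 4 3] ;;
        BR 1 isS0 (BR 2 isS0 (OPS [C 4 5] ;; PNUM) Skip) Skip) (?s2(5 := pos l3)) [] []"
        by (intro run_chk_fail) (simp_all add: assms)
      then show ?thesis using b2
        by (intro run_chk[OF _ _ run_OPS_seq] run_OPS_seq) (simp_all add: assms bigs s3)
    qed
    then show ?thesis unfolding PARSE_def using b1
      by - (rule run_chk[OF _ _ run_OPS_seq], simp_all add: assms(2) bigs s2 pos_big0)
  qed
  ultimately show ?thesis by blast
next
  case True
  then obtain t1 t2 l1 where l: "l = t1 # t2 # SHash # l1" "t1 \<noteq> SHash" "t2 \<noteq> SHash" by blast
  let ?p = "pos l"
  have s: "suf (t2 # SHash # l1)" "suf (SHash # l1)" "suf l1" using assms l suf_Cons by blast+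
  have p: "Suc (pos l) = pos (t2 # SHash # l1)" "Suc (pos (t2 # SHash # l1)) = pos (SHash # l1)" "Suc (pos (SHash # l1)) = pos l1"
    using pos_Cons s assms l by auto
  have rd: "read_in x ?p = Sym t1" "read_in x (Suc ?p) = Sym t2" "read_in x (pos (SHash # l1)) = Sym SHash"
    using read_Cons s assms l p by auto
  have bit: "isbit (Sym t1)" "isbit (Sym t2)" using l by (cases t1; cases t2; simp add: cell_defs)+
  let ?s = "\<sigma>(2 := Suc ?p, 5 := pos l1, 3 := pos l1)"
  let ?rest = "OPS [C 4 3] ;; BR 1 isS0 (BR 2 isS0 (OPS [C 4 5] ;; PNUM) Skip) Skip"
  have pre: "run PARSE \<sigma> \<Omega> []" if "run (PNUM ;; ?rest) ?s \<Omega> []" for \<Omega>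
  proof -
    have "run (BR 5 isH (OPS [I 5, C 3 5]) Fail) (\<sigma>(2 := Suc ?p, 5 := pos (SHash # l1))) [?s] []"
      by (intro run_BR_T run_OPS_eq) (simp_all add: assms rd cell_defs bigs p)
    then have "run (BR 5 isH (OPS [I 5, C 3 5]) Fail ;; PNUM ;; ?rest) (\<sigma>(2 := Suc ?p, 5 := pos (SHash # l1))) \<Omega> []"
      using that run_seq by blast
    then show ?thesis unfolding PARSE_def
      by (intro run_chk run_OPS_seq) (simp_all add: assms rd rd[unfolded p] bit bigs p)
  qed
  from run_PNUM[of l1 ?s] s assms
  consider (ok) q r where "q \<ge> 1" "l1 = bin q @ SHash # r" "suf r" "numat (pos l1) q" "run PNUM ?s [?s(5 := pos r)] []"
    | (bad) "\<nexists>q r. q \<ge> 1 \<and> l1 = bin q @ SHash # r" "run PNUM ?s [] []" by auto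
  then show ?thesis
  proof cases
    case bad
    have "l \<noteq> enc_gate g @ r" if "posg g" for g r
    proof
      assume e: "l = enc_gate g @ r"
      then have "\<exists>r'. l1 = bin (opA g) @ SHash # r'" using l by (cases g) (auto simp: opA_def)
      moreover have "opA g \<ge> 1" using that by (cases g) (auto simp: opA_def posg_def)
      ultimately show False using bad by blast
    qed
    moreover have "run PARSE \<sigma> [] []" by (rule pre, rule run_seq_fail, rule bad)
    ultimately show ?thesis by blast
  next
    case ok
    let ?s1 = "\<sigma>(2 := Suc ?p, 3 := pos l1, 4 := pos l1, 5 := pos r)"
    have e1: "evops [C 4 3] (?s(5 := pos r)) = ?s1" by (auto simp: fun_eq_iff fun_upd_apply)
    have pre1: "run PARSE \<sigma> \<Omega> []" if "run (BR 1 isS0 (BR 2 isS0 (OPS [C 4 5] ;; PNUM) Skip) Skip) ?s1 \<Omega> []" for \<Omega>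
      by (rule pre, rule run_seq[OF ok(5)], rule run_OPS_seq) (use that e1 in simp_all)
    show ?thesis
    proof (cases "t1 = S0 \<and> t2 = S0")
      case False
      obtain g where g: "l = enc_gate g @ r" "operands g = [q]"
      proof -
        have "t1 = S0 \<and> t2 = S1 \<or> t1 = S1 \<and> t2 = S0 \<or> t1 = S1 \<and> t2 = S1" using False l by (cases t1; cases t2; simp)
        then show thesis using that[of "Hadamard q"] that[of "Phase q"] that[of "Measure q"] l ok(2) by auto
      qed
      have "run (BR 1 isS0 (BR 2 isS0 (OPS [C 4 5] ;; PNUM) Skip) Skip) ?s1 [?s1] []"
        using False rd by (intro run_BR) (auto intro!: run_BR_F simp: assms cell_defs run_Skip)
      from pre1[OF this] show ?thesis using g(2) ok
        by (intro disjI1 exI[of _ g] exI[of _ r] exI[of _ "pos l1"] conjI g(1)) (simp_all add: posg_def opA_def opB_def)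
    next
      case True
      let ?s2 = "\<sigma>(2 := Suc ?p, 3 := pos l1, 4 := pos r, 5 := pos r)"
      have e2: "evops [C 4 5] ?s1 = ?s2" by (auto simp: fun_eq_iff fun_upd_apply)
      have pre2: "run PARSE \<sigma> \<Omega> []" if "run PNUM ?s2 \<Omega> []" for \<Omega>
      proof (rule pre1)
        have "run (OPS [C 4 5] ;; PNUM) ?s1 \<Omega> []" by (rule run_OPS_seq) (use e2 that in simp_all)
        then show "run (BR 1 isS0 (BR 2 isS0 (OPS [C 4 5] ;; PNUM) Skip) Skip) ?s1 \<Omega> []"
          using True rd by (intro run_BR_T) (simp_all add: assms cell_defs)
      qed
      from run_PNUM[of r ?s2] ok assms
      consider (ok2) q' r' where "q' \<ge> 1" "r = bin q' @ SHash # r'" "suf r'" "numat (pos r) q'" "run PNUM ?s2 [?s2(5 := pos r')] []"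
        | (bad2) "\<nexists>q r'. q \<ge> 1 \<and> r = bin q @ SHash # r'" "run PNUM ?s2 [] []" by auto
      then show ?thesis
      proof cases
        case ok2
        have g: "l = enc_gate (CNOT q q') @ r'" using l True ok(2) ok2(2) by simp
        have "run PARSE \<sigma> [?s2(5 := pos r')] []" by (rule pre2, rule ok2)
        then show ?thesis using g ok ok2
          by (intro disjI1 exI[of _ "CNOT q q'"] exI[of _ r'] exI[of _ "pos l1"] exI[of _ "pos r"])
            (auto simp: posg_def opA_def opB_def)
      next
        case bad2
        have "l \<noteq> enc_gate g @ r'" if "posg g" for g r'
        proof
          assume e: "l = enc_gate g @ r'"
          then obtain a b where g: "g = CNOT a b" using l True by (cases g) auto
          then have "l1 = bin a @ SHash # bin b @ SHash # r'" using e l by simp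
          then have "r = bin b @ SHash # r'" using ok(2) bin_split by metis
          then show False using bad2 that g by (auto simp: posg_def)
        qed
        moreover have "run PARSE \<sigma> [] []" by (rule pre2, rule bad2)
        ultimately show ?thesis by blast
      qed
    qed
  qed
qed

lemma run_PARSE_ok:
  assumes "suf (enc_gate g @ r)" "posg g" "\<sigma> 0 = 0" "\<sigma> 1 = pos (enc_gate g @ r)"
  obtains A Bp where "numat A (opA g)" "numat Bp (opB g)"
    "run PARSE \<sigma> [\<sigma>(2 := Suc (pos (enc_gate g @ r)), 3 := A, 4 := Bp, 5 := pos r)] []"
  using run_PARSE[of "enc_gate g @ r" \<sigma>] assms enc_gate_split[of g r] by blast

lemma suf_len: "suf l \<Longrightarrow> length l \<le> length x"
  by (auto simp: suf_def)

lemma suf_eq: "suf l \<Longrightarrow> suf l' \<Longrightarrow> pos l = pos l' \<Longrightarrow> l = l'"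
proof -
  assume s: "suf l" "suf l'" "pos l = pos l'"
  have "length l = length l'" using suf_len[OF s(1)] suf_len[OF s(2)] s(3) unfolding pos_def by linarith
  then show "l = l'" using s(1,2) unfolding suf_def by (metis append_eq_append_conv)
qed

lemma numat_unique: "numat p q \<Longrightarrow> numat p q' \<Longrightarrow> q = q'"
proof -
  assume "numat p q" "numat p q'"
  then have "bin q @ SHash # r = bin q' @ SHash # r'" if "suf (bin q @ SHash # r)" "p = pos (bin q @ SHash # r)"
      "suf (bin q' @ SHash # r')" "p = pos (bin q' @ SHash # r')" for r r'
    using that suf_eq by metis
  then show "q = q'" using \<open>numat p q\<close> \<open>numat p q'\<close> bin_split unfolding numat_def by metis
qed

definition nm :: "nat \<Rightarrow> nat" where "nm p = (THE q. numat p q)"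

lemma nm_eq: "numat p q \<Longrightarrow> nm p = q"
  unfolding nm_def using numat_unique by blast

definition "CMPB = BR 7 isbit
    (IFNZ 8 Skip (BR 6 isS1 (BR 7 isS1 Skip (OPS [I 8, I 8])) (BR 7 isS1 (OPS [I 8]) Skip)) ;; OPS [I 6, I 7])
    (OPS [Z 8, I 8, I 8, I 6])"

lemma run_CMP_loop:
  assumes "SHash \<notin> set u" "SHash \<notin> set v" "suf (u @ SHash # r1)" "suf (v @ SHash # r2)" "\<sigma> 0 = 0"
    "\<sigma> 6 = pos (u @ SHash # r1)" "\<sigma> 7 = pos (v @ SHash # r2)" "\<sigma> 8 = c"
  shows "run (WHR 6 isbit CMPB) \<sigma>
    [\<sigma>(6 := pos (SHash # r1), 7 := pos (drop (length u) v @ SHash # r2), 8 := cmpl c u v)] []"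
  using assms
proof (induction c u v arbitrary: \<sigma> rule: cmpl.induct)
  case (1 c v)
  have "\<not> isbit (read_in x (\<sigma> 6))" using 1 read_Cons by (simp add: cell_defs)
  then show ?case using 1 by (intro run_WHR_F) (auto simp: fun_eq_iff fun_upd_apply)
next
  case (2 c a u)
  have s: "suf (u @ SHash # r1)" "Suc (\<sigma> 6) = pos (u @ SHash # r1)"
    using "2.prems" suf_Cons[of a] pos_Cons[of a "u @ SHash # r1"] by auto
  have rd: "read_in x (\<sigma> 6) = Sym a" "read_in x (\<sigma> 7) = Sym SHash" using "2.prems" read_Cons by auto
  have b: "isbit (read_in x (\<sigma> 6))" using rd "2.prems" by (cases a) (auto simp: cell_defs)
  let ?s = "\<sigma>(8 := 2, 6 := pos (u @ SHash # r1))"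
  have "run (WHR 6 isbit CMPB) ?s [?s(6 := pos (SHash # r1), 7 := pos (drop (length u) [] @ SHash # r2), 8 := cmpl 2 u [])] []"
    by (rule 2(1)) (use "2.prems" s in simp_all)
  moreover have "run CMPB \<sigma> [?s] []"
    unfolding CMPB_def using "2.prems" rd s
    by (intro run_BR_F run_OPS_eq) (simp_all add: cell_defs bigs)
  ultimately have "run (CMPB ;; WHR 6 isbit CMPB) \<sigma>
      [?s(6 := pos (SHash # r1), 7 := pos (drop (length u) [] @ SHash # r2), 8 := cmpl 2 u [])] []"
    by (rule run_seq[rotated])
  then have "run (CMPB ;; WHR 6 isbit CMPB) \<sigma>
      [\<sigma>(6 := pos (SHash # r1), 7 := pos (drop (length (a # u)) [] @ SHash # r2), 8 := cmpl c (a # u) [])] []"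
    by (rule run_eq) (auto simp: fun_eq_iff fun_upd_apply)
  moreover have "\<sigma> 0 = 0" using "2.prems" by simp
  ultimately show ?case using b by - (rule run_WHR_T)
next
  case (3 c a u b v)
  define d where "d = (if c \<noteq> 0 then c else if a = b then 0 else if a = S1 then 2 else 1)"
  have s: "suf (u @ SHash # r1)" "Suc (\<sigma> 6) = pos (u @ SHash # r1)" "suf (v @ SHash # r2)" "Suc (\<sigma> 7) = pos (v @ SHash # r2)"
    using "3.prems" suf_Cons[of a "u @ SHash # r1"] pos_Cons[of a "u @ SHash # r1"] suf_Cons[of b "v @ SHash # r2"] pos_Cons[of b "v @ SHash # r2"]
    by simp_all
  have rd: "read_in x (\<sigma> 6) = Sym a" "read_in x (\<sigma> 7) = Sym b" using "3.prems" read_Cons[of a "u @ SHash # r1"] read_Cons[of b "v @ SHash # r2"] by simp_all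
  have bt: "isbit (read_in x (\<sigma> 6))" "isbit (read_in x (\<sigma> 7))" using rd "3.prems" by (cases a; cases b; auto simp: cell_defs)+
  let ?s = "\<sigma>(8 := d, 6 := pos (u @ SHash # r1), 7 := pos (v @ SHash # r2))"
  have r1: "run (WHR 6 isbit CMPB) ?s [?s(6 := pos (SHash # r1), 7 := pos (drop (length u) v @ SHash # r2), 8 := cmpl d u v)] []"
    unfolding d_def by (rule 3(1)) (use "3.prems" s in simp_all)
  have ab: "a = S0 \<or> a = S1" "b = S0 \<or> b = S1" using "3.prems" by (cases a; cases b; simp)+
  have "run (IFNZ 8 Skip (BR 6 isS1 (BR 7 isS1 Skip (OPS [I 8, I 8])) (BR 7 isS1 (OPS [I 8]) Skip))) \<sigma> [\<sigma>(8 := d)] []"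
  proof (cases "c = 0")
    case False
    then show ?thesis using "3.prems" by (intro run_IFNZ_T) (auto simp: d_def run_Skip fun_upd_idem)
  next
    case True
    have sk: "run Skip \<sigma> [\<sigma>(8 := 0)] []" using True "3.prems" run_Skip[of \<sigma>] by (simp add: fun_upd_idem)
    have inc: "run (OPS [I 8]) \<sigma> [\<sigma>(8 := 1)] []" "run (OPS [I 8, I 8]) \<sigma> [\<sigma>(8 := 2)] []"
      using True "3.prems" by (intro run_OPS_eq; simp add: bigs)+
    have z: "\<sigma> 0 = 0" "\<sigma> 8 = 0" using "3.prems" True by simp_all
    have "run (BR 7 isS1 Skip (OPS [I 8, I 8])) \<sigma> [\<sigma>(8 := if b = S1 then 0 else 2)] []"
      by (rule run_BR) (use z sk inc rd in \<open>simp_all add: cell_defs\<close>)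
    moreover have "run (BR 7 isS1 (OPS [I 8]) Skip) \<sigma> [\<sigma>(8 := if b = S1 then 1 else 0)] []"
      by (rule run_BR) (use z sk inc rd in \<open>simp_all add: cell_defs\<close>)
    ultimately have "run (BR 6 isS1 (BR 7 isS1 Skip (OPS [I 8, I 8])) (BR 7 isS1 (OPS [I 8]) Skip)) \<sigma> [\<sigma>(8 := d)] []"
      by - (rule run_BR, rule z, use rd ab True in \<open>cases a; cases b; simp add: cell_defs d_def\<close>)
    then show ?thesis using z(2) by - (rule run_IFNZ_F)
  qed
  moreover have "run (OPS [I 6, I 7]) (\<sigma>(8 := d)) [?s] []"
    using s by (intro run_OPS_eq) (simp_all add: bigs)
  ultimately have "run CMPB \<sigma> [?s] []" unfolding CMPB_def using "3.prems" bt by (intro run_BR_T) (auto intro: run_seq)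
  then have "run (CMPB ;; WHR 6 isbit CMPB) \<sigma>
      [?s(6 := pos (SHash # r1), 7 := pos (drop (length u) v @ SHash # r2), 8 := cmpl d u v)] []"
    using r1 by (rule run_seq)
  then have "run (CMPB ;; WHR 6 isbit CMPB) \<sigma>
      [\<sigma>(6 := pos (SHash # r1), 7 := pos (drop (length (a # u)) (b # v) @ SHash # r2), 8 := cmpl c (a # u) (b # v))] []"
    by (rule run_eq, unfold drop_Cons_len) (auto simp: fun_eq_iff fun_upd_apply d_def)
  moreover have "\<sigma> 0 = 0" using "3.prems" by simp
  ultimately show ?case using bt by - (rule run_WHR_T)
qed

lemma run_CMP:
  assumes "numat (\<sigma> 6) p" "numat (\<sigma> 7) q" "\<sigma> 0 = 0"
  shows "run CMP \<sigma> [\<sigma>(6 := 0, 7 := 0, 8 := cmpf (bin p) (bin q))] []"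
proof -
  obtain r1 where r1: "suf (bin p @ SHash # r1)" "\<sigma> 6 = pos (bin p @ SHash # r1)" using assms by (auto simp: numat_def)
  obtain r2 where r2: "suf (bin q @ SHash # r2)" "\<sigma> 7 = pos (bin q @ SHash # r2)" using assms by (auto simp: numat_def)
  let ?d = "drop (length (bin p)) (bin q)"
  let ?s = "\<sigma>(8 := 0, 6 := pos (SHash # r1), 7 := pos (?d @ SHash # r2), 8 := cmpl 0 (bin p) (bin q))"
  have loop: "run (WHR 6 isbit CMPB) (\<sigma>(8 := 0)) [?s] []"
    by (rule run_CMP_loop) (use r1 r2 assms bin_props in auto)
  have sd: "suf (?d @ SHash # r2)"
    using r2(1) suf_app[of "take (length (bin p)) (bin q)" "?d @ SHash # r2"] by (simp flip: append_assoc)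
  have fin: "run (BR 7 isbit (OPS [Z 8, I 8]) Skip ;; OPS [Z 6, Z 7]) ?s [\<sigma>(6 := 0, 7 := 0, 8 := cmpf (bin p) (bin q))] []"
  proof (cases ?d)
    case Nil
    then have "\<not> isbit (read_in x (?s 7))" using sd read_Cons by (simp add: cell_defs)
    then have "run (BR 7 isbit (OPS [Z 8, I 8]) Skip) ?s [?s] []" using assms by (intro run_BR_F) (simp_all add: run_Skip)
    moreover have "run (OPS [Z 6, Z 7]) ?s [\<sigma>(6 := 0, 7 := 0, 8 := cmpf (bin p) (bin q))] []"
      using Nil by (intro run_OPS_eq) (auto simp: cmpf_def fun_eq_iff fun_upd_apply)
    ultimately show ?thesis by (rule run_seq)
  next
    case (Cons a d)
    have "a \<in> set (bin q)" using Cons by (metis in_set_dropD list.set_intros(1))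
    then have "a \<noteq> SHash" using bin_props[of q] by auto
    then have "isbit (read_in x (?s 7))" using Cons sd read_Cons[of a "d @ SHash # r2"] by (cases a) (simp_all add: cell_defs)
    then have "run (BR 7 isbit (OPS [Z 8, I 8]) Skip) ?s [?s(8 := 1)] []" using assms
      by (intro run_BR_T run_OPS_eq) (simp_all add: bigs)
    moreover have "run (OPS [Z 6, Z 7]) (?s(8 := 1)) [\<sigma>(6 := 0, 7 := 0, 8 := cmpf (bin p) (bin q))] []"
    proof (rule run_OPS_eq)
      have "length (bin p) < length (bin q)" using Cons by (metis drop_all linorder_not_less list.distinct(1))
      then show "evops [Z 6, Z 7] (?s(8 := 1)) = \<sigma>(6 := 0, 7 := 0, 8 := cmpf (bin p) (bin q))"
        by (auto simp: cmpf_def fun_eq_iff fun_upd_apply)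
    qed simp
    ultimately show ?thesis by (rule run_seq)
  qed
  show ?thesis unfolding CMP_def CMPB_def[symmetric]
    by (rule run_OPS_seq, simp, rule run_seq[OF _ fin]) (use loop in simp)
qed

end

section \<open>Counting walks\<close>

definition "TYPE4 c1 c2 c3 c4 = BR 1 isS0 (BR 2 isS0 c1 c2) (BR 2 isS0 c3 c4)"
definition "MATCH r c = OPS [C 6 10, C 7 r] ;; CMP ;; IFNZ 8 Skip c"
definition "NXT = OPS [C 1 5, Z 2, Z 3, Z 4, Z 5, Z 8]"
text \<open>The recursion of \<open>cnt\<close> with every \<open>+\<close> turned into a
  \<open>Choice\<close>. Register 11 is 0 for the kind X and 1 for the kind Z.\<close>

definition "WBODY = TYPE4
  (IFNZ 11 (MATCH 3 (Choice Skip (OPS [C 10 4]))) (MATCH 4 (Choice Skip (OPS [C 10 3]))))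
  (MATCH 3 (IFNZ 11 (OPS [Z 11]) (OPS [I 11])))
  (IFNZ 11 (MATCH 3 (Choice Skip (OPS [Z 11]))) Skip)
  Skip"
text \<open>After the last gate only the base case of \<open>cnt\<close> survives: kind Z at qubit
  1, recognized by the numeral \<open>S1\<close> followed directly by \<open>SHash\<close>.\<close>

definition "WALK = WHR 1 nend (PARSE ;; WBODY ;; NXT) ;;
  IFNZ 11 Skip Fail ;; BR 10 isS1 (OPS [I 10]) Fail ;; BR 10 isH Skip Fail ;; OPS [Z 1, Z 10, Z 11]"

context rec
begin

lemma run_TYPE4:
  assumes "suf (enc_gate g @ r)" "\<tau> 0 = 0" "\<tau> 1 = pos (enc_gate g @ r)" "\<tau> 2 = Suc (pos (enc_gate g @ r))"
    "run (case g of CNOT a b \<Rightarrow> c1 | Hadamard a \<Rightarrow> c2 | Phase a \<Rightarrow> c3 | Measure a \<Rightarrow> c4) \<tau> \<Omega> os"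
  shows "run (TYPE4 c1 c2 c3 c4) \<tau> \<Omega> os"
proof -
  obtain t1 t2 l where e: "enc_gate g @ r = t1 # t2 # l" and t: "t1 = S0 \<longleftrightarrow> (\<exists>a b. g = CNOT a b) \<or> (\<exists>a. g = Hadamard a)"
    "t2 = S0 \<longleftrightarrow> (\<exists>a b. g = CNOT a b) \<or> (\<exists>a. g = Phase a)"
    by (cases g) auto
  have rd: "read_in x (\<tau> 1) = Sym t1" "read_in x (\<tau> 2) = Sym t2"
    using read_Cons[of t1 "t2 # l"] read_Cons[of t2 l] suf_Cons[of t1 "t2 # l"] pos_Cons[of t1 "t2 # l"] assms by (auto simp: e)
  show ?thesis
  proof (cases "t1 = S0")
    case True
    have "run (BR 2 isS0 c1 c2) \<tau> \<Omega> os"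
      by (rule run_BR, rule assms(2)) (use assms(5) rd t True in \<open>cases g; simp add: cell_defs\<close>)
    then show ?thesis unfolding TYPE4_def using True rd assms(2) by - (rule run_BR_T, simp_all add: cell_defs)
  next
    case False
    have "run (BR 2 isS0 c3 c4) \<tau> \<Omega> os"
      by (rule run_BR, rule assms(2)) (use assms(5) rd t False in \<open>cases g; simp add: cell_defs\<close>)
    then show ?thesis unfolding TYPE4_def using False rd assms(2) by - (rule run_BR_F, simp_all add: cell_defs)
  qed
qed

text \<open>Register 8 keeps the comparison result \<open>e\<close>, whose nonzero value depends on
  which qubit is larger; the claim is existential in it, and \<open>NXT\<close> erases it.\<close>

lemma run_MATCH:
  assumes "\<tau> 0 = 0" "numat (\<tau> 10) q" "numat (\<tau> r) a" "r \<noteq> 6"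
    and "\<And>e. q \<noteq> a \<Longrightarrow> e \<noteq> 0 \<Longrightarrow> [\<tau>(6 := 0, 7 := 0, 8 := e)] = \<Omega> e"
    and "\<And>e. q = a \<Longrightarrow> run c (\<tau>(6 := 0, 7 := 0, 8 := 0)) (\<Omega> e) []"
  shows "\<exists>e. run (MATCH r c) \<tau> (\<Omega> e) []"
proof -
  let ?e = "cmpf (bin q) (bin a)"
  let ?s = "\<tau>(6 := \<tau> 10, 7 := \<tau> r)"
  have e: "?e = 0 \<longleftrightarrow> q = a" using cmpf_bin assms(2,3) by (auto simp: numat_def)
  have "run CMP ?s [?s(6 := 0, 7 := 0, 8 := ?e)] []"
    by (rule run_CMP) (use assms in simp_all)
  then have r: "run CMP ?s [\<tau>(6 := 0, 7 := 0, 8 := ?e)] []"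
    by (rule run_eq) (auto simp: fun_eq_iff fun_upd_apply)
  have "run (IFNZ 8 Skip c) (\<tau>(6 := 0, 7 := 0, 8 := ?e)) (\<Omega> ?e) []"
  proof (cases "q = a")
    case True
    then show ?thesis using e assms(6)[OF True, of ?e] by (intro run_IFNZ_F) auto
  next
    case False
    then show ?thesis using e assms(5)[OF False, of ?e] run_Skip[of "\<tau>(6 := 0, 7 := 0, 8 := ?e)"]
      by (intro run_IFNZ_T) auto
  qed
  then have "run (MATCH r c) \<tau> (\<Omega> ?e) []"
    unfolding MATCH_def by (intro run_OPS_seq) (use r assms(4) in \<open>auto intro: run_seq\<close>)
  then show ?thesis by blast
qed

lemma run_then_OPS:
  assumes "run c \<tau> \<Omega> []" "\<And>\<sigma>. okops (2 ^ B) ps \<sigma>" shows "run (c ;; OPS ps) \<tau> (map (evops ps) \<Omega>) []"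
proof -
  have "run (c ;; OPS ps) \<tau> (concat (map (\<lambda>s. [evops ps s]) \<Omega>)) ([] @ [])"
    by (rule run_Seq[OF assms(1)]) (rule run_OPS[OF assms(2)])
  moreover have "concat (map (\<lambda>s. [h s]) \<Omega>) = map h \<Omega>" for h :: "(nat \<Rightarrow> nat) \<Rightarrow> nat \<Rightarrow> nat" by (induction \<Omega>) auto
  ultimately show ?thesis by (simp only: append.simps)
qed

lemma run_Choice_Skip: "a \<noteq> Skip \<Longrightarrow> run a \<sigma> \<Omega> [] \<Longrightarrow> run (Choice Skip a) \<sigma> (\<sigma> # \<Omega>) []"
  using run_Choice[OF _ _ run_Skip, of a \<sigma> \<Omega>] by simp

lemma OPS_ne: "OPS (p # ps) \<noteq> Skip" "a ;; b \<noteq> Skip"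
  by (simp_all add: OPS.simps)

text \<open>One gate of a walk. \<open>L\<close> lists the summands in the recursion for
  \<open>cnt\<close> at this gate and does not depend on the remaining circuit.\<close>

lemma run_WBODY:
  assumes z: "\<And>r. r \<le> 11 \<Longrightarrow> \<sigma>0 r = 0" and s: "suf (enc_gate g @ l)" and g: "posg g" and P: "numat P q"
    and A: "numat A (opA g)" and Bp: "numat Bp (opB g)"
  defines "S \<equiv> \<lambda>k' P'. \<sigma>0(1 := pos l, 10 := P', 11 := of_bool k')"
  shows "\<exists>L. run (WBODY ;; NXT) (\<sigma>0(1 := pos (enc_gate g @ l), 10 := P, 11 := of_bool k,
        2 := Suc (pos (enc_gate g @ l)), 3 := A, 4 := Bp, 5 := pos l)) (map (\<lambda>(k', P'). S k' P') L) [] \<and>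
      (\<forall>(k', P') \<in> set L. \<exists>q'. numat P' q') \<and>
      (\<forall>gs. cnt (g # gs) k q = (\<Sum>(k', P') \<leftarrow> L. cnt gs k' (nm P')))"
proof -
  define \<tau> where "\<tau> = \<sigma>0(1 := pos (enc_gate g @ l), 10 := P, 11 := of_bool k,
        2 := Suc (pos (enc_gate g @ l)), 3 := A, 4 := Bp, 5 := pos l)"
  let ?N = "evops [C 1 5, Z 2, Z 3, Z 4, Z 5, Z 8]"
  have z': "\<sigma>0 0 = 0" "\<sigma>0 2 = 0" "\<sigma>0 3 = 0" "\<sigma>0 4 = 0" "\<sigma>0 5 = 0" "\<sigma>0 6 = 0" "\<sigma>0 7 = 0" "\<sigma>0 8 = 0" "\<sigma>0 1 = 0" "\<sigma>0 10 = 0" "\<sigma>0 11 = 0"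
    using z by auto
  have t: "\<tau> 0 = 0" "\<tau> 10 = P" "\<tau> 3 = A" "\<tau> 4 = Bp" "\<tau> 11 = of_bool k" by (simp_all add: \<tau>_def z')
  \<comment> \<open>Whatever \<open>e\<close> is, only the position in the circuit, the qubit and
    the kind survive \<open>NXT\<close>.\<close>
  have N: "?N (\<tau>(6 := 0, 7 := 0, 8 := e)) = S k P" "?N (\<tau>(6 := 0, 7 := 0, 8 := e, 10 := P')) = S k P'"
    "?N (\<tau>(6 := 0, 7 := 0, 8 := e, 11 := of_bool k')) = S k' P" "?N \<tau> = S k P" for e P' k'
    by (auto simp: \<tau>_def S_def fun_eq_iff fun_upd_apply z')
  have fin: "\<exists>L. run (WBODY ;; NXT) \<tau> (map (\<lambda>(k', P'). S k' P') L) [] \<and>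
      (\<forall>(k', P') \<in> set L. \<exists>q'. numat P' q') \<and>
      (\<forall>gs. cnt (g # gs) k q = (\<Sum>(k', P') \<leftarrow> L. cnt gs k' (nm P')))"
    if r: "run WBODY \<tau> \<Omega> []" and L: "map ?N \<Omega> = map (\<lambda>(k', P'). S k' P') L"
      "\<forall>(k', P') \<in> set L. \<exists>q'. numat P' q'" "\<forall>gs. cnt (g # gs) k q = (\<Sum>(k', P') \<leftarrow> L. cnt gs k' (nm P'))" for \<Omega> L
    using run_then_OPS[OF r, of "[C 1 5, Z 2, Z 3, Z 4, Z 5, Z 8]", folded NXT_def] L by (intro exI[of _ L]) simp
  have T: "run WBODY \<tau> \<Omega> []" if "run (case g of
      CNOT a b \<Rightarrow> (IFNZ 11 (MATCH 3 (Choice Skip (OPS [C 10 4]))) (MATCH 4 (Choice Skip (OPS [C 10 3]))))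
    | Hadamard a \<Rightarrow> (MATCH 3 (IFNZ 11 (OPS [Z 11]) (OPS [I 11])))
    | Phase a \<Rightarrow> (IFNZ 11 (MATCH 3 (Choice Skip (OPS [Z 11]))) Skip) | Measure a \<Rightarrow> Skip) \<tau> \<Omega> []" for \<Omega>
    unfolding WBODY_def by (rule run_TYPE4[OF s _ _ _ that]) (simp_all add: \<tau>_def z')
  let ?s = "\<lambda>e. \<tau>(6 := 0, 7 := 0, 8 := e)"
  have nmP: "nm P = q" using P nm_eq by simp
  have "\<exists>L. run (WBODY ;; NXT) \<tau> (map (\<lambda>(k', P'). S k' P') L) [] \<and>
      (\<forall>(k', P') \<in> set L. \<exists>q'. numat P' q') \<and>
      (\<forall>gs. cnt (g # gs) k q = (\<Sum>(k', P') \<leftarrow> L. cnt gs k' (nm P')))"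
  proof (cases g)
    case (CNOT a b)
    have ab: "numat A a" "numat Bp b" "nm A = a" "nm Bp = b" using A Bp nm_eq by (auto simp: CNOT opA_def opB_def)
    show ?thesis
    proof (cases k)
      case True
      let ?O = "\<lambda>e. if q = a then [?s 0, (?s 0)(10 := Bp)] else [?s e]"
      have "\<exists>e. run (MATCH 3 (Choice Skip (OPS [C 10 4]))) \<tau> (?O e) []"
        by (rule run_MATCH[of \<tau> q 3 a]) (use P ab in \<open>auto simp: t intro!: run_Choice_Skip run_OPS_eq OPS_ne\<close>)
      then obtain e where "run (MATCH 3 (Choice Skip (OPS [C 10 4]))) \<tau> (?O e) []" by blast
      then have "run WBODY \<tau> (?O e) []" using True by (intro T) (auto simp: CNOT t intro!: run_IFNZ_T)
      then show ?thesis
        by (rule fin[where L = "if q = a then [(k, P), (k, Bp)] else [(k, P)]"]) (use P ab True N CNOT nmP in auto)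
    next
      case False
      let ?O = "\<lambda>e. if q = b then [?s 0, (?s 0)(10 := A)] else [?s e]"
      have "\<exists>e. run (MATCH 4 (Choice Skip (OPS [C 10 3]))) \<tau> (?O e) []"
        by (rule run_MATCH[of \<tau> q 4 b]) (use P ab in \<open>auto simp: t intro!: run_Choice_Skip run_OPS_eq OPS_ne\<close>)
      then obtain e where "run (MATCH 4 (Choice Skip (OPS [C 10 3]))) \<tau> (?O e) []" by blast
      then have "run WBODY \<tau> (?O e) []" using False by (intro T) (auto simp: CNOT t intro!: run_IFNZ_F)
      then show ?thesis
        by (rule fin[where L = "if q = b then [(k, P), (k, A)] else [(k, P)]"]) (use P ab False N CNOT nmP in auto)
    qed
  next
    case (Hadamard a)
    have ab: "numat A a" using A by (auto simp: Hadamard opA_def)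
    let ?O = "\<lambda>e. if q = a then [(?s 0)(11 := of_bool (\<not> k))] else [?s e]"
    have "run (IFNZ 11 (OPS [Z 11]) (OPS [I 11])) (?s 0) [(?s 0)(11 := of_bool (\<not> k))] []"
      by (rule run_IFNZ) (cases k; simp add: t bigs run_OPS_eq)
    then have "\<exists>e. run (MATCH 3 (IFNZ 11 (OPS [Z 11]) (OPS [I 11]))) \<tau> (?O e) []"
      by (intro run_MATCH[of \<tau> q 3 a]) (use P ab in \<open>auto simp: t\<close>)
    then obtain e where "run (MATCH 3 (IFNZ 11 (OPS [Z 11]) (OPS [I 11]))) \<tau> (?O e) []" by blast
    then have "run WBODY \<tau> (?O e) []" by (intro T) (auto simp: Hadamard)
    then show ?thesis
      by (rule fin[where L = "if q = a then [(\<not> k, P)] else [(k, P)]"]) (use P ab N Hadamard nmP in auto)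
  next
    case (Phase a)
    have ab: "numat A a" using A by (auto simp: Phase opA_def)
    show ?thesis
    proof (cases k)
      case True
      let ?O = "\<lambda>e. if q = a then [?s 0, (?s 0)(11 := of_bool False)] else [?s e]"
      have "\<exists>e. run (MATCH 3 (Choice Skip (OPS [Z 11]))) \<tau> (?O e) []"
        by (rule run_MATCH[of \<tau> q 3 a]) (use P ab in \<open>auto simp: t intro!: run_Choice_Skip run_OPS_eq OPS_ne\<close>)
      then obtain e where "run (MATCH 3 (Choice Skip (OPS [Z 11]))) \<tau> (?O e) []" by blast
      then have "run WBODY \<tau> (?O e) []" using True by (intro T) (auto simp: Phase t intro!: run_IFNZ_T)
      then show ?thesis
        by (rule fin[where L = "if q = a then [(k, P), (False, P)] else [(k, P)]"]) (use P ab True N(1) N(3)[of _ False] Phase nmP in auto)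
    next
      case False
      then have "run WBODY \<tau> [\<tau>] []" by (intro T) (auto simp: Phase t run_Skip intro!: run_IFNZ_F)
      then show ?thesis by (rule fin[where L = "[(k, P)]"]) (use P False N(4) Phase nmP in auto)
    qed
  next
    case (Measure a)
    then have "run WBODY \<tau> [\<tau>] []" by (intro T) (auto simp: run_Skip)
    then show ?thesis by (rule fin[where L = "[(k, P)]"]) (use P N(4) Measure nmP in auto)
  qed
  then show ?thesis unfolding \<tau>_def .
qed

lemma replicate_1: "replicate 1 s = [s]"
  by (simp only: One_nat_def replicate.simps)

lemma concat_replicate: "(\<And>y. y \<in> set xs \<Longrightarrow> F y = replicate (h y) s) \<Longrightarrow> concat (map F xs) = replicate (\<Sum>y \<leftarrow> xs. h y) s"
  by (induction xs) (auto simp: replicate_add)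

text \<open>All surviving runs return to the same \<open>\<sigma>0\<close>, so a call of
  \<open>WALK\<close> acts on later counts as multiplication by \<open>cnt gs k q\<close>.\<close>

lemma run_WALK:
  assumes z: "\<And>r. r \<le> 11 \<Longrightarrow> \<sigma>0 r = 0" and "suf (enc gs)" "\<forall>g \<in> set gs. posg g" "numat P q"
  shows "run WALK (\<sigma>0(1 := pos (enc gs), 10 := P, 11 := of_bool k)) (replicate (cnt gs k q) \<sigma>0) []"
  using assms(2-4)
proof (induction gs arbitrary: P q k)
  case Nil
  let ?s = "\<sigma>0(1 := pos [], 10 := P, 11 := of_bool k)"
  have z': "\<sigma>0 0 = 0" "\<sigma>0 1 = 0" "\<sigma>0 10 = 0" "\<sigma>0 11 = 0" using z by auto
  obtain r where r: "q \<ge> 1" "suf (bin q @ SHash # r)" "P = pos (bin q @ SHash # r)" using Nil by (auto simp: numat_def)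
  then obtain v where v: "bin q = S1 # v" using isnum_iff[of "bin q"] by (auto simp: isnum_def)
  have q1: "v = [] \<longleftrightarrow> q = 1"
  proof
    assume "v = []"
    then show "q = 1" using bin_props[of q] v by simp
  next
    assume "q = 1"
    then show "v = []" using v by (simp add: bin.simps[of 1])
  qed
  have p: "suf (v @ SHash # r)" "Suc P = pos (v @ SHash # r)" "isS1 (read_in x P)"
    using r v suf_Cons[of S1] pos_Cons[of S1] read_Cons[of S1] by (auto simp: cell_defs)
  \<comment> \<open>Among canonical positive numerals only that of 1 has length one, so a single
    symbol behind the leading \<open>S1\<close> decides.\<close>
  have h: "isH (read_in x (Suc P)) \<longleftrightarrow> v = []"
  proof (cases v)
    case Nil
    then show ?thesis using p read_Cons by (simp add: cell_defs)
  next
    case (Cons a w)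
    then have "a \<noteq> SHash" using bin_props[of q] v by auto
    then show ?thesis using p read_Cons[of a] Cons by (simp add: cell_defs)
  qed
  have e: "evops [Z 1, Z 10, Z 11] (?s(10 := pos (v @ SHash # r))) = \<sigma>0" by (auto simp: fun_eq_iff fun_upd_apply z')
  have tl: "run (BR 10 isS1 (OPS [I 10]) Fail ;; BR 10 isH Skip Fail ;; OPS [Z 1, Z 10, Z 11]) ?s (if q = 1 then [\<sigma>0] else []) []"
  proof (rule run_chkops)
    show "run (BR 10 isH Skip Fail ;; OPS [Z 1, Z 10, Z 11]) (evops [I 10] ?s) (if q = 1 then [\<sigma>0] else []) []"
    proof (cases "q = 1")
      case True
      then show ?thesis using h p q1
        by (auto intro!: run_chk run_OPS_eq simp: z' e) (auto simp: fun_eq_iff fun_upd_apply z')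
    next
      case False
      then show ?thesis using h p q1 by (auto intro!: run_chk_fail simp: z')
    qed
  qed (use p bigs in \<open>auto simp: z'\<close>)
  show ?case unfolding WALK_def
  proof (rule run_WHR_end)
    show "run (IFNZ 11 Skip Fail ;; BR 10 isS1 (OPS [I 10]) Fail ;; BR 10 isH Skip Fail ;; OPS [Z 1, Z 10, Z 11])
      (\<sigma>0(1 := pos (enc []), 10 := P, 11 := of_bool k)) (replicate (cnt [] k q) \<sigma>0) []"
    proof (cases k)
      case True
      have "run (IFNZ 11 Skip Fail) ?s [?s] []" using True by (intro run_IFNZ_T) (auto simp: run_Skip)
      from run_seq[OF this tl] show ?thesis using True by (auto simp: replicate_1 split: if_splits)
    next
      case False
      then show ?thesis by (auto intro!: run_seq_fail run_IFNZ_F run_Fail)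
    qed
  qed (use read_Nil in \<open>auto simp: z' cell_defs\<close>)
next
  case (Cons g gs)
  let ?s = "\<sigma>0(1 := pos (enc (g # gs)), 10 := P, 11 := of_bool k)"
  let ?tl = "IFNZ 11 Skip Fail ;; BR 10 isS1 (OPS [I 10]) Fail ;; BR 10 isH Skip Fail ;; OPS [Z 1, Z 10, Z 11]"
  have z': "\<sigma>0 0 = 0" using z by auto
  have s: "suf (enc_gate g @ enc gs)" "posg g" "suf (enc gs)" using Cons.prems suf_app by auto
  have ne: "nend (read_in x (pos (enc_gate g @ enc gs)))"
    using s(1) read_Cons enc_gate_ne[of g] by (cases "enc_gate g") (auto simp: cell_defs)
  obtain A Bp where AB: "numat A (opA g)" "numat Bp (opB g)"
    "run PARSE ?s [?s(2 := Suc (pos (enc_gate g @ enc gs)), 3 := A, 4 := Bp, 5 := pos (enc gs))] []"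
    by (rule run_PARSE_ok[OF s(1,2), of ?s]) (auto simp: z')
  obtain L where L: "run (WBODY ;; NXT) (?s(2 := Suc (pos (enc_gate g @ enc gs)), 3 := A, 4 := Bp, 5 := pos (enc gs)))
      (map (\<lambda>(k', P'). \<sigma>0(1 := pos (enc gs), 10 := P', 11 := of_bool k')) L) []"
    "\<forall>(k', P') \<in> set L. \<exists>q'. numat P' q'" "cnt (g # gs) k q = (\<Sum>(k', P') \<leftarrow> L. cnt gs k' (nm P'))"
    using run_WBODY[of \<sigma>0, where k = k, OF z s(1,2) Cons.prems(3) AB(1,2)] unfolding enc_simps by blast
  \<comment> \<open>The loop rule wants the outcome of the remaining walk as a function of the
    register state, so kind and qubit are read back from registers 11 and 10.\<close>
  define F where "F s = replicate (cnt gs (s 11 \<noteq> 0) (nm (s 10))) \<sigma>0" for s :: "nat \<Rightarrow> nat"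
  let ?\<Omega> = "map (\<lambda>(k', P'). \<sigma>0(1 := pos (enc gs), 10 := P', 11 := of_bool k')) L"
  have F: "concat (map F ?\<Omega>) = replicate (cnt (g # gs) k q) \<sigma>0"
  proof -
    have "concat (map F ?\<Omega>) = concat (map (\<lambda>(k', P'). replicate (cnt gs k' (nm P')) \<sigma>0) L)"
      by (auto simp: F_def intro!: arg_cong[of _ _ concat])
    also have "\<dots> = replicate (\<Sum>(k', P') \<leftarrow> L. cnt gs k' (nm P')) \<sigma>0"
      by (rule concat_replicate) auto
    finally show ?thesis using L(3) by simp
  qed
  have "run WALK ?s (concat (map F ?\<Omega>)) ([] @ [])"
    unfolding WALK_def
  proof (rule run_WHR_body)
    show "run (PARSE ;; WBODY ;; NXT) ?s ?\<Omega> []" by (rule run_seq[OF AB(3) L(1)])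
    fix \<sigma>1 assume "\<sigma>1 \<in> set ?\<Omega>"
    then obtain k' P' where kP: "(k', P') \<in> set L" "\<sigma>1 = \<sigma>0(1 := pos (enc gs), 10 := P', 11 := of_bool k')" by auto
    then obtain q' where q': "numat P' q'" using L(2) by auto
    have "run WALK \<sigma>1 (replicate (cnt gs k' q') \<sigma>0) []"
      unfolding kP by (rule Cons.IH) (use s Cons.prems q' in auto)
    then show "run (WHR 1 nend (PARSE ;; WBODY ;; NXT) ;; ?tl) \<sigma>1 (F \<sigma>1) []"
      using nm_eq[OF q'] by (simp add: F_def kP WALK_def)
  qed (use ne in \<open>auto simp: z'\<close>)
  then show ?case unfolding F by simp
qed

end

section \<open>Assembling the recognizer from walks\<close>

definition "SAVE = OPS [C 12 5, C 14 3, C 15 4, Z 1, Z 2, Z 3, Z 4, Z 5]"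
text \<open>Also advances to the next gate, since register 12 holds the position behind the current
  one. \<open>SAVE ;; RESTORE\<close> is thus the idle step of a gate loop.\<close>

definition "RESTORE = OPS [C 1 12, Z 12, Z 14, Z 15]"
definition "WK r s k = OPS (if k then [C 10 r, C 1 s, I 11] else [C 10 r, C 1 s]) ;; WALK"

text \<open>The result 2 stands for greater, so after one decrement it is the only nonzero result
  that remains nonzero.\<close>

definition "LE = CMP ;; IFNZ 8 (DEC 8 ;; IFNZ 8 Fail Skip) Skip"
definition "VALIDATE = PARSE ;; OPS [C 6 3, C 7 16] ;; LE ;; OPS [C 6 4, C 7 16] ;; LE ;;
  TYPE4 (OPS [C 6 3, C 7 4] ;; CMP ;; IFNZ 8 (OPS [Z 8]) Fail) Skip Skip Skip ;; OPS [C 1 5, Z 2, Z 3, Z 4, Z 5]"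

text \<open>The extra branch adds 1 to the number of walks: the count is odd iff the X-bit is
  0.\<close>

definition "CW r s = Choice Skip (WK r s False)"
definition "CHECK_MEASURE = TYPE4 (SAVE ;; RESTORE) (SAVE ;; RESTORE) (SAVE ;; RESTORE) (SAVE ;; CW 14 12 ;; RESTORE)"
text \<open>Walks start at the first gate (register 13), giving X-bits of the fully conjugated
  observable; for a measurement they start behind the gate (register 12), where only the later gates
  have acted on it.\<close>

definition "CHECK_INIT = SAVE ;; CW 14 13 ;; CW 15 13 ;; RESTORE"
text \<open>Choosing a gate is weighted by walks from behind it: an X walk for a Phase gate, an X
  walk and then a Z walk for a Hadamard gate.\<close>

definition "SIGN_STEP = TYPE4 (SAVE ;; RESTORE)
  (IFNZ 17 (SAVE ;; RESTORE) (SAVE ;; Choice Skip (WK 14 12 False ;; WK 14 12 True ;; OPS [I 17, I 18]) ;; RESTORE))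
  (IFNZ 18 (SAVE ;; RESTORE) (SAVE ;; Choice Skip (WK 14 12 False ;; IFNZ 17 (OPS [I 18]) (OPS [I 17])) ;; RESTORE))
  (SAVE ;; RESTORE)"
definition "SIGN = WHR 1 nend (PARSE ;; SIGN_STEP) ;; IFNZ 18 Skip Fail ;; OPS [Z 1, Z 17, Z 18]"

text \<open>On a well-formed input the number of accepting runs is a product with one factor per
  conjunct of \<open>certainly_one_iff\<close>; \<open>sign_cnt 1\<close>, which must be even,
  enters with 1 added. Register 16 is 1 because \<open>n\<close> is written at the start of the
  input.\<close>

definition "GKPROG = OPS [I 5, I 16] ;; PNUM ;; OPS [C 13 5, C 1 5, Z 5] ;; WHR 1 nend VALIDATE ;;
  OPS [C 1 13] ;; WHR 1 nend (PARSE ;; CHECK_MEASURE) ;; OPS [C 1 13] ;; WHR 1 nend (PARSE ;; CHECK_INIT) ;; OPS [Z 1] ;;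
  Choice Skip (OPS [C 1 13, I 17] ;; SIGN) ;; OPS [C 1 13] ;; SIGN"

lemma replicate_plus_1: "replicate (1 + n) s = s # replicate n s"
  unfolding plus_1_eq_Suc replicate.simps ..

lemma enc_inj: "enc gs = enc gs' \<Longrightarrow> gs = gs'"
proof (induction gs arbitrary: gs')
  case Nil
  then show ?case using enc_gate_ne by (cases gs') auto
next
  case (Cons g gs)
  then obtain g' gs'' where "gs' = g' # gs''" using enc_gate_ne by (cases gs') auto
  then show ?case using Cons enc_gate_split[of g "enc gs" g' "enc gs''"] by auto
qed

lemma cok_OPS: "cok n (OPS ps) = (\<forall>p \<in> set ps. cok n (cop p))"
  by (induction ps) (auto simp: OPS.simps)

lemma cok_GKPROG: "cok 19 GKPROG"
  by (simp add: GKPROG_def SIGN_def CHECK_MEASURE_def CHECK_INIT_def SIGN_STEP_def CW_def VALIDATE_def LE_def WK_def RESTORE_def SAVE_def WALK_def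
      WBODY_def NXT_def MATCH_def TYPE4_def CMP_def PARSE_def PNUM_def cok_OPS)

context rec
begin

text \<open>The state between two gates: walks and parsing have left nothing behind, while 13, 16,
  17 and 18 keep their values throughout a loop.\<close>

definition clean :: "(nat \<Rightarrow> nat) \<Rightarrow> bool" where
  "clean \<sigma> \<longleftrightarrow> (\<forall>r \<le> 12. \<sigma> r = 0) \<and> \<sigma> 14 = 0 \<and> \<sigma> 15 = 0"

lemma cleanD:
  "clean \<sigma> \<Longrightarrow> \<sigma> 0 = 0 \<and> \<sigma> 1 = 0 \<and> \<sigma> 2 = 0 \<and> \<sigma> 3 = 0 \<and> \<sigma> 4 = 0 \<and> \<sigma> 5 = 0 \<and> \<sigma> 6 = 0 \<and> \<sigma> 7 = 0 \<and> \<sigma> 8 = 0 \<and>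
    \<sigma> 9 = 0 \<and> \<sigma> 10 = 0 \<and> \<sigma> 11 = 0 \<and> \<sigma> 12 = 0 \<and> \<sigma> 14 = 0 \<and> \<sigma> 15 = 0"
  by (simp add: clean_def)

lemma run_WK:
  assumes "\<And>i. i \<le> 11 \<Longrightarrow> \<sigma> i = 0" "suf (enc gs)" "\<forall>g \<in> set gs. posg g" "numat (\<sigma> r) q" "\<sigma> s = pos (enc gs)" "s \<noteq> 10"
  shows "run (WK r s k) \<sigma> (replicate (cnt gs k q) \<sigma>) []"
  unfolding WK_def
proof (rule run_OPS_seq)
  have "\<sigma> 11 = 0" using assms(1) by simp
  then show "okops (2 ^ B) (if k then [C 10 r, C 1 s, I 11] else [C 10 r, C 1 s]) \<sigma>" using bigs by simp
  have "evops (if k then [C 10 r, C 1 s, I 11] else [C 10 r, C 1 s]) \<sigma> = \<sigma>(1 := pos (enc gs), 10 := \<sigma> r, 11 := of_bool k)"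
    using \<open>\<sigma> 11 = 0\<close> assms(5,6) by (cases "s = 10") (auto simp: fun_eq_iff fun_upd_apply)
  then show "run WALK (evops (if k then [C 10 r, C 1 s, I 11] else [C 10 r, C 1 s]) \<sigma>) (replicate (cnt gs k q) \<sigma>) []"
    using run_WALK[OF assms(1,2,3,4)] by simp
qed

lemma run_CW:
  assumes "\<And>i. i \<le> 11 \<Longrightarrow> \<sigma> i = 0" "suf (enc gs)" "\<forall>g \<in> set gs. posg g" "numat (\<sigma> r) q" "\<sigma> s = pos (enc gs)" "s \<noteq> 10"
  shows "run (CW r s) \<sigma> (replicate (1 + cnt gs False q) \<sigma>) []"
  unfolding CW_def
  unfolding replicate_plus_1
  by (rule run_Choice_Skip, simp add: WK_def OPS_ne, rule run_WK) (use assms in auto)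

fun loop_cnt :: "(gate \<Rightarrow> gate list \<Rightarrow> nat) \<Rightarrow> gate list \<Rightarrow> nat" where
  "loop_cnt m [] = 1"
| "loop_cnt m (g # gs) = m g gs * loop_cnt m gs"

lemma nend_enc: "suf (enc_gate g @ l) \<Longrightarrow> nend (read_in x (pos (enc_gate g @ l)))"
  using read_Cons enc_gate_ne[of g] by (cases "enc_gate g") (auto simp: cell_defs)

lemma run_gates:
  assumes c: "clean \<sigma>" and "suf (enc gs)" "\<forall>g \<in> set gs. posg g"
    and body: "\<And>g gs' A Bp. \<lbrakk>suf (enc_gate g @ enc gs'); suf (enc gs'); \<forall>g \<in> set gs'. posg g; numat A (opA g); numat Bp (opB g)\<rbrakk> \<Longrightarrow>
      run c (\<sigma>(1 := pos (enc_gate g @ enc gs'), 2 := Suc (pos (enc_gate g @ enc gs')), 3 := A, 4 := Bp, 5 := pos (enc gs')))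
        (replicate (m g gs') (\<sigma>(1 := pos (enc gs')))) []"
  shows "run (WHR 1 nend (PARSE ;; c)) (\<sigma>(1 := pos (enc gs))) (replicate (loop_cnt m gs) (\<sigma>(1 := pos []))) []"
  using assms(2,3)
proof (induction gs)
  case Nil
  show ?case using cleanD[OF c] read_Nil by (intro run_WHR_F) (simp_all add: cell_defs replicate_1)
next
  case (Cons g gs)
  let ?p = "pos (enc_gate g @ enc gs)"
  have s: "suf (enc_gate g @ enc gs)" "posg g" "suf (enc gs)" "\<forall>g \<in> set gs. posg g" using Cons.prems suf_app by auto
  obtain A Bp where AB: "numat A (opA g)" "numat Bp (opB g)"
    "run PARSE (\<sigma>(1 := ?p)) [\<sigma>(1 := ?p, 2 := Suc ?p, 3 := A, 4 := Bp, 5 := pos (enc gs))] []"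
    by (rule run_PARSE_ok[OF s(1,2), of "\<sigma>(1 := ?p)"]) (use cleanD[OF c] in auto)
  have "run (PARSE ;; c) (\<sigma>(1 := ?p)) (replicate (m g gs) (\<sigma>(1 := pos (enc gs)))) []"
    by (rule run_seq[OF AB(3) body]) (use s AB in auto)
  then have "run ((PARSE ;; c) ;; WHR 1 nend (PARSE ;; c)) (\<sigma>(1 := ?p)) (replicate (m g gs * loop_cnt m gs) (\<sigma>(1 := pos []))) []"
    by (rule run_seq_rep) (rule Cons.IH[OF s(3,4)])
  then show ?case
    by - (rule run_WHR_T, use cleanD[OF c] nend_enc[OF s(1)] in simp_all)
qed

lemma run_SAVE:
  assumes "clean \<sigma>"
  shows "run SAVE (\<sigma>(1 := p, 2 := p2, 3 := A, 4 := Bp, 5 := n)) [\<sigma>(12 := n, 14 := A, 15 := Bp)] []"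
  unfolding SAVE_def by (rule run_OPS_eq) (use cleanD[OF assms] in \<open>auto simp: fun_eq_iff fun_upd_apply\<close>)

lemma run_RESTORE:
  assumes "clean \<sigma>"
  shows "run RESTORE (\<sigma>(12 := n, 14 := A, 15 := Bp)) [\<sigma>(1 := n)] []"
  unfolding RESTORE_def by (rule run_OPS_eq) (use cleanD[OF assms] in \<open>auto simp: fun_eq_iff fun_upd_apply\<close>)

lemma saved_zero: "clean \<sigma> \<Longrightarrow> i \<le> 11 \<Longrightarrow> (\<sigma>(12 := n, 14 := A, 15 := Bp)) i = 0"
  by (simp add: clean_def)

lemma run_SAVE_RESTORE:
  assumes "clean \<sigma>" "run c (\<sigma>(12 := n, 14 := A, 15 := Bp)) (replicate m (\<sigma>(12 := n, 14 := A, 15 := Bp))) []"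
  shows "run (SAVE ;; c ;; RESTORE) (\<sigma>(1 := p, 2 := p2, 3 := A, 4 := Bp, 5 := n)) (replicate m (\<sigma>(1 := n))) []"
proof -
  have "run RESTORE (\<sigma>(12 := n, 14 := A, 15 := Bp)) (replicate 1 (\<sigma>(1 := n))) []"
    unfolding replicate_1 by (rule run_RESTORE[OF assms(1)])
  from run_seq[OF run_SAVE[OF assms(1)] run_seq_rep[OF assms(2) this]] show ?thesis by simp
qed

lemma run_NOP:
  assumes "clean \<sigma>"
  shows "run (SAVE ;; RESTORE) (\<sigma>(1 := p, 2 := p2, 3 := A, 4 := Bp, 5 := n)) [\<sigma>(1 := n)] []"
  by (rule run_seq[OF run_SAVE[OF assms] run_RESTORE[OF assms]])

definition m2 :: "gate \<Rightarrow> gate list \<Rightarrow> nat" where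
  "m2 g gs = (case g of Measure a \<Rightarrow> 1 + cnt gs False a | _ \<Rightarrow> 1)"

lemma run_CHECK_MEASURE:
  assumes c: "clean \<sigma>" and s: "suf (enc_gate g @ enc gs)" "suf (enc gs)" "\<forall>g \<in> set gs. posg g"
    and AB: "numat A (opA g)" "numat Bp (opB g)"
  shows "run CHECK_MEASURE (\<sigma>(1 := pos (enc_gate g @ enc gs), 2 := Suc (pos (enc_gate g @ enc gs)), 3 := A, 4 := Bp, 5 := pos (enc gs)))
        (replicate (m2 g gs) (\<sigma>(1 := pos (enc gs)))) []"
  unfolding CHECK_MEASURE_def
proof (rule run_TYPE4[OF s(1)])
  let ?\<tau> = "\<sigma>(1 := pos (enc_gate g @ enc gs), 2 := Suc (pos (enc_gate g @ enc gs)), 3 := A, 4 := Bp, 5 := pos (enc gs))"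
  have M: "run (SAVE ;; CW 14 12 ;; RESTORE) ?\<tau> (replicate (1 + cnt gs False (opA g)) (\<sigma>(1 := pos (enc gs)))) []"
    by (rule run_SAVE_RESTORE[OF c], rule run_CW) (use saved_zero[OF c] s AB in simp_all)
  show "run (case g of CNOT a b \<Rightarrow> SAVE ;; RESTORE | Hadamard a \<Rightarrow> SAVE ;; RESTORE | Phase a \<Rightarrow> SAVE ;; RESTORE
      | Measure a \<Rightarrow> SAVE ;; CW 14 12 ;; RESTORE) ?\<tau> (replicate (m2 g gs) (\<sigma>(1 := pos (enc gs)))) []"
    using M run_NOP[OF c, of "pos (enc_gate g @ enc gs)" "Suc (pos (enc_gate g @ enc gs))" A Bp "pos (enc gs)"]
    by (cases g) (simp_all add: m2_def opA_def replicate_1)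
qed (use cleanD[OF c] in simp_all)

lemma alive_loop_cnt: "odd (loop_cnt m2 gs) = alive gs"
  by (induction gs rule: alive.induct) (auto simp: m2_def)

definition m3 :: "gate list \<Rightarrow> gate \<Rightarrow> gate list \<Rightarrow> nat" where
  "m3 gs0 g gs = (1 + cnt gs0 False (opA g)) * (1 + cnt gs0 False (opB g))"

lemma run_CHECK_INIT:
  assumes c: "clean \<sigma>" and s: "suf (enc gs0)" "\<forall>g \<in> set gs0. posg g" "\<sigma> 13 = pos (enc gs0)"
    and AB: "numat A (opA g)" "numat Bp (opB g)"
  shows "run CHECK_INIT (\<sigma>(1 := p, 2 := p2, 3 := A, 4 := Bp, 5 := n)) (replicate (m3 gs0 g gs) (\<sigma>(1 := n))) []"
proof -
  let ?s = "\<sigma>(12 := n, 14 := A, 15 := Bp)"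
  have 1: "run (CW 14 13) ?s (replicate (1 + cnt gs0 False (opA g)) ?s) []"
    by (rule run_CW) (use saved_zero[OF c] s AB in simp_all)
  have "run RESTORE ?s (replicate 1 (\<sigma>(1 := n))) []"
    unfolding replicate_1 by (rule run_RESTORE[OF c])
  moreover have "run (CW 15 13) ?s (replicate (1 + cnt gs0 False (opB g)) ?s) []"
    by (rule run_CW) (use saved_zero[OF c] s AB in simp_all)
  ultimately have "run (CW 15 13 ;; RESTORE) ?s (replicate ((1 + cnt gs0 False (opB g)) * 1) (\<sigma>(1 := n))) []"
    by (rule run_seq_rep[rotated])
  from run_seq[OF run_SAVE[OF c] run_seq_rep[OF 1 this]] show ?thesis by (simp add: CHECK_INIT_def m3_def)
qed

lemma operands_op: "set (operands g) = {opA g, opB g}"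
  by (cases g) (auto simp: opA_def opB_def)

lemma zero_loop_cnt: "odd (loop_cnt (m3 gs0) gs) = (\<forall>g \<in> set gs. \<forall>q \<in> set (operands g). even (cnt gs0 False q))"
  by (induction gs) (auto simp: m3_def operands_op)

definition mode :: "(nat \<Rightarrow> nat) \<Rightarrow> nat \<Rightarrow> nat \<Rightarrow> nat" where
  "mode \<sigma> m = \<sigma>(17 := of_bool (m \<ge> 1), 18 := of_bool (m = 2))"

lemma clean_mode: "clean \<sigma> \<Longrightarrow> clean (mode \<sigma> m)"
  by (simp add: clean_def mode_def)

lemma run_mode_branch:
  assumes c: "clean \<sigma>" and s: "s = (\<lambda>m. (mode \<sigma> m)(12 := n, 14 := A, 15 := Bp))"
    and X: "run X (s m) (replicate j (s m')) []" "X \<noteq> Skip"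
  shows "run (SAVE ;; Choice Skip X ;; RESTORE) ((mode \<sigma> m)(1 := p, 2 := p2, 3 := A, 4 := Bp, 5 := n))
    ((mode \<sigma> m)(1 := n) # replicate j ((mode \<sigma> m')(1 := n))) []"
proof -
  have R: "evops [C 1 12, Z 12, Z 14, Z 15] (s m) = (mode \<sigma> m)(1 := n)" for m
    using cleanD[OF clean_mode[OF c]] by (auto simp: s fun_eq_iff fun_upd_apply)
  have "run (Choice Skip X ;; RESTORE) (s m) (map (evops [C 1 12, Z 12, Z 14, Z 15]) (s m # replicate j (s m'))) []"
    unfolding RESTORE_def by (rule run_then_OPS[OF run_Choice_Skip[OF X(2,1)]]) simp
  then have "run (Choice Skip X ;; RESTORE) (s m) ((mode \<sigma> m)(1 := n) # replicate j ((mode \<sigma> m')(1 := n))) []"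
    by (rule run_eq) (simp only: list.map map_replicate R)
  moreover have "run SAVE ((mode \<sigma> m)(1 := p, 2 := p2, 3 := A, 4 := Bp, 5 := n)) [s m] []"
    unfolding s by (rule run_SAVE[OF clean_mode[OF c]])
  ultimately show ?thesis by (rule run_seq[rotated])
qed

definition step4 :: "nat \<Rightarrow> gate \<Rightarrow> gate list \<Rightarrow> nat" where
  "step4 m g gs = (case g of Hadamard a \<Rightarrow> if m = 0 then cnt gs False a * cnt gs True a else 0
    | Phase a \<Rightarrow> if m < 2 then cnt gs False a else 0 | _ \<Rightarrow> 0)"

definition next4 :: "nat \<Rightarrow> gate \<Rightarrow> nat" where
  "next4 m g = (case g of Hadamard a \<Rightarrow> 2 | _ \<Rightarrow> Suc m)"

lemma sign_cnt_step: "m \<le> 2 \<Longrightarrow> sign_cnt m (g # gs) = sign_cnt m gs + step4 m g gs * sign_cnt (next4 m g) gs"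
  by (cases g) (auto simp: step4_def next4_def)

lemma run_SIGN_STEP:
  assumes c: "clean \<sigma>" and m: "m \<le> 2" and s: "suf (enc_gate g @ enc gs)" "suf (enc gs)" "\<forall>g \<in> set gs. posg g"
    and AB: "numat A (opA g)" "numat Bp (opB g)"
  shows "run SIGN_STEP ((mode \<sigma> m)(1 := pos (enc_gate g @ enc gs), 2 := Suc (pos (enc_gate g @ enc gs)), 3 := A, 4 := Bp, 5 := pos (enc gs)))
        ((mode \<sigma> m)(1 := pos (enc gs)) # replicate (step4 m g gs) ((mode \<sigma> (next4 m g))(1 := pos (enc gs)))) []"
  unfolding SIGN_STEP_def
proof (rule run_TYPE4[OF s(1)])
  let ?p = "pos (enc_gate g @ enc gs)" and ?n = "pos (enc gs)"
  let ?\<tau> = "(mode \<sigma> m)(1 := ?p, 2 := Suc ?p, 3 := A, 4 := Bp, 5 := ?n)"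
  define S where "S = (\<lambda>m. (mode \<sigma> m)(12 := ?n, 14 := A, 15 := Bp))"
  have cm: "clean (mode \<sigma> m)" for m by (rule clean_mode[OF c])
  have NOP: "run (SAVE ;; RESTORE) ?\<tau> [(mode \<sigma> m)(1 := ?n)] []" by (rule run_NOP[OF cm])
  have md: "S m 17 = of_bool (m \<ge> 1)" "S m 18 = of_bool (m = 2)" for m by (auto simp: S_def mode_def)
  have W: "run (WK 14 12 k) (S m) (replicate (cnt gs k (opA g)) (S m)) []" for k m
    by (rule run_WK) (use saved_zero[OF cm] s AB in \<open>simp_all add: S_def\<close>)
  have H: "run (IFNZ 17 (SAVE ;; RESTORE) (SAVE ;; Choice Skip (WK 14 12 False ;; WK 14 12 True ;; OPS [I 17, I 18]) ;; RESTORE)) ?\<tau>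
      ((mode \<sigma> m)(1 := ?n) # replicate (step4 m g gs) ((mode \<sigma> (next4 m g))(1 := ?n))) []" if g: "g = Hadamard a" for a
  proof (cases "m = 0")
    case False
    then show ?thesis using NOP by (intro run_IFNZ_T) (auto simp: mode_def step4_def g)
  next
    case True
    have fin: "run (OPS [I 17, I 18]) (S m) (replicate 1 (S 2)) []"
      unfolding replicate_1 by (rule run_OPS_eq) (use True bigs in \<open>auto simp: S_def mode_def fun_eq_iff fun_upd_apply\<close>)
    have "run (WK 14 12 False ;; WK 14 12 True ;; OPS [I 17, I 18]) (S m)
        (replicate (cnt gs False (opA g) * (cnt gs True (opA g) * 1)) (S 2)) []"
      by (rule run_seq_rep[OF W run_seq_rep[OF W fin]])
    then have "run (WK 14 12 False ;; WK 14 12 True ;; OPS [I 17, I 18]) (S m) (replicate (step4 m g gs) (S (next4 m g))) []"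
      by (rule run_eq) (simp add: step4_def next4_def g True opA_def)
    from run_mode_branch[OF c S_def this OPS_ne(2)] show ?thesis
      using True by - (rule run_IFNZ_F, simp_all add: mode_def)
  qed
  have P: "run (IFNZ 18 (SAVE ;; RESTORE) (SAVE ;; Choice Skip (WK 14 12 False ;; IFNZ 17 (OPS [I 18]) (OPS [I 17])) ;; RESTORE)) ?\<tau>
      ((mode \<sigma> m)(1 := ?n) # replicate (step4 m g gs) ((mode \<sigma> (next4 m g))(1 := ?n))) []" if g: "g = Phase a" for a
  proof (cases "m = 2")
    case True
    then show ?thesis using NOP by (intro run_IFNZ_T) (auto simp: mode_def step4_def g)
  next
    case False
    then have m01: "m = 0 \<or> m = 1" using m by auto
    have fin: "run (IFNZ 17 (OPS [I 18]) (OPS [I 17])) (S m) (replicate 1 (S (Suc m))) []"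
      unfolding replicate_1
      using m01 by (intro run_IFNZ, cases "m = 0")
        (auto intro!: run_OPS_eq simp: bigs S_def mode_def fun_eq_iff fun_upd_apply)
    have "run (WK 14 12 False ;; IFNZ 17 (OPS [I 18]) (OPS [I 17])) (S m) (replicate (cnt gs False (opA g) * 1) (S (Suc m))) []"
      by (rule run_seq_rep[OF W fin])
    then have "run (WK 14 12 False ;; IFNZ 17 (OPS [I 18]) (OPS [I 17])) (S m) (replicate (step4 m g gs) (S (next4 m g))) []"
      by (rule run_eq) (use False m in \<open>simp add: step4_def next4_def g opA_def\<close>)
    from run_mode_branch[OF c S_def this OPS_ne(2)] show ?thesis
      using False by - (rule run_IFNZ_F, simp_all add: mode_def)
  qed
  show "run (case g of CNOT a b \<Rightarrow> SAVE ;; RESTORE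
      | Hadamard a \<Rightarrow> IFNZ 17 (SAVE ;; RESTORE) (SAVE ;; Choice Skip (WK 14 12 False ;; WK 14 12 True ;; OPS [I 17, I 18]) ;; RESTORE)
      | Phase a \<Rightarrow> IFNZ 18 (SAVE ;; RESTORE) (SAVE ;; Choice Skip (WK 14 12 False ;; IFNZ 17 (OPS [I 18]) (OPS [I 17])) ;; RESTORE)
      | Measure a \<Rightarrow> SAVE ;; RESTORE) ?\<tau>
      ((mode \<sigma> m)(1 := ?n) # replicate (step4 m g gs) ((mode \<sigma> (next4 m g))(1 := ?n))) []"
    using H P NOP by (cases g) (simp_all add: step4_def)
qed (use cleanD[OF clean_mode[OF c]] in simp_all)

lemma run_SIGN:
  assumes c: "clean \<sigma>" "\<sigma> 17 = 0" "\<sigma> 18 = 0" and "m \<le> 2" "suf (enc gs)" "\<forall>g \<in> set gs. posg g"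
  shows "run SIGN ((mode \<sigma> m)(1 := pos (enc gs))) (replicate (sign_cnt m gs) \<sigma>) []"
  using assms(4-)
proof (induction gs arbitrary: m)
  case Nil
  let ?s = "(mode \<sigma> m)(1 := pos [])"
  have "run (IFNZ 18 Skip Fail ;; OPS [Z 1, Z 17, Z 18]) ?s (replicate (sign_cnt m []) \<sigma>) []"
  proof (cases "m = 2")
    case True
    have "run (IFNZ 18 Skip Fail) ?s [?s] []" by (rule run_IFNZ_T) (simp_all add: True mode_def run_Skip)
    moreover have "run (OPS [Z 1, Z 17, Z 18]) ?s [\<sigma>] []"
      by (rule run_OPS_eq) (use c cleanD[OF c(1)] in \<open>auto simp: mode_def fun_eq_iff fun_upd_apply\<close>)
    ultimately show ?thesis using run_seq True by (simp add: replicate_1)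
  next
    case False
    have "run (IFNZ 18 Skip Fail) ?s [] []" by (rule run_IFNZ_F) (simp_all add: False mode_def run_Fail)
    then show ?thesis using run_seq_fail False by simp
  qed
  then show ?case unfolding SIGN_def
    by - (rule run_WHR_end, use cleanD[OF clean_mode[OF c(1)]] read_Nil in \<open>simp_all add: cell_defs\<close>)
next
  case (Cons g gs)
  let ?p = "pos (enc_gate g @ enc gs)" and ?n = "pos (enc gs)"
  let ?s = "(mode \<sigma> m)(1 := ?p)"
  let ?tl = "IFNZ 18 Skip Fail ;; OPS [Z 1, Z 17, Z 18]"
  have s: "suf (enc_gate g @ enc gs)" "posg g" "suf (enc gs)" "\<forall>g \<in> set gs. posg g" using Cons.prems suf_app by auto
  obtain A Bp where AB: "numat A (opA g)" "numat Bp (opB g)" "run PARSE ?s [?s(2 := Suc ?p, 3 := A, 4 := Bp, 5 := ?n)] []"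
    by (rule run_PARSE_ok[OF s(1,2), of ?s]) (use cleanD[OF clean_mode[OF c(1)]] in auto)
  let ?\<Omega> = "(mode \<sigma> m)(1 := ?n) # replicate (step4 m g gs) ((mode \<sigma> (next4 m g))(1 := ?n))"
  \<comment> \<open>The two flags 17 and 18 add up to the mode.\<close>
  define F where "F s = replicate (sign_cnt (s 17 + s 18) gs) \<sigma>" for s :: "nat \<Rightarrow> nat"
  have F1: "F ((mode \<sigma> m)(1 := ?n)) = replicate (sign_cnt m gs) \<sigma>" if "m \<le> 2" for m
  proof -
    have "m = 0 \<or> m = 1 \<or> m = 2" using that by linarith
    then show ?thesis by (auto simp: F_def mode_def)
  qed
  \<comment> \<open>A Phase gate in mode 2 would lead to mode 3, but then there are no such
    branches.\<close>
  have nx: "next4 m g \<le> 2" if "step4 m g gs \<noteq> 0"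
    using that by (cases g) (auto simp: step4_def next4_def split: if_splits)
  have body: "run (PARSE ;; SIGN_STEP) ?s ?\<Omega> []"
    using run_seq[OF AB(3) run_SIGN_STEP[OF c(1) Cons.prems(1) s(1,3,4) AB(1,2)]] .
  have cc: "concat (map F ?\<Omega>) = replicate (sign_cnt m (g # gs)) \<sigma>"
  proof (cases "step4 m g gs = 0")
    case True
    then show ?thesis using F1 Cons.prems(1) sign_cnt_step[of m g gs] by simp
  next
    case False
    have "concat (replicate j (replicate i \<sigma>)) = replicate (j * i) \<sigma>" for i j
      by (induction j) (simp_all add: replicate_add)
    then show ?thesis using F1[OF Cons.prems(1)] F1[OF nx[OF False]] sign_cnt_step[OF Cons.prems(1), of g gs]
      by (simp add: replicate_add)
  qed
  have "run SIGN ?s (concat (map F ?\<Omega>)) ([] @ [])"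
    unfolding SIGN_def
  proof (rule run_WHR_body)
    show "run (PARSE ;; SIGN_STEP) ?s ?\<Omega> []" by (rule body)
    fix \<sigma>1 assume "\<sigma>1 \<in> set ?\<Omega>"
    then obtain m' where m': "\<sigma>1 = (mode \<sigma> m')(1 := ?n)" "m' \<le> 2"
      using Cons.prems(1) nx by (auto split: if_splits)
    show "run (WHR 1 nend (PARSE ;; SIGN_STEP) ;; ?tl) \<sigma>1 (F \<sigma>1) []"
      using Cons.IH[OF m'(2) s(3,4)] unfolding m'(1) F1[OF m'(2)] SIGN_def .
  qed (use cleanD[OF clean_mode[OF c(1)]] nend_enc[OF s(1)] in auto)
  then show ?case unfolding cc by simp
qed

lemma run_LE:
  assumes "numat (\<sigma> 6) p" "numat (\<sigma> 7) q" "\<sigma> 0 = 0"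
  shows "run LE \<sigma> (if p \<le> q then [\<sigma>(6 := 0, 7 := 0, 8 := 0)] else []) []"
proof -
  let ?e = "cmpf (bin p) (bin q)"
  let ?s = "\<lambda>e. \<sigma>(6 := 0, 7 := 0, 8 := e)"
  have e: "?e \<le> 2" "?e = 2 \<longleftrightarrow> \<not> p \<le> q" using cmpf_bin assms by (auto simp: numat_def)
  have "run (IFNZ 8 (DEC 8 ;; IFNZ 8 Fail Skip) Skip) (?s ?e) (if p \<le> q then [?s 0] else []) []"
  proof (cases "?e = 0")
    case True
    then have "p \<le> q" using e by auto
    then show ?thesis using True by (intro run_IFNZ_F) (simp_all add: run_Skip)
  next
    case False
    have d: "run (DEC 8) (?s ?e) [?s (?e - 1)] []" using run_DEC[of "?s ?e" 8] False by simp
    have "run (IFNZ 8 Fail Skip) (?s (?e - 1)) (if p \<le> q then [?s 0] else []) []"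
    proof (cases "?e = 2")
      case True
      then show ?thesis using e by (intro run_IFNZ_T) (simp_all add: run_Fail)
    next
      case f: False
      then have "?e = 1" using e(1) False by linarith
      then show ?thesis using e by (intro run_IFNZ_F) (simp_all add: run_Skip)
    qed
    from run_seq[OF d this] show ?thesis using False by - (rule run_IFNZ_T, simp_all)
  qed
  from run_seq[OF run_CMP[of \<sigma>, OF assms] this] show ?thesis by (simp add: LE_def)
qed

definition gate_ok :: "nat \<Rightarrow> gate \<Rightarrow> bool" where
  "gate_ok n g \<longleftrightarrow> opA g \<le> n \<and> opB g \<le> n \<and> (case g of CNOT a b \<Rightarrow> a \<noteq> b | _ \<Rightarrow> True)"

lemma gate_wf_ok: "gate_wf n g \<longleftrightarrow> posg g \<and> gate_ok n g"
  by (cases g) (auto simp: gate_ok_def posg_def opA_def opB_def valid_qubit_def)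

lemma run_seq_if:
  assumes "run a \<sigma> (if P then [\<sigma>1] else []) []" "P \<Longrightarrow> run b \<sigma>1 (if Q then \<Omega> else []) []"
  shows "run (a ;; b) \<sigma> (if P \<and> Q then \<Omega> else []) []"
proof (cases P)
  case True
  then show ?thesis using run_seq[of a \<sigma> \<sigma>1 b] assms by simp
next
  case False
  then show ?thesis using run_seq_fail[of a \<sigma>] assms(1) by simp
qed

lemma run_check_gate:
  assumes c: "clean \<sigma>" and N: "numat (\<sigma> 16) n" and s: "suf (enc_gate g @ r)"
    and AB: "numat A (opA g)" "numat Bp (opB g)"
  shows "run (OPS [C 6 3, C 7 16] ;; LE ;; OPS [C 6 4, C 7 16] ;; LE ;;
     TYPE4 (OPS [C 6 3, C 7 4] ;; CMP ;; IFNZ 8 (OPS [Z 8]) Fail) Skip Skip Skip ;; OPS [C 1 5, Z 2, Z 3, Z 4, Z 5])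
    (\<sigma>(1 := pos (enc_gate g @ r), 2 := Suc (pos (enc_gate g @ r)), 3 := A, 4 := Bp, 5 := pos r))
    (if gate_ok n g then [\<sigma>(1 := pos r)] else []) []"
proof -
  let ?p = "pos (enc_gate g @ r)"
  let ?\<tau> = "\<sigma>(1 := ?p, 2 := Suc ?p, 3 := A, 4 := Bp, 5 := pos r)"
  let ?D = "case g of CNOT a b \<Rightarrow> a \<noteq> b | _ \<Rightarrow> True"
  note z = cleanD[OF c]
  have e: "(?\<tau>(6 := a, 7 := b))(6 := 0, 7 := 0, 8 := 0) = ?\<tau>" for a b
    using z by (auto simp: fun_eq_iff fun_upd_apply)
  have le: "run LE (?\<tau>(6 := ?\<tau> r, 7 := ?\<tau> 16)) (if p \<le> n then [?\<tau>] else []) []"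
    if "numat (?\<tau> r) p" for r p
    using run_LE[of "?\<tau>(6 := ?\<tau> r, 7 := ?\<tau> 16)" p n] that N z unfolding e by simp
  have fin: "run (OPS [C 1 5, Z 2, Z 3, Z 4, Z 5]) ?\<tau> (if True then [\<sigma>(1 := pos r)] else []) []"
    unfolding if_True by (rule run_OPS_eq) (use z in \<open>auto simp: fun_eq_iff fun_upd_apply\<close>)
  have ty: "run (TYPE4 (OPS [C 6 3, C 7 4] ;; CMP ;; IFNZ 8 (OPS [Z 8]) Fail) Skip Skip Skip) ?\<tau> (if ?D then [?\<tau>] else []) []"
  proof (rule run_TYPE4[OF s])
    show "run (case g of CNOT a b \<Rightarrow> OPS [C 6 3, C 7 4] ;; CMP ;; IFNZ 8 (OPS [Z 8]) Fail | Hadamard a \<Rightarrow> Skip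
        | Phase a \<Rightarrow> Skip | Measure a \<Rightarrow> Skip) ?\<tau> (if ?D then [?\<tau>] else []) []"
    proof (cases g)
      case (CNOT a b)
      let ?e = "cmpf (bin a) (bin b)"
      let ?t = "?\<tau>(6 := A, 7 := Bp)"
      have ee: "?e = 0 \<longleftrightarrow> a = b" using cmpf_bin(2) AB by (auto simp: numat_def CNOT opA_def opB_def)
      have r1: "run CMP ?t [?t(6 := 0, 7 := 0, 8 := ?e)] []"
        by (rule run_CMP) (use AB z in \<open>simp_all add: CNOT opA_def opB_def\<close>)
      have r2: "run (IFNZ 8 (OPS [Z 8]) Fail) (?t(6 := 0, 7 := 0, 8 := ?e)) (if a \<noteq> b then [?\<tau>] else []) []"
      proof (cases "a = b")
        case True
        then show ?thesis using ee by (intro run_IFNZ_F) (simp_all add: run_Fail)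
      next
        case False
        have "run (OPS [Z 8]) (?t(6 := 0, 7 := 0, 8 := ?e)) [?\<tau>] []"
          by (rule run_OPS_eq) (use z in \<open>auto simp: fun_eq_iff fun_upd_apply\<close>)
        then show ?thesis using False ee by - (rule run_IFNZ_T, simp_all)
      qed
      show ?thesis using run_seq[OF r1 r2] by (auto simp: CNOT intro!: run_OPS_seq)
    qed (auto simp: run_Skip)
  qed (use z in simp_all)
  have 3: "run (TYPE4 (OPS [C 6 3, C 7 4] ;; CMP ;; IFNZ 8 (OPS [Z 8]) Fail) Skip Skip Skip ;; OPS [C 1 5, Z 2, Z 3, Z 4, Z 5])
     ?\<tau> (if ?D then [\<sigma>(1 := pos r)] else []) []"
    using run_seq_if[OF ty fin] by simp
  have 2: "run (LE ;; TYPE4 (OPS [C 6 3, C 7 4] ;; CMP ;; IFNZ 8 (OPS [Z 8]) Fail) Skip Skip Skip ;; OPS [C 1 5, Z 2, Z 3, Z 4, Z 5])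
     (?\<tau>(6 := ?\<tau> 4, 7 := ?\<tau> 16)) (if opB g \<le> n \<and> ?D then [\<sigma>(1 := pos r)] else []) []"
    by (rule run_seq_if[OF le 3]) (use AB in simp)
  have "run (LE ;; OPS [C 6 4, C 7 16] ;; LE ;; TYPE4 (OPS [C 6 3, C 7 4] ;; CMP ;; IFNZ 8 (OPS [Z 8]) Fail) Skip Skip Skip ;; OPS [C 1 5, Z 2, Z 3, Z 4, Z 5])
     (?\<tau>(6 := ?\<tau> 3, 7 := ?\<tau> 16)) (if opA g \<le> n \<and> (opB g \<le> n \<and> ?D) then [\<sigma>(1 := pos r)] else []) []"
    by (rule run_seq_if[OF le], use AB in simp, rule run_OPS_seq, simp) (use 2 in simp)
  then show ?thesis
    by - (rule run_OPS_seq, simp_all add: gate_ok_def)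
qed

text \<open>Inputs that encode no well-formed circuit lose all their branches here, so later loops
  may presuppose a gate list. The induction is on the unread suffix, as no gate list is known
  yet.\<close>

lemma run_VALIDATE:
  assumes c: "clean \<sigma>" and N: "numat (\<sigma> 16) n" and "suf l"
  shows "run (WHR 1 nend VALIDATE) (\<sigma>(1 := pos l))
    (if \<exists>gs. l = enc gs \<and> (\<forall>g \<in> set gs. gate_wf n g) then [\<sigma>(1 := pos [])] else []) []"
  using assms(3)
proof (induction "length l" arbitrary: l rule: less_induct)
  case less
  note z = cleanD[OF c]
  show ?case
  proof (cases "l = []")
    case True
    have "\<exists>gs. [] = enc gs \<and> (\<forall>g \<in> set gs. gate_wf n g)" by (rule exI[of _ "[]"]) simp
    then show ?thesis using True z read_Nil by (intro run_WHR_F) (simp_all add: cell_defs)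
  next
    case False
    then obtain a l' where "l = a # l'" by (cases l) auto
    then have ne: "nend (read_in x (pos l))" using read_Cons[of a l'] less.prems by (simp add: cell_defs)
    have goal: "run (WHR 1 nend VALIDATE) (\<sigma>(1 := pos l)) \<Omega> []" if "run (VALIDATE ;; WHR 1 nend VALIDATE) (\<sigma>(1 := pos l)) \<Omega> []" for \<Omega>
      by (rule run_WHR_T) (use that z ne in simp_all)
    from run_PARSE[OF less.prems, of "\<sigma>(1 := pos l)"] z
    consider (ok) g r A Bp where "l = enc_gate g @ r" "posg g" "suf r" "numat A (opA g)" "numat Bp (opB g)"
        "run PARSE (\<sigma>(1 := pos l)) [\<sigma>(1 := pos l, 2 := Suc (pos l), 3 := A, 4 := Bp, 5 := pos r)] []"
      | (bad) "\<nexists>g r. posg g \<and> l = enc_gate g @ r" "run PARSE (\<sigma>(1 := pos l)) [] []" by auto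
    then show ?thesis
    proof cases
      case bad
      have "\<nexists>gs. l = enc gs \<and> (\<forall>g \<in> set gs. gate_wf n g)"
      proof clarify
        fix gs assume l: "l = enc gs" "\<forall>g \<in> set gs. gate_wf n g"
        then obtain g gs' where "gs = g # gs'" using False by (cases gs) auto
        then show False using bad(1) l gate_wf_ok by auto
      qed
      moreover have "run VALIDATE (\<sigma>(1 := pos l)) [] []" unfolding VALIDATE_def by (rule run_seq_fail[OF bad(2)])
      moreover then have "run (WHR 1 nend VALIDATE) (\<sigma>(1 := pos l)) [] []" by (intro goal run_seq_fail)
      ultimately show ?thesis by (simp only: if_False)
    next
      case ok
      have vb: "run VALIDATE (\<sigma>(1 := pos l)) (if gate_ok n g then [\<sigma>(1 := pos r)] else []) []"
        unfolding VALIDATE_def by (rule run_seq[OF ok(6)]) (use run_check_gate[OF c N less.prems[unfolded ok(1)] ok(4,5)] ok(1) in simp)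
      have lt: "length r < length l" using ok(1) enc_gate_ne[of g] by simp
      have iff: "(\<exists>gs. l = enc gs \<and> (\<forall>g \<in> set gs. gate_wf n g)) \<longleftrightarrow>
          gate_ok n g \<and> (\<exists>gs. r = enc gs \<and> (\<forall>g \<in> set gs. gate_wf n g))"
      proof
        assume "\<exists>gs. l = enc gs \<and> (\<forall>g \<in> set gs. gate_wf n g)"
        then obtain gs where gs: "l = enc gs" "\<forall>g \<in> set gs. gate_wf n g" by blast
        then obtain g' gs' where "gs = g' # gs'" using False by (cases gs) auto
        moreover then have "g = g'" "r = enc gs'" using gs ok(1) enc_gate_split[of g r g' "enc gs'"] by auto
        ultimately show "gate_ok n g \<and> (\<exists>gs. r = enc gs \<and> (\<forall>g \<in> set gs. gate_wf n g))"
          using gs gate_wf_ok by auto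
      next
        assume "gate_ok n g \<and> (\<exists>gs. r = enc gs \<and> (\<forall>g \<in> set gs. gate_wf n g))"
        then obtain gs where "gate_ok n g" "r = enc gs" "\<forall>g \<in> set gs. gate_wf n g" by blast
        then show "\<exists>gs. l = enc gs \<and> (\<forall>g \<in> set gs. gate_wf n g)"
          using ok(1,2) gate_wf_ok by (intro exI[of _ "g # gs"]) auto
      qed
      show ?thesis unfolding iff by (rule goal, rule run_seq_if[OF vb]) (rule less.hyps[OF lt ok(3)])
    qed
  qed
qed

lemma run_GKPROG: "\<exists>\<Omega>. run GKPROG (\<lambda>_. 0) \<Omega> [] \<and> (odd (length \<Omega>) \<longleftrightarrow> x \<in> GK)"
proof -
  let ?s0 = "(\<lambda>_. 0)(5 := 1, 16 := 1) :: nat \<Rightarrow> nat"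
  have first: "run GKPROG (\<lambda>_. 0) \<Omega> []" if "run (PNUM ;; OPS [C 13 5, C 1 5, Z 5] ;; WHR 1 nend VALIDATE ;;
      OPS [C 1 13] ;; WHR 1 nend (PARSE ;; CHECK_MEASURE) ;; OPS [C 1 13] ;; WHR 1 nend (PARSE ;; CHECK_INIT) ;; OPS [Z 1] ;;
      Choice Skip (OPS [C 1 13, I 17] ;; SIGN) ;; OPS [C 1 13] ;; SIGN) ?s0 \<Omega> []" for \<Omega>
    unfolding GKPROG_def by (rule run_OPS_seq) (use that bigs in simp_all)
  from run_PNUM[OF suf_x(1), of ?s0] suf_x(2)
  consider (ok) n r where "n \<ge> 1" "x = bin n @ SHash # r" "suf r" "numat 1 n" "run PNUM ?s0 [?s0(5 := pos r)] []"
    | (bad) "\<nexists>q r. q \<ge> 1 \<and> x = bin q @ SHash # r" "run PNUM ?s0 [] []" by auto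
  then show ?thesis
  proof cases
    case bad
    have "x \<notin> GK" using bad(1) by (auto simp: GK_def enc_instance_def circuit_wf_def)
    then show ?thesis using first[OF run_seq_fail[OF bad(2)]] by (intro exI[of _ "[]"]) simp
  next
    case ok
    define S :: "nat \<Rightarrow> nat" where "S = (\<lambda>_. 0)(13 := pos r, 16 := 1)"
    have c: "clean S" by (simp add: clean_def S_def)
    have S: "S 13 = pos r" "S 16 = 1" "S 17 = 0" "S 18 = 0" by (simp_all add: S_def)
    have e0: "evops [C 13 5, C 1 5, Z 5] (?s0(5 := pos r)) = S(1 := pos r)"
      by (auto simp: S_def fun_eq_iff fun_upd_apply)
    have N: "numat (S 16) n" using S ok by simp
    let ?V = "\<exists>gs. r = enc gs \<and> (\<forall>g \<in> set gs. gate_wf n g)"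
    note V = run_VALIDATE[OF c N ok(3)]
    let ?rest = "OPS [C 1 13] ;; WHR 1 nend (PARSE ;; CHECK_MEASURE) ;; OPS [C 1 13] ;; WHR 1 nend (PARSE ;; CHECK_INIT) ;; OPS [Z 1] ;;
      Choice Skip (OPS [C 1 13, I 17] ;; SIGN) ;; OPS [C 1 13] ;; SIGN"
    have second: "run GKPROG (\<lambda>_. 0) \<Omega> []" if "run (WHR 1 nend VALIDATE ;; ?rest) (S(1 := pos r)) \<Omega> []" for \<Omega>
      by (rule first, rule run_seq[OF ok(5)], rule run_OPS_seq) (use that e0 in simp_all)
    show ?thesis
    proof (cases ?V)
      case False
      from V have "run (WHR 1 nend VALIDATE) (S(1 := pos r)) [] []" unfolding if_not_P[OF False] .
      from second[OF run_seq_fail[OF this]] have "run GKPROG (\<lambda>_. 0) [] []" .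
      moreover have "x \<notin> GK"
      proof
        assume "x \<in> GK"
        then obtain n' gs where n': "x = bin n' @ SHash # enc gs" "\<forall>g \<in> set gs. gate_wf n' g"
          by (auto simp: GK_def enc_instance_def circuit_wf_def enc_def)
        then have "n = n'" "r = enc gs" using ok(2) bin_split[of n r n' "enc gs"] by auto
        then show False using False n' by blast
      qed
      ultimately show ?thesis by (intro exI[of _ "[]"]) simp
    next
      case True
      then obtain gs where gs: "r = enc gs" "\<forall>g \<in> set gs. gate_wf n g" by blast
      have pg: "\<forall>g \<in> set gs. posg g" using gs gate_wf_ok by blast
      have sr: "suf (enc gs)" using ok(3) gs by simp
      have Vt: "run (WHR 1 nend VALIDATE) (S(1 := pos r)) [S(1 := pos [])] []" using V True by simp
      have M: "mode S 0 = S" "S(1 := p, 17 := 1) = (mode S 1)(1 := p)" for p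
        using S by (auto simp: mode_def fun_eq_iff fun_upd_apply)
      have p4: "run SIGN (S(1 := pos (enc gs))) (replicate (sign_cnt 0 gs) S) []"
        using run_SIGN[OF c S(3,4) _ sr pg, of 0] by (simp add: M)
      have p4': "run SIGN (S(1 := pos (enc gs), 17 := 1)) (replicate (sign_cnt 1 gs) S) []"
        unfolding M using run_SIGN[OF c S(3,4) _ sr pg, of 1] by simp
      have 1: "run (OPS [C 1 13] ;; SIGN) S (replicate (sign_cnt 0 gs) S) []"
        by (rule run_OPS_seq) (use p4 S gs in simp_all)
      have "run (OPS [C 1 13, I 17] ;; SIGN) S (replicate (sign_cnt 1 gs) S) []"
        by (rule run_OPS_seq) (use p4' S gs bigs in simp_all)
      then have 2: "run (Choice Skip (OPS [C 1 13, I 17] ;; SIGN)) S (replicate (1 + sign_cnt 1 gs) S) []"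
        by (rule run_eq[OF run_Choice_Skip[OF OPS_ne(2)]]) (rule replicate_plus_1[symmetric])
      have z1: "evops [Z 1] (S(1 := p)) = S" for p using cleanD[OF c] by (auto simp: fun_eq_iff fun_upd_apply)
      have 3: "run (OPS [Z 1] ;; Choice Skip (OPS [C 1 13, I 17] ;; SIGN) ;; OPS [C 1 13] ;; SIGN) (S(1 := pos []))
          (replicate ((1 + sign_cnt 1 gs) * sign_cnt 0 gs) S) []"
        by (rule run_OPS_seq, simp) (use run_seq_rep[OF 2 1] z1 in simp)
      have L3: "run (WHR 1 nend (PARSE ;; CHECK_INIT)) (S(1 := pos (enc gs))) (replicate (loop_cnt (m3 gs) gs) (S(1 := pos []))) []"
        by (rule run_gates[OF c sr pg]) (rule run_CHECK_INIT[OF c sr pg], use S gs in auto)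
      have c13: "evops [C 1 13] (S(1 := p)) = S(1 := pos (enc gs))" for p using S gs by (auto simp: fun_eq_iff fun_upd_apply)
      have 4: "run (OPS [C 1 13] ;; WHR 1 nend (PARSE ;; CHECK_INIT) ;; OPS [Z 1] ;; Choice Skip (OPS [C 1 13, I 17] ;; SIGN) ;; OPS [C 1 13] ;; SIGN)
         (S(1 := pos [])) (replicate (loop_cnt (m3 gs) gs * ((1 + sign_cnt 1 gs) * sign_cnt 0 gs)) S) []"
        by (rule run_OPS_seq, simp) (use run_seq_rep[OF L3 3] c13 in simp)
      have L2: "run (WHR 1 nend (PARSE ;; CHECK_MEASURE)) (S(1 := pos (enc gs))) (replicate (loop_cnt m2 gs) (S(1 := pos []))) []"
        by (rule run_gates[OF c sr pg]) (rule run_CHECK_MEASURE[OF c])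
      have 5: "run ?rest (S(1 := pos [])) (replicate (loop_cnt m2 gs * (loop_cnt (m3 gs) gs * ((1 + sign_cnt 1 gs) * sign_cnt 0 gs))) S) []"
        by (rule run_OPS_seq, simp) (use run_seq_rep[OF L2 4] c13 in simp)
      have "run GKPROG (\<lambda>_. 0) (replicate (loop_cnt m2 gs * (loop_cnt (m3 gs) gs * ((1 + sign_cnt 1 gs) * sign_cnt 0 gs))) S) []"
        by (rule second, rule run_seq[OF Vt 5])
      moreover have "odd (loop_cnt m2 gs * (loop_cnt (m3 gs) gs * ((1 + sign_cnt 1 gs) * sign_cnt 0 gs))) \<longleftrightarrow> qubit1_certainly_one gs"
      proof -
        have "CNOT a b \<in> set gs \<Longrightarrow> a \<noteq> b" for a b using gs(2) by fastforce
        from certainly_one_iff[OF this] show ?thesis using alive_loop_cnt[of gs] zero_loop_cnt[of gs gs] by auto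
      qed
      moreover have "qubit1_certainly_one gs \<longleftrightarrow> x \<in> GK"
      proof
        assume "qubit1_certainly_one gs"
        then show "x \<in> GK" using ok(1,2) gs unfolding GK_def enc_instance_def circuit_wf_def enc_def by auto
      next
        assume "x \<in> GK"
        then obtain n' gs' where n': "x = bin n' @ SHash # enc gs'" "qubit1_certainly_one gs'"
          by (auto simp: GK_def enc_instance_def enc_def)
        then have e: "enc gs' = enc gs" using ok(2) gs bin_split[of n r n' "enc gs'"] by auto
        then show "qubit1_certainly_one gs" using enc_inj n'(2) by metis
      qed
      ultimately show ?thesis by (intro exI[of _ "replicate (loop_cnt m2 gs * (loop_cnt (m3 gs) gs * ((1 + sign_cnt 1 gs) * sign_cnt 0 gs))) S"]) simp
    qed
  qed
qed

end

theorem GK_in_parityL: "GK \<in> parityL"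
proof (rule parityL_of_program[OF cok_GKPROG, of 2])
  fix x :: "sym list"
  \<comment> \<open>The width \<open>lg x\<close> only yields a weak inequality. Squaring makes it
    strict, hence the factor 2 in the width.\<close>
  have "length x + 2 < (length x + 2) * (length x + 2)" by simp
  also have "\<dots> \<le> 2 ^ lg x * 2 ^ lg x" by (rule mult_le_mono[OF two_pow_lg two_pow_lg])
  also have "\<dots> = 2 ^ (2 * lg x)" by (simp add: mult_2 power_add)
  finally interpret rec x "2 * lg x" by unfold_locales
  from run_GKPROG obtain \<Omega> where "run GKPROG (\<lambda>_. 0) \<Omega> []" "odd (length \<Omega>) \<longleftrightarrow> x \<in> GK" by blast
  then show "\<exists>os. prog.G x (2 * lg x) True [GKPROG] (\<lambda>_. 0) (x \<in> GK) os" using G_of_run by metis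
qed

declare One_nat_def [symmetric, simp del] One_nat_def [simp] fun_upd_other [simp del] fun_upd_same [simp del] fun_upd_apply [simp]

section \<open>Counting paths with CNOT circuits\<close>

text \<open>Each \<open>S1\<close> opens a component, given in unary. The leading \<open>S1\<close>
  makes the word a canonical numeral, and it can be printed component by component without ever
  computing its value.\<close>

definition name :: "nat list \<Rightarrow> sym list" where
  "name ns = concat (map (\<lambda>n. S1 # replicate n S0) ns)"

definition nid :: "nat list \<Rightarrow> nat" where "nid ns = bval (name ns)"

lemma name_simps [simp]: "name [] = []" "name (n # ns) = S1 # replicate n S0 @ name ns"
  by (auto simp: name_def)

lemma name_no_hash: "SHash \<notin> set (name ns)"
  by (induction ns) auto

lemma bin_nid: "ns \<noteq> [] \<Longrightarrow> bin (nid ns) = name ns"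
  using bin_bval name_no_hash by (cases ns) (auto simp: nid_def simp del: bval.simps)

lemma name_inj: "name xs = name ys \<Longrightarrow> xs = ys"
proof (induction xs arbitrary: ys)
  case Nil
  then show ?case by (cases ys) auto
next
  case (Cons a xs)
  have tw: "takeWhile (\<lambda>s. s = S0) (replicate n S0 @ name ns) = replicate n S0" for n ns
    by (induction n) (cases ns; simp)+
  obtain b ys' where ys: "ys = b # ys'" using Cons by (cases ys) auto
  have e: "replicate a S0 @ name xs = replicate b S0 @ name ys'" using Cons.prems ys by simp
  then have "replicate a S0 = replicate b S0" using tw by metis
  then have "a = b" by (metis length_replicate)
  then show ?case using e ys Cons.IH by simp
qed

lemma nid_inj: "nid xs = nid ys \<Longrightarrow> xs \<noteq> [] \<Longrightarrow> ys \<noteq> [] \<Longrightarrow> xs = ys"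
  using name_inj bin_nid by metis

lemma nid_pos: "ns \<noteq> [] \<Longrightarrow> nid ns \<ge> 1"
  by (cases ns) (auto simp: nid_def Suc_le_eq)

text \<open>The tested qubit thus has a name of its own, \<open>[0]\<close>, and can collect the
  accepting paths.\<close>

lemma nid_0: "nid [0] = 1"
  by (simp add: nid_def)

lemma length_name: "length (name ns) = length ns + sum_list ns"
  by (induction ns) auto

text \<open>\<open>nid [b]\<close> is \<open>2 ^ b\<close>, hence an easily printed upper bound for
  all numbers with at most \<open>b\<close> digits.\<close>

lemma nid_le: "length (name ns) \<le> b \<Longrightarrow> nid ns \<le> nid [b]"
proof -
  assume l: "length (name ns) \<le> b"
  have "nid ns < 2 ^ length (name ns)" unfolding nid_def by (rule bval_lt)
  also have "\<dots> \<le> 2 ^ b" using l by simp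
  also have "\<dots> \<le> nid [b]" by (simp add: nid_def)
  finally show ?thesis by simp
qed

definition cnots :: "(nat \<times> nat) list \<Rightarrow> gate list" where
  "cnots ps = map (\<lambda>(a, b). CNOT a b) ps"

abbreviation "cn ps q \<equiv> cnt (cnots ps) True q"

lemma cnots_simps [simp]: "cnots [] = []" "cnots ((a, b) # ps) = CNOT a b # cnots ps" "cnots (ps @ ps') = cnots ps @ cnots ps'"
  by (auto simp: cnots_def)

text \<open>CNOT gates do not mix the kinds and the base case of \<open>cnt\<close> requires Z, so
  only Z walks contribute: paths to qubit 1 in which a gate \<open>(a, b)\<close> permits a step
  from \<open>a\<close> to \<open>b\<close>.\<close>

lemma cnt_cnots_x: "cnt (cnots ps) False q = 0"
  by (induction ps arbitrary: q) auto

lemma cn_not_source: "q \<notin> fst ` set ps \<Longrightarrow> cn ps q = (if q = 1 then 1 else 0)"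
  by (induction ps) auto

text \<open>No target of the block is one of its sources, so a path uses at most one gate of the
  block and then continues in \<open>ps'\<close>.\<close>

lemma cn_append:
  assumes "\<And>a b. (a, b) \<in> set ps \<Longrightarrow> b \<notin> fst ` set ps"
  shows "cn (ps @ ps') q = cn ps' q + (\<Sum>(a, b) \<leftarrow> ps. if a = q then cn ps' b else 0)"
  using assms
proof (induction ps arbitrary: q)
  case (Cons p ps)
  obtain a b where p: "p = (a, b)" by (cases p)
  have IH: "cn (ps @ ps') q = cn ps' q + (\<Sum>(a, b) \<leftarrow> ps. if a = q then cn ps' b else 0)" for q
  proof (rule Cons.IH)
    fix a b assume "(a, b) \<in> set ps"
    then show "b \<notin> fst ` set ps" using Cons.prems[of a b] by auto
  qed
  have "b \<notin> fst ` set ps" using Cons.prems[of a b] p by auto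
  then have "(\<Sum>(a', b') \<leftarrow> ps. if a' = b then cn ps' b' else 0) = 0"
    by (induction ps) auto
  then have "cn (ps @ ps') b = cn ps' b" using IH by simp
  then show ?case using IH[of q] by (simp add: p)
qed simp

lemma cnots_silent: "alive (cnots ps)" "sign_cnt 0 (cnots ps) = 0" "sign_cnt 1 (cnots ps) = 0"
  by (induction ps) auto

text \<open>Conjugating \<open>Phase\<^sup>2 = Z\<close> by \<open>Hadamard\<close> flips the qubit \<open>z\<close>.\<close>

lemma certainly_one_cnots:
  assumes "\<And>a b. (a, b) \<in> set ps \<Longrightarrow> a \<noteq> b"
  shows "qubit1_certainly_one ([Hadamard z, Phase z, Phase z, Hadamard z] @ cnots ps) \<longleftrightarrow> odd (cn ps z)"
proof -
  let ?gs = "[Hadamard z, Phase z, Phase z, Hadamard z] @ cnots ps"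
  have x: "even (cnt ?gs False q)" for q by (auto simp: cnt_cnots_x)
  have c: "CNOT a b \<in> set ?gs \<Longrightarrow> a \<noteq> b" for a b using assms by (auto simp: cnots_def)
  have "alive ?gs" "even (sign_cnt 1 ?gs)" "odd (sign_cnt 0 ?gs) \<longleftrightarrow> odd (cn ps z)"
    using sign_cnt_2 by (simp_all add: cnots_silent cnots_silent(3)[simplified] cnt_cnots_x flip: numeral_2_eq_2)
  with certainly_one_iff[where gs = ?gs, OF c] x show ?thesis by blast
qed

section \<open>Accepting paths of bounded length\<close>

fun acc_below :: "ntm \<Rightarrow> sym list \<Rightarrow> nat \<Rightarrow> nconfig \<Rightarrow> nat" where
  "acc_below M x 0 c = 0"
| "acc_below M x (Suc u) c = (if nchoices M x c = {} then (if fst c = 1 then 1 else 0)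
     else (\<Sum>tr \<in> nchoices M x c. acc_below M x u (napply x tr c)))"

text \<open>\<open>acc_below\<close> counts accepting paths with fewer than \<open>u\<close>
  transitions, which are all of them once \<open>u\<close> exceeds every path length. Its value 0 at
  \<open>u = 0\<close> corresponds to the lowest layer, from which no gate leads on.\<close>

lemma card_apaths_acc_below:
  assumes fin: "\<And>c'. (nsucc M x)\<^sup>*\<^sup>* c c' \<Longrightarrow> finite (nchoices M x c')"
    and short: "\<And>trs. valid_path M x c trs \<Longrightarrow> length trs < u"
  shows "finite (apaths M x c) \<and> card (apaths M x c) = acc_below M x u c"
  using assms
proof (induction u arbitrary: c)
  case 0
  from 0(2)[of "[]"] show ?case by simp
next
  case (Suc u)
  show ?case
  proof (cases "nchoices M x c = {}")
    case True
    then show ?thesis by (simp add: apaths_halt)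
  next
    case False
    have IH: "finite (apaths M x (napply x tr c)) \<and> card (apaths M x (napply x tr c)) = acc_below M x u (napply x tr c)"
      if tr: "tr \<in> nchoices M x c" for tr
    proof (rule Suc.IH)
      have s: "nsucc M x c (napply x tr c)" using tr by (auto simp: nsucc_def)
      fix c' assume "(nsucc M x)\<^sup>*\<^sup>* (napply x tr c) c'"
      then show "finite (nchoices M x c')" using Suc.prems(1) s by (meson converse_rtranclp_into_rtranclp)
    next
      fix trs assume "valid_path M x (napply x tr c) trs"
      then show "length trs < u" using Suc.prems(2)[of "tr # trs"] tr by simp
    qed
    have "finite (nchoices M x c)" using Suc.prems(1) by blast
    from card_apaths_step[OF False this] IH show ?thesis using False by simp
  qed
qed

lemma valid_path_configs:
  "valid_path M x c trs \<Longrightarrow> \<exists>f. f 0 = c \<and> (\<forall>k < length trs. nsucc M x (f k) (f (Suc k)))"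
proof (induction trs arbitrary: c)
  case Nil
  then show ?case by auto
next
  case (Cons tr trs)
  then have "valid_path M x (napply x tr c) trs" by simp
  from Cons.IH[OF this] obtain f where f: "f 0 = napply x tr c" "\<forall>k < length trs. nsucc M x (f k) (f (Suc k))" by blast
  have "nsucc M x c (napply x tr c)" using Cons.prems by (auto simp: nsucc_def)
  then show ?case using f
    by (intro exI[of _ "\<lambda>k. case k of 0 \<Rightarrow> c | Suc k \<Rightarrow> f k"]) (auto split: nat.splits)
qed

lemma cycle_infinite:
  assumes f: "\<And>k. k < n \<Longrightarrow> r (f k) (f (Suc k))" and ij: "i < j" "j \<le> n" "f i = f j"
  shows "\<exists>g. g 0 = f 0 \<and> (\<forall>k. r (g k) (g (Suc k)))"
proof -
  \<comment> \<open>Follow \<open>f\<close> up to index \<open>j - 1\<close>, then return to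
    \<open>i\<close> and go round the cycle forever.\<close>
  define h where "h k = (if k < i then k else i + (k - i) mod (j - i))" for k
  have hj: "h k < j" for k using ij mod_less_divisor[of "j - i" "k - i"] unfolding h_def by (auto intro: less_diff_conv2[THEN iffD1] simp: less_diff_conv add.commute)
  have step: "f (h (Suc k)) = f (Suc (h k))" for k
  proof (cases "Suc k \<le> i")
    case True
    then show ?thesis using ij by (auto simp: h_def le_less)
  next
    case False
    then have e: "Suc k - i = Suc (k - i)" by auto
    show ?thesis
    proof (cases "Suc ((k - i) mod (j - i)) = j - i")
      case True
      then have "h (Suc k) = i" "Suc (h k) = j" using False ij by (auto simp: h_def e mod_Suc)
      then show ?thesis using ij by simp
    next
      case f: False
      then show ?thesis using False by (auto simp: h_def e mod_Suc)
    qed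
  qed
  have "h 0 = 0" using ij by (simp add: h_def)
  then show ?thesis using f hj step ij(2)
    by (intro exI[of _ "\<lambda>k. f (h k)"]) (metis less_le_trans)
qed

text \<open>Pigeonhole: a longer path repeats a configuration, and the resulting cycle contradicts
  termination.\<close>

lemma path_length_bound:
  assumes "no_inf M x c" "finite S" "\<And>c'. (nsucc M x)\<^sup>*\<^sup>* c c' \<Longrightarrow> c' \<in> S" "valid_path M x c trs"
  shows "length trs < card S"
proof (rule ccontr)
  assume l: "\<not> length trs < card S"
  obtain f where f: "f 0 = c" "\<forall>k < length trs. nsucc M x (f k) (f (Suc k))" using valid_path_configs[OF assms(4)] by blast
  have reach: "(nsucc M x)\<^sup>*\<^sup>* c (f k)" if "k \<le> length trs" for k
    using that by (induction k) (use f in \<open>auto intro: rtranclp.rtrancl_into_rtrancl\<close>)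
  have "f ` {..length trs} \<subseteq> S" using reach assms(3) by blast
  then have "card (f ` {..length trs}) \<le> card S" using assms(2) by (rule card_mono[rotated])
  then have "\<not> inj_on f {..length trs}" using l card_image[of f "{..length trs}"] by auto
  then obtain i j where "i < j" "j \<le> length trs" "f i = f j"
    unfolding inj_on_def by (metis atMost_iff linorder_neqE_nat)
  from cycle_infinite[of "length trs" "nsucc M x" f, OF _ this] f assms(1) show False unfolding no_inf_def by metis
qed

section \<open>The circuit of a machine\<close>

text \<open>The tape left of the head is a numeral with nonzero digits in base \<open>K + 1\<close>, so that it is 0 only at the left end of
  the tape, where \<open>mv Lft\<close> does not move; the tape right of the head is a numeral in base \<open>K\<close>.\<close>

fun encL :: "nat \<Rightarrow> (nat \<Rightarrow> nat) \<Rightarrow> nat \<Rightarrow> nat" where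
  "encL K t 0 = 0"
| "encL K t (Suc w) = encL K t w * Suc K + Suc (t w)"

fun encR :: "nat \<Rightarrow> (nat \<Rightarrow> nat) \<Rightarrow> nat \<Rightarrow> nat \<Rightarrow> nat" where
  "encR K t w 0 = 0"
| "encR K t w (Suc n) = t (Suc w) + K * encR K t (Suc w) n"

lemma encL_upd: "w \<le> v \<Longrightarrow> encL K (t(v := s)) w = encL K t w"
  by (induction w) auto

lemma encR_upd: "v \<le> w \<Longrightarrow> encR K (t(v := s)) w n = encR K t w n"
  by (induction n arbitrary: w) auto

lemma encL_bound: "(\<And>j. t j < K) \<Longrightarrow> encL K t w < Suc K ^ w"
proof (induction w)
  case (Suc w)
  have "Suc (encL K t w) * Suc K \<le> Suc K ^ w * Suc K" using Suc by (intro mult_le_mono) auto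
  moreover have "t w < K" using Suc by simp
  ultimately show ?case by (simp add: algebra_simps)
qed simp

lemma encR_bound: "(\<And>j. t j < K) \<Longrightarrow> encR K t w n < Suc K ^ n"
proof (induction n arbitrary: w)
  case (Suc n)
  have "encR K t (Suc w) n < Suc K ^ n" by (rule Suc.IH) (rule Suc.prems)
  then have "Suc (encR K t (Suc w) n) * Suc K \<le> Suc K ^ n * Suc K" by (intro mult_le_mono) auto
  moreover have "t (Suc w) < K" using Suc by simp
  ultimately show ?case by (simp add: algebra_simps)
qed simp

text \<open>A block \<open>(r, k, c)\<close> denotes the value \<open>k * \<sigma> r + c\<close>,
  which one countdown loop over register \<open>r\<close> can print in unary.\<close>

type_synonym block = "nat \<times> nat \<times> nat"

fun bv :: "(nat \<Rightarrow> nat) \<Rightarrow> block \<Rightarrow> nat" where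
  "bv \<sigma> (r, k, c) = k * \<sigma> r + c"

text \<open>The registers as seen by the innermost printing loop. Register 10 is the input position
  after a left move, cut off at 0.\<close>

definition env :: "nat \<Rightarrow> nat \<Rightarrow> nat \<Rightarrow> nat \<Rightarrow> nat \<Rightarrow> nat \<Rightarrow> nat \<Rightarrow> nat" where
  "env N m u Lq Rq i = (\<lambda>_. 0)(7 := m, 1 := N, 2 := u, 3 := Lq, 4 := Rq, 5 := i, 10 := i - 1)"

lemma concat_product:
  "concat (map f (List.product xs ys)) = concat (map (\<lambda>x. concat (map (\<lambda>y. f (x, y)) ys)) xs)"
  by (induction xs) (auto simp: comp_def)

lemma sum_list_concat_map: "(\<Sum>z \<leftarrow> concat (map g xs). h z) = (\<Sum>y \<leftarrow> xs. \<Sum>z \<leftarrow> g y. h z :: nat)"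
  by (induction xs) auto

lemma sum_list_single:
  assumes "distinct xs" "j \<in> set xs" "\<And>y. y \<in> set xs \<Longrightarrow> y \<noteq> j \<Longrightarrow> h y = (0 :: nat)"
  shows "(\<Sum>y \<leftarrow> xs. h y) = h j"
proof -
  have "(\<Sum>y \<leftarrow> xs. h y) = sum h (set xs)" using assms(1) by (simp add: sum_list_distinct_conv_sum_set)
  also have "\<dots> = sum h {j}" by (rule sum.mono_neutral_right) (use assms in auto)
  finally show ?thesis by simp
qed

lemma digit_div_mod: "(d :: nat) < k \<Longrightarrow> (a * k + d) div k = a \<and> (a * k + d) mod k = d"
  by simp

lemma digit_shift: "k * k * a + (d * k + s) = (k * a + d) * k + (s :: nat)"
  by (simp add: algebra_simps)

section \<open>Layers of gates for a machine\<close>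

locale red =
  fixes M :: ntm and c :: nat
  assumes wf: "ntm_wf M"
    and tm: "\<And>x. ntm_terminates M x"
    and bnd: "\<And>x cf. (nsucc M x)\<^sup>*\<^sup>* ninit cf \<Longrightarrow> logspace_bound c x (nwork_head cf)"
begin

abbreviation "K \<equiv> n_nk M"
abbreviation "Q \<equiv> n_nq M"

lemma pos_QK: "0 < Q" "0 < K"
  using wf by (auto simp: ntm_wf_def)

text \<open>An arbitrary value if the set of transitions is infinite.\<close>

definition trl :: "nat \<Rightarrow> cell \<Rightarrow> nat \<Rightarrow> (nat \<times> dir \<times> nat \<times> dir) list" where
  "trl q ce a = (SOME l. distinct l \<and> set l = n_delta M q ce a)"

lemma trl: "q < Q \<Longrightarrow> a < K \<Longrightarrow> distinct (trl q ce a) \<and> set (trl q ce a) = n_delta M q ce a"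
proof -
  assume "q < Q" "a < K"
  then have "finite (n_delta M q ce a)" using wf by (auto simp: ntm_wf_def)
  then have "\<exists>l. distinct l \<and> set l = n_delta M q ce a" using finite_distinct_list by metis
  then show ?thesis unfolding trl_def by (rule someI_ex)
qed

lemma delta_in: "q < Q \<Longrightarrow> a < K \<Longrightarrow> (q', di, s, dw) \<in> n_delta M q ce a \<Longrightarrow> q' < Q \<and> s < K"
  using wf unfolding ntm_wf_def by fast

text \<open>The last digits \<open>d\<close> and \<open>r\<close> of the two tape halves are enumerated in the finite control and the registers 3 and 4 hold
  the remaining digits, so source and target of a transition only need multiplications by constants. The register 10 is
  one less than 5. Layers are numbered backwards: a gate of layer \<open>u\<close> goes from layer \<open>u + 1\<close> to layer \<open>u\<close>.\<close>

definition srcB :: "nat \<Rightarrow> nat \<Rightarrow> nat \<Rightarrow> nat \<Rightarrow> block list" where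
  "srcB q a d r = [(2, 1, 1), (5, 1, 0), (3, Suc K, d), (4, K, r), (0, 0, q), (0, 0, a)]"

fun tgtB :: "cell \<Rightarrow> nat \<Rightarrow> nat \<Rightarrow> nat \<times> dir \<times> nat \<times> dir \<Rightarrow> block list" where
  "tgtB ce d r (q', di, s, dw) = [(2, 1, 0),
     (case di of Lft \<Rightarrow> (10, 1, 0) | Rgt \<Rightarrow> (if ce = REnd then (5, 1, 0) else (5, 1, 1)) | Stay \<Rightarrow> (5, 1, 0)),
     (case dw of Rgt \<Rightarrow> (3, Suc K * Suc K, d * Suc K + Suc s) | Lft \<Rightarrow> (if d = 0 then (3, Suc K, 0) else (3, 1, 0)) | Stay \<Rightarrow> (3, Suc K, d)),
     (case dw of Rgt \<Rightarrow> (4, 1, 0) | Lft \<Rightarrow> (if d = 0 then (4, K, r) else (4, K * K, r * K + s)) | Stay \<Rightarrow> (4, K, r)),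
     (0, 0, q'), (0, 0, (case dw of Rgt \<Rightarrow> r | Lft \<Rightarrow> (if d = 0 then s else d - 1) | Stay \<Rightarrow> s))]"

text \<open>An accepting halt is joined to qubit 1, named \<open>[0]\<close>; a rejecting halt gets
  no gate and so ends no counted path.\<close>

fun gatesAt :: "cell \<Rightarrow> nat \<times> nat \<times> nat \<times> nat \<Rightarrow> (block list \<times> block list) list" where
  "gatesAt ce (q, a, d, r) = (if trl q ce a = [] then (if q = 1 then [(srcB q a d r, [(0, 0, 0)])] else [])
     else map (\<lambda>tr. (srcB q a d r, tgtB ce d r tr)) (trl q ce a))"

definition combos :: "(nat \<times> nat \<times> nat \<times> nat) list" where
  "combos = List.product [0..<Q] (List.product [0..<K] (List.product [0..<Suc K] [0..<K]))"

definition item :: "sym list \<Rightarrow> nat \<Rightarrow> nat \<Rightarrow> nat \<times> nat \<times> nat \<times> nat \<times> nat \<times> nat \<times> nat \<Rightarrow> (nat list \<times> nat list) list" where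
  "item x N u = (\<lambda>(Lq, Rq, i, cb).
     map (\<lambda>(s, t). (map (bv (env N (length x + 2) u Lq Rq i)) s, map (bv (env N (length x + 2) u Lq Rq i)) t)) (gatesAt (read_in x i) cb))"

text \<open>The ranges are reversed because the printing loops count down and the circuit must agree
  with the printed one gate by gate.\<close>

definition idx :: "sym list \<Rightarrow> nat \<Rightarrow> (nat \<times> nat \<times> nat \<times> nat \<times> nat \<times> nat \<times> nat) list" where
  "idx x N = List.product (rev [0..<N]) (List.product (rev [0..<N]) (List.product (rev [0..<length x + 2]) combos))"

text \<open>All index tuples occur, since the printer cannot tell which configurations are
  reachable; \<open>cn_lays\<close> makes its claim for the reachable ones.\<close>

definition lay :: "sym list \<Rightarrow> nat \<Rightarrow> nat \<Rightarrow> (nat list \<times> nat list) list" where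
  "lay x N u = concat (map (item x N u) (idx x N))"

definition lays :: "sym list \<Rightarrow> nat \<Rightarrow> nat \<Rightarrow> (nat list \<times> nat list) list" where
  "lays x N u = concat (map (lay x N) (rev [0..<u]))"

abbreviation "ids ps \<equiv> map (map_prod nid nid) ps"

lemma lays_simps [simp]: "lays x N 0 = []" "lays x N (Suc u) = lay x N u @ lays x N u"
  by (auto simp: lays_def)

lemma item_src:
  "(s, t) \<in> set (item x N u (Lq, Rq, i, q, a, d, r)) \<Longrightarrow> s = [Suc u, i, Suc K * Lq + d, K * Rq + r, q, a]"
  by (auto simp: item_def srcB_def env_def split: if_splits)

lemma item_tgt:
  "(s, t) \<in> set (item x N u j) \<Longrightarrow> t = [0] \<or> (\<exists>ns. t = u # ns \<and> length ns = 5)"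
  by (cases j) (auto simp: item_def env_def split: if_splits)

lemma lay_src: "(s, t) \<in> set (lay x N u) \<Longrightarrow> \<exists>ns. s = Suc u # ns \<and> length ns = 5"
  unfolding lay_def using item_src by fastforce

lemma lay_tgt: "(s, t) \<in> set (lay x N u) \<Longrightarrow> t = [0] \<or> (\<exists>ns. t = u # ns \<and> length ns = 5)"
  unfolding lay_def using item_tgt by fastforce

lemma lays_src: "(s, t) \<in> set (lays x N u) \<Longrightarrow> \<exists>v ns. v < u \<and> s = Suc v # ns \<and> length ns = 5"
  unfolding lays_def using lay_src by fastforce

lemma not_source:
  assumes "ns \<noteq> []" "\<And>v ns'. v < u \<Longrightarrow> length ns' = 5 \<Longrightarrow> ns \<noteq> Suc v # ns'"
  shows "nid ns \<notin> fst ` set (ids (lays x N u))"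
proof
  assume "nid ns \<in> fst ` set (ids (lays x N u))"
  then obtain s t where st: "(s, t) \<in> set (lays x N u)" "nid ns = nid s" by auto
  then obtain v ns' where "v < u" "s = Suc v # ns'" "length ns' = 5" using lays_src by blast
  then show False using assms st(2) nid_inj by blast
qed

definition tp :: "sym list \<Rightarrow> nat \<Rightarrow> nconfig \<Rightarrow> nat list" where
  "tp x u = (\<lambda>(q, i, t, w). [u, i, encL K t w, encR K t w (c * lg x - w), q, t w])"

abbreviation "reach x \<equiv> (nsucc M x)\<^sup>*\<^sup>* ninit"

lemma reach_inv:
  assumes "reach x (q, i, t, w)"
  shows "q < Q \<and> i \<le> Suc (length x) \<and> w \<le> c * lg x \<and> (\<forall>j. t j < K) \<and> (\<forall>j > c * lg x. t j = 0)"
proof -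
  have w: "w' \<le> c * lg x" if "reach x (q', i', t', w')" for q' i' t' w'
    using bnd[OF that] by (simp add: logspace_bound_def lg_def)
  have "case cf of (q, i, t, w) \<Rightarrow> q < Q \<and> i \<le> Suc (length x) \<and> (\<forall>j. t j < K) \<and> (\<forall>j > c * lg x. t j = 0)"
    if "reach x cf" for cf
    using that
  proof (induction rule: rtranclp_induct)
    case base
    then show ?case using pos_QK by (simp add: ninit_def)
  next
    case (step cf cf')
    obtain q i t w where cf: "cf = (q, i, t, w)" by (cases cf)
    obtain q' di s dw where tr: "(q', di, s, dw) \<in> n_delta M q (read_in x i) (t w)" "cf' = napply x (q', di, s, dw) cf"
      using step(2) unfolding nsucc_def cf by auto
    have "q' < Q \<and> s < K" using delta_in[OF _ _ tr(1)] step.IH by (simp add: cf)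
    moreover have "w \<le> c * lg x" using w step(1) cf by blast
    ultimately show ?case using tr step.IH by (auto simp: cf move_in_def)
  qed
  from this[OF assms] w[OF assms] show ?thesis by auto
qed

lemma reach_step:
  assumes "reach x (q, i, t, w)" "tr \<in> n_delta M q (read_in x i) (t w)"
  shows "reach x (napply x tr (q, i, t, w))"
proof -
  have "nsucc M x (q, i, t, w) (napply x tr (q, i, t, w))" using assms(2) by (auto simp: nsucc_def)
  with assms(1) show ?thesis by (rule rtranclp.rtrancl_into_rtrancl)
qed

text \<open>A move of the work head passes one digit from one tape half to the other. As the halves
  are given by quotient and last digit, dropping a digit keeps the quotient and appending one is a
  multiplication by the base.\<close>

lemma tgt_correct:
  assumes re: "reach x (q, i, t, w)" and tr: "tr \<in> n_delta M q (read_in x i) (t w)"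
  defines "L \<equiv> encL K t w" and "R \<equiv> encR K t w (c * lg x - w)"
  shows "map (bv (env N m u (L div Suc K) (R div K) i)) (tgtB (read_in x i) (L mod Suc K) (R mod K) tr)
    = tp x u (napply x tr (q, i, t, w))"
proof -
  obtain q' di s dw where e: "tr = (q', di, s, dw)" by (metis prod_cases4)
  note inv = reach_inv[OF re]
  \<comment> \<open>The successor is reachable too, so it obeys the space bound; hence the right
    half still has a digit to give when the head moves right.\<close>
  have inv': "mv dw w \<le> c * lg x" using reach_inv[of x _ _ _ "mv dw w"] reach_step[OF re tr] by (auto simp: e)
  have tK: "t j < K" for j using inv by simp
  have Lm: "Suc K * (L div Suc K) + L mod Suc K = L" "K * (R div K) + R mod K = R" by (rule mult_div_mod_eq)+
  have ie: "(case di of Lft \<Rightarrow> i - 1 | Rgt \<Rightarrow> if read_in x i = REnd then i else Suc i | Stay \<Rightarrow> i) = move_in x di i"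
    using inv by (cases di) (auto simp: move_in_def read_in_def)
  have I: "bv (env N m u (L div Suc K) (R div K) i)
      (case di of Lft \<Rightarrow> (10, 1, 0) | Rgt \<Rightarrow> (if read_in x i = REnd then (5, 1, 0) else (5, 1, 1)) | Stay \<Rightarrow> (5, 1, 0)) = move_in x di i"
    unfolding ie[symmetric] by (cases di) (auto simp: env_def)
  show ?thesis
  proof (cases dw)
    case Rgt
    then have "Suc w \<le> c * lg x" using inv' by simp
    then obtain n where n: "c * lg x - w = Suc n" "c * lg x - Suc w = n" by (metis Suc_diff_Suc Suc_le_lessD)
    have R: "R = t (Suc w) + K * encR K t (Suc w) n" by (simp add: R_def n)
    have Rd: "R div K = encR K t (Suc w) n" "R mod K = t (Suc w)" using tK[of "Suc w"] by (simp_all add: R)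
    have "Suc K * Suc K * (L div Suc K) + (L mod Suc K * Suc K + Suc s) = L * Suc K + Suc s"
      using digit_shift[of "Suc K" "L div Suc K" "L mod Suc K" "Suc s"] unfolding Lm .
    then show ?thesis using I Rd n
      by (simp add: e Rgt tp_def env_def encL_upd encR_upd L_def del: mult_Suc mult_Suc_right)
  next
    case Stay
    then show ?thesis using I Lm by (simp add: e tp_def env_def encL_upd encR_upd L_def R_def del: mult_Suc mult_Suc_right)
  next
    case Lft
    show ?thesis
    proof (cases w)
      case 0
      then have "L = 0" by (simp add: L_def)
      then show ?thesis using I Lm 0 by (simp add: e Lft tp_def env_def encR_upd R_def del: mult_Suc mult_Suc_right)
    next
      case (Suc v)
      have L: "L = encL K t v * Suc K + Suc (t v)" by (simp add: L_def Suc del: mult_Suc mult_Suc_right)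
      have tv: "Suc (t v) < Suc K" using tK[of v] by simp
      have Ld: "L div Suc K = encL K t v" "L mod Suc K = Suc (t v)"
        unfolding L using digit_div_mod[OF tv, of "encL K t v"] by blast+
      obtain n where n: "c * lg x - v = Suc n" "c * lg x - Suc v = n" using inv Suc by (metis Suc_diff_Suc Suc_le_lessD)
      have "K * K * (R div K) + (R mod K * K + s) = s + K * R"
        using digit_shift[of K "R div K" "R mod K" s] unfolding Lm by (simp only: mult.commute add.commute)
      then show ?thesis using I Ld n Suc
        by (simp add: e Lft tp_def env_def encL_upd encR_upd R_def del: mult_Suc mult_Suc_right)
    qed
  qed
qed

text \<open>By uniqueness of division with remainder, all gates leaving a reachable configuration in
  layer \<open>u\<close> come from one index tuple, so the sum over the layer collapses to its
  transitions. \<open>big\<close> ensures that both tape halves lie in the loop ranges.\<close>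

lemma cn_lays:
  assumes big: "Suc K ^ (c * lg x) \<le> N" and "reach x cf"
  shows "cn (ids (lays x N u)) (nid (tp x u cf)) = acc_below M x u cf"
  using assms(2)
proof (induction u arbitrary: cf)
  case 0
  obtain q i t w where cf: "cf = (q, i, t, w)" by (cases cf)
  have "nid (tp x 0 cf) \<noteq> nid [0]" using nid_inj[of "tp x 0 cf" "[0]"] by (auto simp: tp_def cf)
  then show ?case by (simp add: nid_0)
next
  case (Suc u)
  obtain q i t w where cf: "cf = (q, i, t, w)" by (cases cf)
  have re: "reach x (q, i, t, w)" using Suc.prems by (simp add: cf)
  note inv = reach_inv[OF re]
  define L where "L = encL K t w"
  define R where "R = encR K t w (c * lg x - w)"
  define j where "j = (L div Suc K, R div K, i, q, t w, L mod Suc K, R mod K)"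
  let ?s = "tp x (Suc u) cf" and ?f = "\<lambda>b. cn (ids (lays x N u)) b"
  have s: "?s = [Suc u, i, Suc K * (L div Suc K) + L mod Suc K, K * (R div K) + R mod K, q, t w]"
    by (simp add: tp_def cf L_def R_def del: mult_Suc mult_Suc_right)
  have lt: "L < N" "R < N"
  proof -
    have "L < Suc K ^ w" "R < Suc K ^ (c * lg x - w)" unfolding L_def R_def using encL_bound encR_bound inv by blast+
    moreover have "Suc K ^ w \<le> Suc K ^ (c * lg x)" "Suc K ^ (c * lg x - w) \<le> Suc K ^ (c * lg x)"
      using inv by (intro power_increasing; simp)+
    ultimately show "L < N" "R < N" using big by linarith+
  qed
  have jin: "j \<in> set (idx x N)"
  proof -
    have "L div Suc K < N" "R div K < N" using lt div_le_dividend le_less_trans by blast+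
    moreover have "L mod Suc K < Suc K" "R mod K < K" using pos_QK by (auto intro: mod_less_divisor)
    ultimately show ?thesis using inv by (simp add: j_def idx_def combos_def del: upt_Suc)
  qed
  have dist: "distinct (idx x N)" unfolding idx_def combos_def by (intro distinct_product) simp_all
  have uniq: "y = j" if y: "y \<in> set (idx x N)" "(?s, b) \<in> set (item x N u y)" for y b
  proof -
    obtain Lq Rq i' q' a d r where ye: "y = (Lq, Rq, i', q', a, d, r)" by (metis prod_cases7)
    have b: "d < Suc K" "r < K" using y(1) by (simp_all add: ye idx_def combos_def del: upt_Suc)
    have e: "?s = [Suc u, i', Suc K * Lq + d, K * Rq + r, q', a]" using item_src y(2) ye by blast
    then have "Suc K * Lq + d = L" "K * Rq + r = R" "i' = i" "q' = q" "a = t w"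
      unfolding s by (simp_all del: mult_Suc mult_Suc_right)
    moreover have "(Suc K * Lq + d) div Suc K = Lq" "(Suc K * Lq + d) mod Suc K = d" "(K * Rq + r) div K = Rq" "(K * Rq + r) mod K = r"
      using digit_div_mod[OF b(1), of Lq] digit_div_mod[OF b(2), of Rq] by (simp_all only: mult.commute)
    ultimately show ?thesis by (simp add: ye j_def)
  qed
  \<comment> \<open>Sources of this layer begin with \<open>Suc u\<close>, targets begin with
    \<open>u\<close> or are \<open>[0]\<close>; so no gate of the layer feeds another, as
    \<open>cn_append\<close> requires.\<close>
  have tg: "b \<notin> fst ` set (ids (lay x N u))" if ab: "(a, b) \<in> set (ids (lay x N u))" for a b
  proof
    assume "b \<in> fst ` set (ids (lay x N u))"
    then obtain s' t' where s': "(s', t') \<in> set (lay x N u)" "b = nid s'" by auto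
    obtain s1 t1 where t1: "(s1, t1) \<in> set (lay x N u)" "b = nid t1" using ab by auto
    have "t1 = s'" using s' t1 nid_inj[of t1 s'] lay_src[OF s'(1)] lay_tgt[OF t1(1)] by force
    then show False using lay_src[OF s'(1)] lay_tgt[OF t1(1)] by auto
  qed
  \<comment> \<open>A path cannot skip the layer: this qubit is no source in the lower layers and is
    not qubit 1.\<close>
  have z: "?f (nid ?s) = 0"
  proof -
    have "nid ?s \<notin> fst ` set (ids (lays x N u))" by (rule not_source) (auto simp: s)
    moreover have "nid ?s \<noteq> 1" unfolding nid_0[symmetric] using nid_inj[of ?s "[0]"] by (auto simp: s)
    ultimately show ?thesis using cn_not_source by simp
  qed
  have one: "?f (nid [0]) = 1"
  proof -
    have "nid [0] \<notin> fst ` set (ids (lays x N u))" by (rule not_source) auto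
    then show ?thesis using cn_not_source nid_0 by simp
  qed
  have inj: "nid a = nid ?s \<longleftrightarrow> a = ?s" if "(a, b) \<in> set (lay x N u)" for a b
    using nid_inj[of a ?s] lay_src[OF that] by (auto simp: s)
  have "cn (ids (lays x N (Suc u))) (nid ?s) = (\<Sum>(a, b) \<leftarrow> ids (lay x N u). if a = nid ?s then ?f b else 0)"
    using cn_append[where ps = "ids (lay x N u)" and ps' = "ids (lays x N u)" and q = "nid ?s", OF tg] z by simp
  also have "\<dots> = (\<Sum>(a, b) \<leftarrow> lay x N u. if a = ?s then ?f (nid b) else 0)"
    unfolding map_map by (rule arg_cong[of _ _ sum_list], rule map_cong[OF refl]) (use inj in auto)
  also have "\<dots> = (\<Sum>y \<leftarrow> idx x N. \<Sum>(a, b) \<leftarrow> item x N u y. if a = ?s then ?f (nid b) else 0)"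
    unfolding lay_def by (rule sum_list_concat_map)
  also have "\<dots> = (\<Sum>(a, b) \<leftarrow> item x N u j. if a = ?s then ?f (nid b) else 0)"
    by (rule sum_list_single[OF dist jin]) (use uniq in \<open>auto intro!: sum_list_0\<close>)
  also have "\<dots> = (\<Sum>(a, b) \<leftarrow> item x N u j. ?f (nid b))"
    by (rule arg_cong[of _ _ sum_list], rule map_cong[OF refl])
      (use item_src[of _ _ x N u "L div Suc K" "R div K" i q "t w" "L mod Suc K" "R mod K"] s in \<open>auto simp: j_def\<close>)
  also have "\<dots> = acc_below M x (Suc u) cf"
  proof -
    have tl: "distinct (trl q (read_in x i) (t w))" "set (trl q (read_in x i) (t w)) = n_delta M q (read_in x i) (t w)"
      using trl inv by auto
    have nc: "nchoices M x cf = n_delta M q (read_in x i) (t w)" by (simp add: cf)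
    show ?thesis
    proof (cases "trl q (read_in x i) (t w) = []")
      case True
      then show ?thesis using tl(2) one by (auto simp: nc cf item_def j_def)
    next
      case False
      have st: "?f (nid (map (bv (env N (length x + 2) u (L div Suc K) (R div K) i)) (tgtB (read_in x i) (L mod Suc K) (R mod K) tr)))
          = acc_below M x u (napply x tr cf)" if "tr \<in> set (trl q (read_in x i) (t w))" for tr
        using tgt_correct[OF re, of tr] Suc.IH[of "napply x tr cf"] reach_step[OF re, of tr] that tl(2)
        by (simp only: L_def R_def cf)
      have "(\<Sum>(a, b) \<leftarrow> item x N u j. ?f (nid b)) = (\<Sum>tr \<leftarrow> trl q (read_in x i) (t w). acc_below M x u (napply x tr cf))"
        using False st by (simp add: item_def j_def comp_def cong: map_cong del: tgtB.simps)
      also have "\<dots> = (\<Sum>tr \<in> nchoices M x cf. acc_below M x u (napply x tr cf))"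
        unfolding nc tl(2)[symmetric] using tl(1) by (simp add: sum_list_distinct_conv_sum_set)
      finally show ?thesis using False tl(2) nc by (auto simp del: nchoices.simps)
    qed
  qed
  finally show ?case .
qed

end

section \<open>The reduction program\<close>

fun SEQ :: "com list \<Rightarrow> com" where
  "SEQ [] = Skip"
| "SEQ (c # cs) = c ;; SEQ cs"

definition "OUTS ss = SEQ (map Out ss)"
definition "LOOP r s a = OPS [C r s] ;; WHNZ r (DEC r ;; a)"

fun BLK :: "block \<Rightarrow> com" where
  "BLK (r, k, c) = Out S1 ;; LOOP 6 r (OUTS (replicate k S0)) ;; OUTS (replicate c S0)"

definition "NAME bs = SEQ (map BLK bs)"

fun EMIT :: "block list \<times> block list \<Rightarrow> com" where
  "EMIT (s, t) = OUTS [S0, S0, SHash] ;; NAME s ;; Out SHash ;; NAME t ;; Out SHash"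

text \<open>\<open>f\<close> gives one program per cell content, chosen by finite case distinction,
  so the transition table of \<open>M\<close> is evaluated when the program is built.\<close>

definition "BRC r f = BR r (\<lambda>c. c = LEnd) (f LEnd) (BR r (\<lambda>c. c = REnd) (f REnd)
  (BR r (\<lambda>c. c = Sym S0) (f (Sym S0)) (BR r (\<lambda>c. c = Sym S1) (f (Sym S1)) (f (Sym SHash)))))"

definition "LEN = WHR 7 nend (OPS [I 7]) ;; OPS [I 7]"
definition "MUL = OPS [C 8 1, Z 1] ;; WHNZ 8 (DEC 8 ;; LOOP 9 7 (OPS [I 1]))"

lemma cok_SEQ: "cok n (SEQ cs) = (\<forall>c \<in> set cs. cok n c)"
  by (induction cs) auto

lemma cok_print:
  assumes "11 \<le> n"
  shows "cok n (OUTS ss)" "cok n (BLK b)" "cok n (NAME bs)" "cok n (EMIT p)"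
proof -
  show O: "cok n (OUTS ss)" for ss by (auto simp: OUTS_def cok_SEQ)
  have B: "cok n (BLK b)" for b using O assms by (cases b) (simp add: LOOP_def cok_OPS)
  then show "cok n (BLK b)" .
  have N: "cok n (NAME bs)" for bs using B by (auto simp: NAME_def cok_SEQ)
  then show "cok n (NAME bs)" .
  show "cok n (EMIT p)" using O N by (cases p) simp
qed

lemma concat_map_Nil: "concat (map (\<lambda>_. []) xs) = []"
  by (induction xs) auto

lemma sum_list_le: "(\<And>n. n \<in> set ns \<Longrightarrow> n \<le> b) \<Longrightarrow> sum_list ns \<le> length ns * (b :: nat)"
  by (induction ns) (auto simp: add_mono)

lemma concat_map_concat: "concat (map f (concat (map g xs))) = concat (map (\<lambda>x. concat (map f (g x))) xs)"
  by (induction xs) auto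

context prog
begin

lemma run_SEQ_map:
  "(\<And>y. y \<in> set ys \<Longrightarrow> run (f y) \<sigma> [\<sigma>] (h y)) \<Longrightarrow> run (SEQ (map f ys)) \<sigma> [\<sigma>] (concat (map h ys))"
proof (induction ys)
  case Nil
  then show ?case by (simp add: run_Skip)
next
  case (Cons y ys)
  have "run (f y) \<sigma> [\<sigma>] (h y)" "run (SEQ (map f ys)) \<sigma> [\<sigma>] (concat (map h ys))" using Cons by auto
  then show ?case using run_seq_out by fastforce
qed

lemma run_OUTS: "run (OUTS ss) \<sigma> [\<sigma>] ss"
proof -
  have "run (OUTS ss) \<sigma> [\<sigma>] (concat (map (\<lambda>s. [s]) ss))"
    unfolding OUTS_def by (rule run_SEQ_map) (rule run_Out)
  moreover have "concat (map (\<lambda>s. [s]) ss) = ss" by (induction ss) auto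
  ultimately show ?thesis by simp
qed

text \<open>\<open>S k\<close> is the state with \<open>k\<close> rounds left, so the outputs appear
  in decreasing order of \<open>k\<close>.\<close>

lemma run_WHNZ_loop:
  assumes "\<And>k. k < n \<Longrightarrow> run (DEC r ;; a) (S (Suc k)) [S k] (h k)" "\<And>k. k < n \<Longrightarrow> S (Suc k) r \<noteq> 0" "S 0 r = 0"
  shows "run (WHNZ r (DEC r ;; a)) (S n) [S 0] (concat (map h (rev [0..<n])))"
  using assms(1,2)
proof (induction n)
  case 0
  show ?case by (rule run_WHNZ) (simp add: assms(3) run_Skip)
next
  case (Suc n)
  have 1: "run (DEC r ;; a) (S (Suc n)) [S n] (h n)" "S (Suc n) r \<noteq> 0" using Suc.prems by auto
  have 2: "run (WHNZ r (DEC r ;; a)) (S n) [S 0] (concat (map h (rev [0..<n])))" using Suc by auto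
  have "run ((DEC r ;; a) ;; WHNZ r (DEC r ;; a)) (S (Suc n)) [S 0] (concat (map h (rev [0..<Suc n])))"
    by (rule run_seq_out[OF 1(1) 2]) simp
  then show ?case using 1(2) by - (rule run_WHNZ, simp)
qed

lemma run_LOOP:
  assumes "\<sigma> r = 0" "r \<noteq> s" "\<And>k. k < \<sigma> s \<Longrightarrow> run a (\<sigma>(r := k)) [\<sigma>(r := k)] (h k)"
  shows "run (LOOP r s a) \<sigma> [\<sigma>] (concat (map h (rev [0..<\<sigma> s])))"
  unfolding LOOP_def
proof (rule run_OPS_seq)
  have "run (WHNZ r (DEC r ;; a)) (\<sigma>(r := \<sigma> s)) [\<sigma>(r := 0)] (concat (map h (rev [0..<\<sigma> s])))"
  proof (rule run_WHNZ_loop)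
    fix k assume k: "k < \<sigma> s"
    have "run (DEC r) (\<sigma>(r := Suc k)) [\<sigma>(r := k)] []" using run_DEC[of "\<sigma>(r := Suc k)" r] by simp
    then show "run (DEC r ;; a) (\<sigma>(r := Suc k)) [\<sigma>(r := k)] (h k)" using assms(3)[OF k] run_seq by blast
  qed auto
  then show "run (WHNZ r (DEC r ;; a)) (evops [C r s] \<sigma>) [\<sigma>] (concat (map h (rev [0..<\<sigma> s])))"
    using assms(1) by (simp add: fun_upd_idem)
qed simp

lemma run_BLK:
  assumes "\<sigma> 6 = 0" "fst b \<noteq> 6"
  shows "run (BLK b) \<sigma> [\<sigma>] (S1 # replicate (bv \<sigma> b) S0)"
proof -
  obtain r k c where b: "b = (r, k, c)" by (cases b)
  have "run (LOOP 6 r (OUTS (replicate k S0))) \<sigma> [\<sigma>] (concat (map (\<lambda>_. replicate k S0) (rev [0..<\<sigma> r])))"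
    by (rule run_LOOP) (use assms in \<open>auto simp: b run_OUTS\<close>)
  moreover have "concat (map (\<lambda>_. replicate k S0) (rev [0..<n])) = replicate (k * n) S0" for n
    by (induction n) (simp_all add: replicate_add)
  ultimately have "run (LOOP 6 r (OUTS (replicate k S0))) \<sigma> [\<sigma>] (replicate (k * \<sigma> r) S0)" by simp
  then have "run (LOOP 6 r (OUTS (replicate k S0)) ;; OUTS (replicate c S0)) \<sigma> [\<sigma>] (replicate (k * \<sigma> r + c) S0)"
    by (rule run_seq_out[OF _ run_OUTS]) (simp add: replicate_add)
  then show ?thesis using run_seq_out[OF run_Out] by (simp add: b)
qed

lemma run_NAME:
  assumes "\<sigma> 6 = 0" "\<And>b. b \<in> set bs \<Longrightarrow> fst b \<noteq> 6"
  shows "run (NAME bs) \<sigma> [\<sigma>] (name (map (bv \<sigma>) bs))"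
proof -
  have "run (NAME bs) \<sigma> [\<sigma>] (concat (map (\<lambda>b. S1 # replicate (bv \<sigma> b) S0) bs))"
    unfolding NAME_def by (rule run_SEQ_map) (use assms run_BLK in auto)
  then show ?thesis by (simp add: name_def comp_def)
qed

definition okB :: "block list \<Rightarrow> bool" where "okB bs \<longleftrightarrow> bs \<noteq> [] \<and> (\<forall>b \<in> set bs. fst b \<noteq> 6)"

lemma run_EMIT:
  assumes "\<sigma> 6 = 0" "okB s" "okB t"
  shows "run (EMIT (s, t)) \<sigma> [\<sigma>] (enc_gate (CNOT (nid (map (bv \<sigma>) s)) (nid (map (bv \<sigma>) t))))"
proof -
  have n: "run (NAME s) \<sigma> [\<sigma>] (name (map (bv \<sigma>) s))" "run (NAME t) \<sigma> [\<sigma>] (name (map (bv \<sigma>) t))"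
    using run_NAME assms by (auto simp: okB_def)
  have "run (EMIT (s, t)) \<sigma> [\<sigma>] ([S0, S0, SHash] @ name (map (bv \<sigma>) s) @ [SHash] @ name (map (bv \<sigma>) t) @ [SHash])"
    unfolding EMIT.simps
    by (rule run_seq_out[OF run_OUTS run_seq_out[OF n(1) run_seq_out[OF run_Out run_seq_out[OF n(2) run_Out refl] refl] refl] refl])
  then show ?thesis using assms by (simp add: bin_nid okB_def)
qed

lemma run_BRC:
  assumes "\<sigma> 0 = 0" "run (f (read_in x (\<sigma> r))) \<sigma> \<Omega> os"
  shows "run (BRC r f) \<sigma> \<Omega> os"
  unfolding BRC_def
proof -
  let ?c = "read_in x (\<sigma> r)"
  have 4: "run (BR r (\<lambda>c. c = Sym S1) (f (Sym S1)) (f (Sym SHash))) \<sigma> \<Omega> os" if "?c = Sym S1 \<or> ?c = Sym SHash"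
    by (rule run_BR, rule assms(1)) (use assms(2) that in auto)
  have 3: "run (BR r (\<lambda>c. c = Sym S0) (f (Sym S0)) (BR r (\<lambda>c. c = Sym S1) (f (Sym S1)) (f (Sym SHash)))) \<sigma> \<Omega> os"
    if ex: "\<exists>s. ?c = Sym s"
  proof (rule run_BR, rule assms(1))
    obtain s where "?c = Sym s" using ex by blast
    then show "run (if ?c = Sym S0 then f (Sym S0) else BR r (\<lambda>c. c = Sym S1) (f (Sym S1)) (f (Sym SHash))) \<sigma> \<Omega> os"
      using 4 assms(2) by (cases s) auto
  qed
  have 2: "run (BR r (\<lambda>c. c = REnd) (f REnd) (BR r (\<lambda>c. c = Sym S0) (f (Sym S0)) (BR r (\<lambda>c. c = Sym S1) (f (Sym S1)) (f (Sym SHash))))) \<sigma> \<Omega> os"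
    if "?c \<noteq> LEnd"
  proof (rule run_BR, rule assms(1))
    show "run (if ?c = REnd then f REnd else BR r (\<lambda>c. c = Sym S0) (f (Sym S0)) (BR r (\<lambda>c. c = Sym S1) (f (Sym S1)) (f (Sym SHash)))) \<sigma> \<Omega> os"
      using 3 assms(2) that by (cases ?c) auto
  qed
  show "run (BR r (\<lambda>c. c = LEnd) (f LEnd) (BR r (\<lambda>c. c = REnd) (f REnd)
      (BR r (\<lambda>c. c = Sym S0) (f (Sym S0)) (BR r (\<lambda>c. c = Sym S1) (f (Sym S1)) (f (Sym SHash)))))) \<sigma> \<Omega> os"
    by (rule run_BR, rule assms(1)) (use 2 assms(2) in auto)
qed

lemma run_LEN:
  assumes "length x + 2 < 2 ^ B"
  shows "run LEN (\<lambda>_. 0) [(\<lambda>_. 0)(7 := length x + 2)] []"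
proof -
  let ?S = "\<lambda>k. (\<lambda>_. 0)(7 := k) :: nat \<Rightarrow> nat"
  have "run (WHR 7 nend (OPS [I 7])) (?S k) [?S (Suc (length x))] []" if "k \<le> Suc (length x)" for k
    using that
  proof (induction "Suc (length x) - k" arbitrary: k)
    case 0
    then show ?case by (intro run_WHR_F) (auto simp: nend_def read_in_def)
  next
    case (Suc n)
    have ih: "run (WHR 7 nend (OPS [I 7])) (?S (Suc k)) [?S (Suc (length x))] []" by (rule Suc) (use Suc in auto)
    have "run (OPS [I 7] ;; WHR 7 nend (OPS [I 7])) (?S k) [?S (Suc (length x))] []"
      by (rule run_OPS_seq) (use ih Suc assms in auto)
    moreover have "nend (read_in x (?S k 7))" using Suc by (auto simp: nend_def read_in_def)
    ultimately show ?case by - (rule run_WHR_T, auto)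
  qed
  from this[of 0] have w: "run (WHR 7 nend (OPS [I 7])) (\<lambda>_. 0) [?S (Suc (length x))] []" by (simp add: fun_upd_idem)
  have "run (OPS [I 7]) (?S (Suc (length x))) [?S (length x + 2)] []" by (rule run_OPS_eq) (use assms in auto)
  with w show ?thesis unfolding LEN_def by (rule run_seq)
qed

lemma run_MUL:
  assumes "n * m < 2 ^ B"
  shows "run MUL ((\<lambda>_. 0)(7 := m, 1 := n)) [(\<lambda>_. 0)(7 := m, 1 := n * m)] []"
proof -
  define S :: "nat \<Rightarrow> nat \<Rightarrow> nat \<Rightarrow> nat \<Rightarrow> nat" where "S v a b = (\<lambda>_. 0)(7 := m, 1 := v, 8 := a, 9 := b)" for v a b
  have inner: "run (LOOP 9 7 (OPS [I 1])) (S v a 0) [S (v + m) a 0] []" if "v + m < 2 ^ B" for v a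
  proof -
    have "run (WHNZ 9 (DEC 9 ;; OPS [I 1])) (S (v + (m - m)) a m) [S (v + (m - 0)) a 0] (concat (map (\<lambda>_. []) (rev [0..<m])))"
    proof (rule run_WHNZ_loop[where S = "\<lambda>k. S (v + (m - k)) a k"])
      fix k assume k: "k < m"
      have "run (DEC 9) (S (v + (m - Suc k)) a (Suc k)) [S (v + (m - Suc k)) a k] []"
        using run_DEC[of "S (v + (m - Suc k)) a (Suc k)" 9] by (simp add: S_def)
      moreover have "run (OPS [I 1]) (S (v + (m - Suc k)) a k) [S (v + (m - k)) a k] []"
        by (rule run_OPS_eq) (use k that in \<open>auto simp: S_def fun_eq_iff Suc_diff_Suc\<close>)
      ultimately show "run (DEC 9 ;; OPS [I 1]) (S (v + (m - Suc k)) a (Suc k)) [S (v + (m - k)) a k] []" by (rule run_seq)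
    qed (auto simp: S_def)
    moreover have "evops [C 9 7] (S v a 0) = S v a m" by (auto simp: S_def fun_eq_iff)
    ultimately show ?thesis unfolding LOOP_def by (intro run_OPS_seq) (simp_all add: concat_map_Nil)
  qed
  have "run (WHNZ 8 (DEC 8 ;; LOOP 9 7 (OPS [I 1]))) (S ((n - n) * m) n 0) [S ((n - 0) * m) 0 0] (concat (map (\<lambda>_. []) (rev [0..<n])))"
  proof (rule run_WHNZ_loop[where S = "\<lambda>k. S ((n - k) * m) k 0"])
    fix k assume k: "k < n"
    have e: "(n - Suc k) * m + m = (n - k) * m" using k by (metis Suc_diff_Suc add.commute mult_Suc)
    have "(n - k) * m \<le> n * m" by simp
    then have b: "(n - Suc k) * m + m < 2 ^ B" using assms e by linarith
    have "run (DEC 8) (S ((n - Suc k) * m) (Suc k) 0) [S ((n - Suc k) * m) k 0] []"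
      using run_DEC[of "S ((n - Suc k) * m) (Suc k) 0" 8] by (simp add: S_def fun_upd_twist)
    from run_seq[OF this inner[OF b]]
    show "run (DEC 8 ;; LOOP 9 7 (OPS [I 1])) (S ((n - Suc k) * m) (Suc k) 0) [S ((n - k) * m) k 0] []" unfolding e .
  qed (auto simp: S_def)
  moreover have "evops [C 8 1, Z 1] ((\<lambda>_. 0)(7 := m, 1 := n)) = S 0 n 0" by (auto simp: S_def fun_eq_iff)
  moreover have "S (n * m) 0 0 = (\<lambda>_. 0)(7 := m, 1 := n * m)" by (auto simp: S_def fun_eq_iff)
  ultimately show ?thesis unfolding MUL_def by (intro run_OPS_seq) (simp_all add: concat_map_Nil)
qed

lemma run_POW:
  assumes "n * m ^ e < 2 ^ B" "0 < m"
  shows "run (SEQ (replicate e MUL)) ((\<lambda>_. 0)(7 := m, 1 := n)) [(\<lambda>_. 0)(7 := m, 1 := n * m ^ e)] []"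
  using assms(1)
proof (induction e arbitrary: n)
  case 0
  then show ?case by (simp add: run_Skip)
next
  case (Suc e)
  have "n * m * 1 \<le> n * m * m ^ e" using assms(2) by (intro mult_le_mono) auto
  then have b: "n * m < 2 ^ B" using Suc.prems le_less_trans[of "n * m" "n * m * m ^ e" "2 ^ B"] by (simp add: mult.assoc)
  have "run (SEQ (replicate e MUL)) ((\<lambda>_. 0)(7 := m, 1 := n * m)) [(\<lambda>_. 0)(7 := m, 1 := n * m * m ^ e)] []"
    by (rule Suc.IH) (use Suc.prems in \<open>simp add: mult.assoc\<close>)
  from run_seq[OF run_MUL[OF b] this] show ?case
    by (simp only: replicate_Suc SEQ.simps power_Suc mult.assoc)
qed

end

section \<open>The reduction: printing, size bounds and correctness\<close>

context red
begin

definition "BODY ce = SEQ (map (\<lambda>cb. SEQ (map EMIT (gatesAt ce cb))) combos)"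
text \<open>The scan of \<open>DEC\<close> does not end on a zero register, hence the test; register
  10 becomes the truncated predecessor of register 5.\<close>

definition "INNER = OPS [C 10 5] ;; IFNZ 10 (DEC 10) Skip ;; BRC 5 BODY ;; OPS [Z 10]"
definition "NEST = LOOP 2 1 (LOOP 3 1 (LOOP 4 1 (LOOP 5 7 INNER)))"
text \<open>With \<open>m = length x + 2\<close>, the exponents bound the factors of the
  configuration count: \<open>Q\<close> for states, 1 for input positions, \<open>2 * c\<close> for
  work head positions, \<open>2 * K * c + K\<close> for tapes.\<close>

definition "EXP = Q + 1 + 2 * c + 2 * K * c + K"
text \<open>Bounds every coefficient and every constant in a block: up to two tape digits, or a
  state.\<close>

definition "DD = Suc K * Suc K + Q"
text \<open>A name has six blocks, each an \<open>S1\<close> and at most \<open>DD * N + DD\<close>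
  further symbols, which for \<open>N \<ge> 1\<close> totals at most
  \<open>6 * N + 12 * DD * N\<close>.\<close>

definition "CC = 12 * DD + 6"
definition "ZN = NAME [(1, 1, 0), (0, 0, 0), (0, 0, 0), (0, 0, 0), (0, 0, 0), (0, 0, 0)] ;; Out SHash"
text \<open>The announced number of qubits, \<open>2 ^ (CC * N)\<close>, is exponential, but its
  numeral has polynomial length and only polynomially many qubits are touched.\<close>

definition "REDPROG = LEN ;; OPS [I 1] ;; SEQ (replicate EXP MUL) ;; BLK (1, CC, 0) ;; Out SHash ;;
  OUTS [S0, S1, SHash] ;; ZN ;; OUTS [S1, S0, SHash] ;; ZN ;; OUTS [S1, S0, SHash] ;; ZN ;; OUTS [S0, S1, SHash] ;; ZN ;; NEST"

lemma cok_REDPROG: "cok 11 REDPROG"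
proof -
  have b: "cok 11 (BODY ce)" for ce using cok_print(4)[of 11] by (auto simp: BODY_def cok_SEQ)
  show ?thesis
    by (simp add: REDPROG_def NEST_def INNER_def BRC_def LOOP_def LEN_def MUL_def ZN_def cok_OPS cok_SEQ cok_print b del: BLK.simps)
qed

definition bigN :: "sym list \<Rightarrow> nat" where "bigN x = (length x + 2) ^ EXP"

definition redf :: "sym list \<Rightarrow> sym list" where
  "redf x = (let N = bigN x; z = nid [N, 0, 0, 0, 0, 0] in
     enc_instance (nid [CC * N]) ([Hadamard z, Phase z, Phase z, Hadamard z] @ cnots (ids (lays x N N))))"

lemma okB_gates: "(s, t) \<in> set (gatesAt ce cb) \<Longrightarrow> prog.okB s \<and> prog.okB t"
  by (cases cb) (auto simp: prog.okB_def srcB_def split: if_splits dir.splits)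

lemma run_REDPROG:
  assumes "length x + 2 < 2 ^ B" "bigN x < 2 ^ B"
  shows "\<exists>\<sigma>. prog.run x B nd REDPROG (\<lambda>_. 0) [\<sigma>] (redf x)"
proof -
  interpret prog x B nd .
  let ?m = "length x + 2" and ?N = "bigN x"
  define \<sigma> :: "nat \<Rightarrow> nat" where "\<sigma> = (\<lambda>_. 0)(7 := ?m, 1 := ?N)"
  define enco where "enco = (\<lambda>(s, t). enc_gate (CNOT (nid s) (nid t)))"
  have body: "run (BODY (read_in x i)) (env ?N ?m u Lq Rq i) [env ?N ?m u Lq Rq i]
      (concat (map (\<lambda>cb. concat (map enco (item x ?N u (Lq, Rq, i, cb)))) combos))" for u Lq Rq i
    unfolding BODY_def
  proof (rule run_SEQ_map)
    fix cb
    let ?e = "env ?N ?m u Lq Rq i"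
    have "run (SEQ (map EMIT (gatesAt (read_in x i) cb))) ?e [?e]
      (concat (map (\<lambda>(s, t). enc_gate (CNOT (nid (map (bv ?e) s)) (nid (map (bv ?e) t)))) (gatesAt (read_in x i) cb)))"
    proof (rule run_SEQ_map)
      fix p assume p: "p \<in> set (gatesAt (read_in x i) cb)"
      obtain s t where st: "p = (s, t)" by (cases p)
      show "run (EMIT p) ?e [?e] (case p of (s, t) \<Rightarrow> enc_gate (CNOT (nid (map (bv ?e) s)) (nid (map (bv ?e) t))))"
        unfolding st prod.case by (rule run_EMIT) (use okB_gates p st in \<open>auto simp: env_def\<close>)
    qed
    moreover have "map (\<lambda>(s, t). enc_gate (CNOT (nid (map (bv ?e) s)) (nid (map (bv ?e) t)))) (gatesAt (read_in x i) cb)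
        = map enco (item x ?N u (Lq, Rq, i, cb))"
      unfolding item_def enco_def prod.case map_map by (rule map_cong[OF refl]) (simp add: case_prod_beta)
    ultimately show "run (SEQ (map EMIT (gatesAt (read_in x i) cb))) ?e [?e] (concat (map enco (item x ?N u (Lq, Rq, i, cb))))"
      by (simp only:)
  qed
  have inner: "run INNER (\<sigma>(2 := u, 3 := Lq, 4 := Rq, 5 := i)) [\<sigma>(2 := u, 3 := Lq, 4 := Rq, 5 := i)]
      (concat (map (\<lambda>cb. concat (map enco (item x ?N u (Lq, Rq, i, cb)))) combos))" for u Lq Rq i
  proof -
    let ?s = "\<sigma>(2 := u, 3 := Lq, 4 := Rq, 5 := i)"
    have e: "?s(10 := i - 1) = env ?N ?m u Lq Rq i" by (simp add: env_def \<sigma>_def)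
    have "run (IFNZ 10 (DEC 10) Skip) (?s(10 := i)) [?s(10 := i - 1)] []"
      using run_DEC[of "?s(10 := i)" 10] run_Skip[of "?s(10 := i)"] by (intro run_IFNZ) auto
    then have i: "run (IFNZ 10 (DEC 10) Skip) (?s(10 := i)) [env ?N ?m u Lq Rq i] []" unfolding e .
    have b: "run (BRC 5 BODY) (env ?N ?m u Lq Rq i) [env ?N ?m u Lq Rq i]
      (concat (map (\<lambda>cb. concat (map enco (item x ?N u (Lq, Rq, i, cb)))) combos))"
      by (rule run_BRC) (use body in \<open>simp_all add: env_def\<close>)
    have o: "run (OPS [Z 10]) (env ?N ?m u Lq Rq i) [?s] []"
      by (rule run_OPS_eq) (auto simp: env_def \<sigma>_def fun_eq_iff)
    show ?thesis unfolding INNER_def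
      by (rule run_OPS_seq, simp) (use run_seq[OF i run_seq_out[OF b o refl]] in simp)
  qed
  have nest: "run NEST \<sigma> [\<sigma>] (concat (map enco (lays x ?N ?N)))"
  proof -
    have "run NEST \<sigma> [\<sigma>] (concat (map (\<lambda>u. concat (map (\<lambda>Lq. concat (map (\<lambda>Rq. concat (map (\<lambda>i.
        concat (map (\<lambda>cb. concat (map enco (item x ?N u (Lq, Rq, i, cb)))) combos)) (rev [0..<?m]))) (rev [0..<?N]))) (rev [0..<?N]))) (rev [0..<?N])))"
    proof -
      have v: "\<sigma> 1 = ?N" "(\<sigma>(2 := u)) 1 = ?N" "(\<sigma>(2 := u, 3 := Lq)) 1 = ?N" "(\<sigma>(2 := u, 3 := Lq, 4 := Rq)) 7 = ?m" for u Lq Rq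
        by (simp_all add: \<sigma>_def)
      have 1: "run (LOOP 5 7 INNER) (\<sigma>(2 := u, 3 := Lq, 4 := Rq)) [\<sigma>(2 := u, 3 := Lq, 4 := Rq)]
        (concat (map (\<lambda>i. concat (map (\<lambda>cb. concat (map enco (item x ?N u (Lq, Rq, i, cb)))) combos)) (rev [0..<?m])))" for u Lq Rq
        using run_LOOP[where r = 5 and s = 7 and a = INNER and \<sigma> = "\<sigma>(2 := u, 3 := Lq, 4 := Rq)", OF _ _ inner]
        unfolding v by (simp add: \<sigma>_def)
      have 2: "run (LOOP 4 1 (LOOP 5 7 INNER)) (\<sigma>(2 := u, 3 := Lq)) [\<sigma>(2 := u, 3 := Lq)]
        (concat (map (\<lambda>Rq. concat (map (\<lambda>i. concat (map (\<lambda>cb. concat (map enco (item x ?N u (Lq, Rq, i, cb)))) combos)) (rev [0..<?m]))) (rev [0..<?N])))" for u Lq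
        using run_LOOP[where r = 4 and s = 1 and a = "LOOP 5 7 INNER" and \<sigma> = "\<sigma>(2 := u, 3 := Lq)", OF _ _ 1]
        unfolding v by (simp add: \<sigma>_def)
      have 3: "run (LOOP 3 1 (LOOP 4 1 (LOOP 5 7 INNER))) (\<sigma>(2 := u)) [\<sigma>(2 := u)]
        (concat (map (\<lambda>Lq. concat (map (\<lambda>Rq. concat (map (\<lambda>i. concat (map (\<lambda>cb. concat (map enco (item x ?N u (Lq, Rq, i, cb)))) combos)) (rev [0..<?m]))) (rev [0..<?N]))) (rev [0..<?N])))" for u
        using run_LOOP[where r = 3 and s = 1 and a = "LOOP 4 1 (LOOP 5 7 INNER)" and \<sigma> = "\<sigma>(2 := u)", OF _ _ 2]
        unfolding v by (simp add: \<sigma>_def)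
      show ?thesis
        using run_LOOP[where r = 2 and s = 1 and a = "LOOP 3 1 (LOOP 4 1 (LOOP 5 7 INNER))" and \<sigma> = \<sigma>, OF _ _ 3]
        unfolding v NEST_def by (simp add: \<sigma>_def)
    qed
    then show ?thesis
      by (simp only: lays_def lay_def idx_def concat_product concat_map_concat)
  qed
  have pw: "run (SEQ (replicate EXP MUL)) ((\<lambda>_. 0)(7 := ?m, 1 := 1)) [\<sigma>] []"
    using run_POW[of 1 ?m EXP] assms(2) by (simp add: \<sigma>_def bigN_def)
  have i1: "evops [I 1] ((\<lambda>_. 0)(7 := ?m)) = (\<lambda>_. 0)(7 := ?m, 1 := 1)" by (auto simp: fun_eq_iff)
  have hd: "run (BLK (1, CC, 0)) \<sigma> [\<sigma>] (name [CC * ?N])"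
    using run_BLK[of \<sigma> "(1, CC, 0)"] by (simp add: \<sigma>_def del: BLK.simps)
  have zn: "run ZN \<sigma> [\<sigma>] (name [?N, 0, 0, 0, 0, 0] @ [SHash])"
  proof -
    let ?bs = "[(1, 1, 0), (0, 0, 0), (0, 0, 0), (0, 0, 0), (0, 0, 0), (0, 0, 0)] :: block list"
    have "run (NAME ?bs) \<sigma> [\<sigma>] (name (map (bv \<sigma>) ?bs))" by (rule run_NAME) (auto simp: \<sigma>_def)
    moreover have "map (bv \<sigma>) ?bs = [?N, 0, 0, 0, 0, 0]" by (simp add: \<sigma>_def)
    ultimately show ?thesis unfolding ZN_def by (intro run_seq_out[OF _ run_Out refl]) (simp only:)
  qed
  let ?z = "name [?N, 0, 0, 0, 0, 0] @ [SHash]"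
  let ?out = "name [CC * ?N] @ [SHash] @ [S0, S1, SHash] @ ?z @ [S1, S0, SHash] @ ?z @ [S1, S0, SHash] @ ?z @ [S0, S1, SHash] @ ?z
      @ concat (map enco (lays x ?N ?N))"
  have "run (BLK (1, CC, 0) ;; Out SHash ;;
      OUTS [S0, S1, SHash] ;; ZN ;; OUTS [S1, S0, SHash] ;; ZN ;; OUTS [S1, S0, SHash] ;; ZN ;; OUTS [S0, S1, SHash] ;; ZN ;; NEST) \<sigma> [\<sigma>] ?out"
    by (rule run_seq_out[OF hd run_seq_out[OF run_Out run_seq_out[OF run_OUTS run_seq_out[OF zn run_seq_out[OF run_OUTS
      run_seq_out[OF zn run_seq_out[OF run_OUTS run_seq_out[OF zn run_seq_out[OF run_OUTS run_seq_out[OF zn nest refl] refl]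
      refl] refl] refl] refl] refl] refl] refl] refl])
  from run_seq[OF pw this] have r1: "run REDPROG (\<lambda>_. 0) [\<sigma>] ?out"
    unfolding REDPROG_def by (intro run_seq[OF run_LEN[OF assms(1)]] run_OPS_seq) (use assms(1) i1 in simp_all)
  have "concat (map enc_gate (cnots (ids ps))) = concat (map enco ps)" for ps
    by (induction ps) (auto simp: enco_def)
  then have "redf x = ?out"
    by (simp add: redf_def Let_def enc_instance_def bin_nid)
  with r1 show ?thesis by auto
qed

text \<open>The exponent \<open>EXP + 2\<close> exceeds both 1 and \<open>EXP\<close>, which makes
  both size conditions of \<open>run_REDPROG\<close> strict.\<close>

lemma redf_computable: "logspace_computable redf"
proof (rule logspace_computable_of_program[OF cok_REDPROG, of "EXP + 2"])
  fix x
  let ?m = "length x + 2" and ?B = "(EXP + 2) * lg x"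
  have "?m ^ (EXP + 2) \<le> (2 ^ lg x) ^ (EXP + 2)" by (rule power_mono[OF two_pow_lg]) simp
  then have le: "?m ^ (EXP + 2) \<le> 2 ^ ?B" by (simp only: power_mult[symmetric] mult.commute)
  have "?m ^ 1 < ?m ^ (EXP + 2)" "?m ^ EXP < ?m ^ (EXP + 2)" by (rule power_strict_increasing; simp)+
  then have "?m < 2 ^ ?B" "bigN x < 2 ^ ?B" using le unfolding bigN_def by auto
  from run_REDPROG[OF this] obtain \<sigma> where "prog.run x ?B False REDPROG (\<lambda>_. 0) [\<sigma>] (redf x)" by blast
  from prog.G_of_run[OF this] show "prog.G x ?B False [REDPROG] (\<lambda>_. 0) True (redf x)" by simp
qed

text \<open>Exponentials in \<open>lg x\<close> become powers of \<open>m = length x + 2\<close> by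
  \<open>2 ^ lg x \<le> 2 * m \<le> m ^ 2\<close>, and a constant \<open>k\<close> is at most
  \<open>m ^ k\<close> because \<open>m \<ge> 2\<close>.\<close>

lemma bigN_bounds:
  shows "Suc K ^ (c * lg x) \<le> bigN x" "length x + 2 \<le> bigN x"
    "Q * (length x + 2) * Suc (c * lg x) * K ^ Suc (c * lg x) \<le> bigN x"
proof -
  let ?m = "length x + 2"
  have lg2: "2 ^ lg x \<le> ?m ^ 2"
  proof -
    have "2 * ?m \<le> ?m * ?m" by (rule mult_le_mono1) simp
    then show ?thesis using two_pow_lg_le[of x] unfolding power2_eq_square by linarith
  qed
  have two: "2 ^ k \<le> ?m ^ k" for k by (rule power_mono) auto
  have lgk: "(2 ^ lg x) ^ k \<le> ?m ^ (2 * k)" for k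
    using power_mono[OF lg2, of k] by (simp add: power_mult)
  have SK: "Suc K \<le> 2 ^ K" using less_exp[of K] by (simp add: Suc_le_eq)
  have a: "Suc K ^ (c * lg x) \<le> ?m ^ (2 * K * c)"
  proof -
    have "Suc K ^ (c * lg x) \<le> (2 ^ K) ^ (c * lg x)" by (rule power_mono[OF SK]) simp
    also have "\<dots> = (2 ^ lg x) ^ (K * c)" by (simp only: power_mult[symmetric] mult.commute mult.left_commute)
    also have "\<dots> \<le> ?m ^ (2 * (K * c))" by (rule lgk)
    finally show ?thesis by (simp add: mult.assoc)
  qed
  have q: "Q \<le> ?m ^ Q" using less_exp[of Q] two[of Q] by linarith
  have k: "K \<le> ?m ^ K" using less_exp[of K] two[of K] by linarith
  have w: "Suc (c * lg x) \<le> ?m ^ (2 * c)"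
  proof -
    have "Suc (c * lg x) \<le> 2 ^ (c * lg x)" using less_exp[of "c * lg x"] by (simp add: Suc_le_eq)
    also have "\<dots> = (2 ^ lg x) ^ c" by (simp only: power_mult[symmetric] mult.commute)
    finally show ?thesis using lgk[of c] by linarith
  qed
  have "K ^ Suc (c * lg x) \<le> Suc K ^ (c * lg x) * K" by (simp add: power_mono mult.commute)
  also have "\<dots> \<le> ?m ^ (2 * K * c) * ?m ^ K" by (rule mult_le_mono[OF a k])
  finally have t: "K ^ Suc (c * lg x) \<le> ?m ^ (2 * K * c) * ?m ^ K" .
  have "Q * ?m * Suc (c * lg x) * K ^ Suc (c * lg x) \<le> ?m ^ Q * ?m * ?m ^ (2 * c) * (?m ^ (2 * K * c) * ?m ^ K)"
    by (intro mult_le_mono q w t order.refl)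
  also have "\<dots> = bigN x" by (simp only: bigN_def EXP_def power_add power_one_right mult.assoc)
  finally show "Q * ?m * Suc (c * lg x) * K ^ Suc (c * lg x) \<le> bigN x" .
  have "?m ^ (2 * K * c) \<le> bigN x" unfolding bigN_def by (rule power_increasing) (auto simp: EXP_def)
  then show "Suc K ^ (c * lg x) \<le> bigN x" using a by linarith
  have "?m ^ 1 \<le> bigN x" unfolding bigN_def by (rule power_increasing) (auto simp: EXP_def)
  then show "?m \<le> bigN x" by simp
qed

text \<open>Termination alone gives no time bound, but the number of reachable configurations does.
  Cells beyond the space bound are blank, so a tape is determined by \<open>Suc (c * lg x)\<close>
  symbols.\<close>

lemma acc_paths_acc_below: "card (acc_paths M x) = acc_below M x (bigN x) ninit"
proof -
  let ?W = "c * lg x"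
  define ls where "ls = {l. set l \<subseteq> {..<K} \<and> length l = Suc ?W}"
  define S where "S = (\<lambda>(q, i, w, l). (q, i, (\<lambda>j. if j < length l then l ! j else 0), w)) `
      ({..<Q} \<times> {..<length x + 2} \<times> {..<Suc ?W} \<times> ls)"
  have fls: "finite ls" "card ls = K ^ Suc ?W"
    unfolding ls_def using finite_lists_length_eq[of "{..<K}"] card_lists_length_eq[of "{..<K}"] by simp_all
  have fS: "finite S" unfolding S_def using fls by blast
  have "card S \<le> card ({..<Q} \<times> {..<length x + 2} \<times> {..<Suc ?W} \<times> ls)"
    unfolding S_def by (rule card_image_le) (use fls in blast)
  also have "\<dots> = Q * (length x + 2) * Suc ?W * K ^ Suc ?W" by (simp only: card_cartesian_product card_lessThan fls mult.assoc)
  finally have cS: "card S \<le> bigN x" using bigN_bounds(3)[of x] by linarith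
  have inS: "cf \<in> S" if r: "reach x cf" for cf
  proof -
    obtain q i t w where cf: "cf = (q, i, t, w)" by (cases cf)
    have inv: "q < Q" "i \<le> Suc (length x)" "w \<le> ?W" "\<forall>j. t j < K" "\<forall>j > ?W. t j = 0"
      using reach_inv r cf by blast+
    let ?l = "map t [0..<Suc ?W]"
    have "t = (\<lambda>j. if j < length ?l then ?l ! j else 0)" using inv by (auto simp: fun_eq_iff simp del: upt_Suc)
    moreover have "?l \<in> ls" using inv by (auto simp: ls_def simp del: upt_Suc)
    moreover have "(q, i, w, ?l) \<in> {..<Q} \<times> {..<length x + 2} \<times> {..<Suc ?W} \<times> ls"
      using inv calculation(2) by (simp del: upt_Suc)
    ultimately show ?thesis unfolding S_def cf by (intro image_eqI[of _ _ "(q, i, w, ?l)"]) (simp_all only: prod.case)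
  qed
  have fin: "finite (nchoices M x cf)" if "reach x cf" for cf
  proof -
    obtain q i t w where cf: "cf = (q, i, t, w)" by (cases cf)
    have "q < Q" "t w < K" using reach_inv that cf by blast+
    then show ?thesis using wf cf by (auto simp: ntm_wf_def)
  qed
  have "no_inf M x ninit" using tm[of x] by (simp add: ntm_terminates_def no_inf_def)
  from path_length_bound[OF this fS inS] cS
  have "valid_path M x ninit trs \<Longrightarrow> length trs < bigN x" for trs by (meson less_le_trans)
  from card_apaths_acc_below[OF fin this] show ?thesis by (simp add: acc_paths_apaths)
qed

definition small :: "block list \<Rightarrow> bool" where
  "small bs \<longleftrightarrow> length bs \<le> 6 \<and> (\<forall>(r, k, c') \<in> set bs. k \<le> DD \<and> c' \<le> DD)"

lemma small_name:
  assumes "small bs" "\<And>r. e r \<le> N" "1 \<le> N"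
  shows "length (name (map (bv e) bs)) \<le> CC * N"
proof -
  have "n \<le> DD * N + DD" if n: "n \<in> set (map (bv e) bs)" for n
  proof -
    obtain r k c' where "(r, k, c') \<in> set bs" "n = k * e r + c'" using n by auto
    moreover then have "k \<le> DD" "c' \<le> DD" using assms(1) by (auto simp: small_def)
    ultimately show ?thesis using assms(2)[of r] by (simp add: add_mono mult_le_mono)
  qed
  then have "sum_list (map (bv e) bs) \<le> length (map (bv e) bs) * (DD * N + DD)" by (rule sum_list_le)
  also have "\<dots> \<le> 6 * (DD * N + DD)" using assms(1) by (intro mult_le_mono1) (simp add: small_def)
  finally have "length (name (map (bv e) bs)) \<le> 6 + 6 * (DD * N + DD)"
    using assms(1) unfolding length_name small_def by simp
  also have "\<dots> \<le> 6 * N + 6 * (DD * N + DD * N)" using assms(3) by (intro add_mono mult_le_mono2) auto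
  also have "\<dots> = CC * N" by (simp add: CC_def algebra_simps)
  finally show ?thesis .
qed

lemma small_gates:
  assumes "(s, t) \<in> set (gatesAt ce (q, a, d, r))" "q < Q" "a < K" "d < Suc K" "r < K"
  shows "small s \<and> small t"
proof -
  have b: "Suc K * Suc K \<le> DD" "q \<le> DD" "1 \<le> DD" "Suc K \<le> DD" "K \<le> DD" "d \<le> DD" "r \<le> DD" "a \<le> DD" "K * K \<le> DD"
    using assms(2-) by (simp_all add: DD_def)
  have s: "s = srcB q a d r" using assms(1) by (auto split: if_splits)
  have "small (tgtB ce d r tr)" if tr: "tr \<in> set (trl q ce a)" for tr
  proof -
    obtain q' di s' dw where e: "tr = (q', di, s', dw)" by (metis prod_cases4)
    have "q' < Q" "s' < K" using delta_in[OF assms(2,3)] trl[OF assms(2,3)] tr e by blast+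
    moreover have "d * Suc K \<le> K * Suc K" "r * K \<le> K * K" using assms by (intro mult_le_mono1; simp)+
    moreover have "K * Suc K = K * K + K" "DD = K * K + 2 * K + 1 + Q" by (simp_all add: DD_def)
    ultimately have "q' \<le> DD" "s' \<le> DD" "d * Suc K + Suc s' \<le> DD" "r * K + s' \<le> DD" by linarith+
    then show ?thesis using b by (cases di; cases dw) (auto simp: small_def e simp del: mult_Suc mult_Suc_right)
  qed
  then have "small t" using assms(1) b by (auto simp: small_def[of "[(0, 0, 0)]"] split: if_splits)
  then show ?thesis using b by (simp add: s small_def srcB_def del: mult_Suc mult_Suc_right)
qed

lemma lays_name_bound:
  assumes "(s, t) \<in> set (lays x (bigN x) (bigN x))"
  shows "length (name s) \<le> CC * bigN x \<and> length (name t) \<le> CC * bigN x"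
proof -
  let ?N = "bigN x"
  obtain u j where u: "u < ?N" "j \<in> set (idx x ?N)" "(s, t) \<in> set (item x ?N u j)"
    using assms by (auto simp: lays_def lay_def)
  obtain Lq Rq i q a d r where j: "j = (Lq, Rq, i, q, a, d, r)" by (metis prod_cases7)
  have b: "Lq < ?N" "Rq < ?N" "i < length x + 2" "q < Q" "a < K" "d < Suc K" "r < K"
    using u(2) by (simp_all add: j idx_def combos_def del: upt_Suc)
  have m: "length x + 2 \<le> ?N" by (rule bigN_bounds(2))
  let ?e = "env ?N (length x + 2) u Lq Rq i"
  have e: "?e r \<le> ?N" for r using b u(1) m by (auto simp: env_def)
  obtain s' t' where st: "(s', t') \<in> set (gatesAt (read_in x i) (q, a, d, r))" "s = map (bv ?e) s'" "t = map (bv ?e) t'"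
    using u(3) unfolding item_def j prod.case by auto
  have "small s'" "small t'" using small_gates[OF st(1) b(4-)] by auto
  then show ?thesis using small_name[of _ ?e ?N] e m st by simp
qed

theorem reduction: "x \<in> {x. odd (card (acc_paths M x))} \<longleftrightarrow> redf x \<in> GK"
proof -
  let ?N = "bigN x"
  let ?z = "nid [?N, 0, 0, 0, 0, 0]"
  let ?ps = "ids (lays x ?N ?N)"
  let ?gs = "[Hadamard ?z, Phase ?z, Phase ?z, Hadamard ?z] @ cnots ?ps"
  let ?n = "nid [CC * ?N]"
  have ne: "s \<noteq> [] \<and> t \<noteq> [] \<and> s \<noteq> t" if st: "(s, t) \<in> set (lays x ?N ?N)" for s t
  proof -
    obtain u where "(s, t) \<in> set (lay x ?N u)" using st by (auto simp: lays_def)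
    from lay_src[OF this] lay_tgt[OF this] show ?thesis by auto
  qed
  have d: "a \<noteq> b" if "(a, b) \<in> set ?ps" for a b
    using that ne nid_inj by force
  have t0: "encL K (\<lambda>_. 0) 0 = 0" "encR K (\<lambda>_. 0) w k = 0" for w k
    by simp (induction k arbitrary: w; simp)
  \<comment> \<open>This is the name printed by \<open>ZN\<close>: start state, blank and both head
    positions are 0, and the start lies in the top layer.\<close>
  have z: "tp x ?N ninit = [?N, 0, 0, 0, 0, 0]" by (simp add: tp_def ninit_def t0)
  have "odd (card (acc_paths M x)) \<longleftrightarrow> odd (cn ?ps ?z)"
    using cn_lays[OF bigN_bounds(1), of x ninit ?N] acc_paths_acc_below[of x] by (simp add: z)
  also have "\<dots> \<longleftrightarrow> qubit1_certainly_one ?gs" by (rule certainly_one_cnots[symmetric]) (rule d)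
  also have "\<dots> \<longleftrightarrow> redf x \<in> GK"
  proof
    assume q: "qubit1_certainly_one ?gs"
    have N1: "?N \<ge> 2" using bigN_bounds(2)[of x] by linarith
    have v: "valid_qubit ?n (nid ns)" if "ns \<noteq> []" "length (name ns) \<le> CC * ?N" for ns
      using nid_pos[OF that(1)] nid_le[OF that(2)] by (simp add: valid_qubit_def)
    have "6 + ?N \<le> CC * ?N" using N1 by (simp add: CC_def algebra_simps)
    then have vz: "valid_qubit ?n ?z" by (intro v) (simp_all add: length_name del: name_simps)
    have "gate_wf ?n g" if "g \<in> set ?gs" for g
    proof (cases "g \<in> set (cnots ?ps)")
      case True
      then obtain s t where st: "(s, t) \<in> set (lays x ?N ?N)" "g = CNOT (nid s) (nid t)" by (auto simp: cnots_def)
      have "nid s \<noteq> nid t" using d st(1) by force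
      then show ?thesis using v[of s] v[of t] ne[OF st(1)] lays_name_bound[OF st(1)] st(2) by simp
    next
      case False
      then show ?thesis using that vz by auto
    qed
    moreover have "?n \<ge> 1" by (rule nid_pos) simp
    ultimately have "circuit_wf ?n ?gs" unfolding circuit_wf_def by blast
    then show "redf x \<in> GK" using q unfolding GK_def redf_def Let_def by blast
  next
    assume "redf x \<in> GK"
    then obtain n gs where g: "enc_instance ?n ?gs = enc_instance n gs" "qubit1_certainly_one gs"
      by (auto simp: GK_def redf_def Let_def)
    \<comment> \<open>Unique decoding identifies the circuit behind the string with this one, so
      membership speaks about this very circuit.\<close>
    from g(1) have "bin ?n @ SHash # enc ?gs = bin n @ SHash # enc gs"
      unfolding enc_instance_def enc_def by (simp only: append.simps append_assoc)
    from bin_split[OF this] have "enc ?gs = enc gs" by blast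
    then have "?gs = gs" by (rule enc_inj)
    then show "qubit1_certainly_one ?gs" using g(2) by (simp only:)
  qed
  finally show ?thesis by simp
qed

end

theorem theorem4:
  shows "GK \<in> parityL \<and> (\<forall>A \<in> parityL. logspace_reducible A GK)"
proof (intro conjI ballI)
  show "GK \<in> parityL" by (rule GK_in_parityL)
  fix A assume "A \<in> parityL"
  then obtain M c where M: "ntm_wf M" "\<And>x. ntm_terminates M x"
    "\<And>x cf. (nsucc M x)\<^sup>*\<^sup>* ninit cf \<Longrightarrow> logspace_bound c x (nwork_head cf)"
    "\<And>x. x \<in> A \<longleftrightarrow> odd (card (acc_paths M x))"
    unfolding parityL_def by blast
  interpret red M c by unfold_locales (use M in auto)
  show "logspace_reducible A GK"
    unfolding logspace_reducible_def using redf_computable reduction M(4) by auto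
qed

end
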